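(* Let $(M,g)$ be a Lorentzian manifold of dimension $n+2$ with a codimension $1$ foliation $\mathcal{F}$ that is lightlike and totally geodesic. Then around every point $M$ admits local coordinates $(u,v,x^1,\dots,x^n)$ adapted to $\mathcal{F}$, in which the metric has the form $$g=2\,du\,dv+H(u,v,x)\,du^2+\sum_{i=1}^{n}W_i(u,v,x)\,du\,dx^i+\sum_{i,j=1}^{n}h_{ij}(u,x)\,dx^i\,dx^j,$$ where $x=(x^1,\dots,x^n)$, $H$, $W_i$, $h_{ij}$ are functions of the indicated variables (in particular the $h_{ij}$ do not depend on $v$).
   Context: A foliation $\mathcal{F}$ of a Lorentzian manifold $(M,g)$ is lightlike if for every $x\in M$ the restriction of $g$ to $T_x\mathcal{F}$ is degenerate. It is totally geodesic if its leaves are totally geodesic: every geodesic of $M$ that is somewhere tangent to a leaf is locally contained in this leaf; equivalently, $\nabla_XY$ is tangent to $\mathcal{F}$ for all vector fields $X,Y$ tangent to $\mathcal{F}$, where $\nabla$ is the Levi-Civita connection. Coordinates $(u,v,x^1,\dots,x^n)$ are adapted to $\mathcal{F}$ if the leaves of $\mathcal{F}$ are locally the levels of $u$ and $\partial_v$ is tangent to the normal foliation $\mathcal{V}$, the $1$-dimensional foliation tangent to the line field $T\mathcal{F}^{\perp}\subset T\mathcal{F}$. Products of differentials denote symmetric products, so that $2\,du\,dv=du\otimes dv+dv\otimes du$. Standing convention: $M$, $\mathcal{F}$ and $\mathcal{V}$ are orientable. All data are smooth. *)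

theory Defs
  imports "HOL-Analysis.Analysis" "HOL-Library.Disjoint_Sets" "HOL-Combinatorics.Permutations"
begin

section \<open>Smooth maps between Euclidean spaces\<close>

text \<open>The sets \<open>S\<close> below are always open. Continuity of all iterated directional derivatives
  is equivalent to continuous Frechet differentiability, because the source has finite dimension.\<close>

primrec Ck_on :: "nat \<Rightarrow> 'a::euclidean_space set \<Rightarrow> ('a \<Rightarrow> 'b::real_normed_vector) \<Rightarrow> bool" where
  "Ck_on 0 S f \<longleftrightarrow> continuous_on S f"
| "Ck_on (Suc k) S f \<longleftrightarrow>
     (\<forall>x\<in>S. f differentiable (at x)) \<and>
     (\<forall>v. Ck_on k S (\<lambda>x. frechet_derivative f (at x) v))"

definition smooth_on :: "'a::euclidean_space set \<Rightarrow> ('a \<Rightarrow> 'b::real_normed_vector) \<Rightarrow> bool" where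
  "smooth_on S f \<longleftrightarrow> (\<forall>k. Ck_on k S f)"


section \<open>Smooth manifolds\<close>

text \<open>A chart is a pair of a domain and a coordinate map; the values of the coordinate map outside
  the domain are irrelevant. The underlying space of a manifold is an abstract topology \<open>X\<close>, and its
  smooth structure is a maximal atlas \<open>A\<close>; so the local coordinate systems of the manifold are
  exactly the members of \<open>A\<close>. The dimension is \<open>CARD('d)\<close>.\<close>

type_synonym ('m, 'd) chart = "'m set \<times> ('m \<Rightarrow> real ^ 'd)"

definition chart_image :: "('m, 'd) chart \<Rightarrow> (real ^ 'd) set" where
  "chart_image c = snd c ` fst c"

definition is_chart :: "'m topology \<Rightarrow> ('m, 'd::finite) chart \<Rightarrow> bool" where
  "is_chart X c \<longleftrightarrow>
     openin X (fst c) \<and> open (chart_image c) \<and>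
     homeomorphic_map (subtopology X (fst c)) (top_of_set (chart_image c)) (snd c)"

definition transition :: "('m, 'd) chart \<Rightarrow> ('m, 'd) chart \<Rightarrow> real ^ 'd \<Rightarrow> real ^ 'd" where
  "transition c c' = snd c' \<circ> inv_into (fst c) (snd c)"

definition compatible :: "('m, 'd::finite) chart \<Rightarrow> ('m, 'd) chart \<Rightarrow> bool" where
  "compatible c c' \<longleftrightarrow>
     smooth_on (snd c ` (fst c \<inter> fst c')) (transition c c') \<and>
     smooth_on (snd c' ` (fst c \<inter> fst c')) (transition c' c)"

definition smooth_structure :: "'m topology \<Rightarrow> ('m, 'd::finite) chart set \<Rightarrow> bool" where
  "smooth_structure X A \<longleftrightarrow>
     (\<forall>c\<in>A. is_chart X c) \<and>
     (\<Union>c\<in>A. fst c) = topspace X \<and>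
     (\<forall>c\<in>A. \<forall>c'\<in>A. compatible c c') \<and>
     (\<forall>c. is_chart X c \<and> (\<forall>c'\<in>A. compatible c c') \<longrightarrow> c \<in> A)"

definition smooth_manifold :: "'m topology \<Rightarrow> ('m, 'd::finite) chart set \<Rightarrow> bool" where
  "smooth_manifold X A \<longleftrightarrow> Hausdorff_space X \<and> second_countable X \<and> smooth_structure X A"


section \<open>Tangent vectors, vector fields, orientability\<close>

text \<open>A tangent vector at \<open>p\<close> is the family of its component vectors in all charts around \<open>p\<close>,
  related to each other by the Jacobians of the transition maps. It is set to \<open>0\<close> on all other
  charts, so that equality of tangent vectors at \<open>p\<close> is equality of functions.\<close>

type_synonym ('m, 'd) tangent_vector = "('m, 'd) chart \<Rightarrow> real ^ 'd"

definition tangent_space ::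
    "('m, 'd::finite) chart set \<Rightarrow> 'm \<Rightarrow> ('m, 'd) tangent_vector set" where
  "tangent_space A p =
     {\<xi>. (\<forall>c\<in>A. \<forall>c'\<in>A. p \<in> fst c \<and> p \<in> fst c' \<longrightarrow>
             \<xi> c' = frechet_derivative (transition c c') (at (snd c p)) (\<xi> c)) \<and>
         (\<forall>c. \<not> (c \<in> A \<and> p \<in> fst c) \<longrightarrow> \<xi> c = 0)}"

text \<open>The vector \<open>\<partial>\<^sub>k\<close> of the chart \<open>c\<close> at \<open>p\<close>.\<close>

definition coord_vector ::
    "('m, 'd::finite) chart set \<Rightarrow> ('m, 'd) chart \<Rightarrow> 'd \<Rightarrow> 'm \<Rightarrow> ('m, 'd) tangent_vector" where
  "coord_vector A c k p =
     (\<lambda>c'. if c' \<in> A \<and> p \<in> fst c'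
           then frechet_derivative (transition c c') (at (snd c p)) (axis k 1) else 0)"

text \<open>The differential of the \<open>k\<close>-th coordinate function of \<open>c\<close>, at any point of its domain.\<close>

definition coord_differential ::
    "('m, 'd::finite) chart \<Rightarrow> 'd \<Rightarrow> ('m, 'd) tangent_vector \<Rightarrow> real" where
  "coord_differential c k \<xi> = \<xi> c $ k"

definition smooth_vector_field ::
    "('m, 'd::finite) chart set \<Rightarrow> 'm set \<Rightarrow> ('m \<Rightarrow> ('m, 'd) tangent_vector) \<Rightarrow> bool" where
  "smooth_vector_field A W E \<longleftrightarrow>
     (\<forall>p\<in>W. E p \<in> tangent_space A p) \<and>
     (\<forall>c\<in>A. smooth_on (snd c ` (fst c \<inter> W)) (\<lambda>y. E (inv_into (fst c) (snd c) y) c))"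

definition lin_comb ::
    "nat \<Rightarrow> (nat \<Rightarrow> real) \<Rightarrow> (nat \<Rightarrow> ('m, 'd::finite) tangent_vector) \<Rightarrow> ('m, 'd) tangent_vector" where
  "lin_comb r a e = (\<lambda>c. \<Sum>i<r. a i *\<^sub>R e i c)"

definition is_basis ::
    "nat \<Rightarrow> ('m, 'd::finite) tangent_vector set \<Rightarrow> (nat \<Rightarrow> ('m, 'd) tangent_vector) \<Rightarrow> bool" where
  "is_basis r V e \<longleftrightarrow>
     V = range (\<lambda>a. lin_comb r a e) \<and>
     (\<forall>a. lin_comb r a e = (\<lambda>c. 0) \<longrightarrow> (\<forall>i<r. a i = 0))"

text \<open>A local frame of a distribution \<open>D\<close> of rank \<open>r\<close>.\<close>

definition local_frame ::
    "'m topology \<Rightarrow> ('m, 'd::finite) chart set \<Rightarrow> nat \<Rightarrow> ('m \<Rightarrow> ('m, 'd) tangent_vector set) \<Rightarrow>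
     'm set \<Rightarrow> (nat \<Rightarrow> 'm \<Rightarrow> ('m, 'd) tangent_vector) \<Rightarrow> bool" where
  "local_frame X A r D W E \<longleftrightarrow>
     openin X W \<and> (\<forall>i<r. smooth_vector_field A W (E i)) \<and>
     (\<forall>p\<in>W. is_basis r (D p) (\<lambda>i. E i p))"

text \<open>The determinant of an \<open>r \<times> r\<close> matrix whose size \<open>r\<close> is not given by a type.\<close>

definition nat_det :: "nat \<Rightarrow> (nat \<Rightarrow> nat \<Rightarrow> real) \<Rightarrow> real" where
  "nat_det r a = (\<Sum>\<pi> | \<pi> permutes {..<r}. of_int (sign \<pi>) * (\<Prod>i<r. a i (\<pi> i)))"

definition orientable_distribution ::
    "'m topology \<Rightarrow> ('m, 'd::finite) chart set \<Rightarrow> nat \<Rightarrow> ('m \<Rightarrow> ('m, 'd) tangent_vector set) \<Rightarrow> bool"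
  where
  "orientable_distribution X A r D \<longleftrightarrow>
     (\<exists>Fr. (\<forall>(W, E)\<in>Fr. local_frame X A r D W E) \<and>
           (\<Union>(W, E)\<in>Fr. W) = topspace X \<and>
           (\<forall>(W, E)\<in>Fr. \<forall>(W', E')\<in>Fr. \<forall>p\<in>W \<inter> W'. \<exists>a.
              (\<forall>j<r. E' j p = lin_comb r (\<lambda>i. a i j) (\<lambda>i. E i p)) \<and> nat_det r a > 0))"


section \<open>Lorentzian metrics and geodesics\<close>

type_synonym ('m, 'd) metric =
  "'m \<Rightarrow> ('m, 'd) tangent_vector \<Rightarrow> ('m, 'd) tangent_vector \<Rightarrow> real"

text \<open>The matrix of the metric with respect to a chart \<open>c\<close>, as a function on the image of \<open>c\<close>.\<close>

definition gram ::
    "('m, 'd::finite) chart set \<Rightarrow> ('m, 'd) metric \<Rightarrow> ('m, 'd) chart \<Rightarrow> real ^ 'd \<Rightarrow> real ^ 'd ^ 'd" where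
  "gram A g c y =
     (let p = inv_into (fst c) (snd c) y
      in \<chi> i j. g p (coord_vector A c i p) (coord_vector A c j p))"

text \<open>Signature \<open>(-, +, \<dots>, +)\<close>. The \<open>CARD('d)\<close> orthonormal vectors \<open>e i\<close> are automatically
  linearly independent, hence a basis of the tangent space.\<close>

definition lorentzian_metric ::
    "'m topology \<Rightarrow> ('m, 'd::finite) chart set \<Rightarrow> ('m, 'd) metric \<Rightarrow> bool" where
  "lorentzian_metric X A g \<longleftrightarrow>
     (\<forall>p\<in>topspace X.
        (\<forall>\<xi>\<in>tangent_space A p. \<forall>\<eta>\<in>tangent_space A p. g p \<xi> \<eta> = g p \<eta> \<xi>) \<and>
        (\<forall>\<xi>\<in>tangent_space A p. \<forall>\<zeta>\<in>tangent_space A p. \<forall>\<eta>\<in>tangent_space A p. \<forall>a b.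
           g p (\<lambda>c. a *\<^sub>R \<xi> c + b *\<^sub>R \<zeta> c) \<eta> = a * g p \<xi> \<eta> + b * g p \<zeta> \<eta>) \<and>
        (\<exists>(e :: 'd \<Rightarrow> ('m, 'd) tangent_vector) i0. (\<forall>i. e i \<in> tangent_space A p) \<and>
           (\<forall>i j. g p (e i) (e j) = (if i = j then if i = i0 then - 1 else 1 else 0)))) \<and>
     (\<forall>c\<in>A. smooth_on (chart_image c) (gram A g c))"

text \<open>The Christoffel symbols \<open>\<Gamma>\<^sup>k\<^sub>i\<^sub>j\<close> of the Levi-Civita connection.\<close>

definition christoffel ::
    "('m, 'd::finite) chart set \<Rightarrow> ('m, 'd) metric \<Rightarrow> ('m, 'd) chart \<Rightarrow> 'd \<Rightarrow> 'd \<Rightarrow> 'd \<Rightarrow> real ^ 'd \<Rightarrow> real"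
  where
  "christoffel A g c k i j y =
     (let G = gram A g c;
          d = (\<lambda>l a b. frechet_derivative (\<lambda>z. G z $ a $ b) (at y) (axis l 1))
      in (1 / 2) * (\<Sum>l\<in>UNIV. matrix_inv (G y) $ k $ l * (d i j l + d j i l - d l i j)))"

definition smooth_curve ::
    "'m topology \<Rightarrow> ('m, 'd::finite) chart set \<Rightarrow> real set \<Rightarrow> (real \<Rightarrow> 'm) \<Rightarrow> bool" where
  "smooth_curve X A J \<gamma> \<longleftrightarrow>
     open J \<and> is_interval J \<and> continuous_map (top_of_set J) X \<gamma> \<and>
     (\<forall>c\<in>A. smooth_on {t \<in> J. \<gamma> t \<in> fst c} (snd c \<circ> \<gamma>))"

definition velocity ::
    "('m, 'd::finite) chart set \<Rightarrow> (real \<Rightarrow> 'm) \<Rightarrow> real \<Rightarrow> ('m, 'd) tangent_vector" where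
  "velocity A \<gamma> t =
     (\<lambda>c. if c \<in> A \<and> \<gamma> t \<in> fst c then vector_derivative (snd c \<circ> \<gamma>) (at t) else 0)"

text \<open>The geodesic equation \<open>\<nabla>\<^bsub>\<gamma>'\<^esub> \<gamma>' = 0\<close> in coordinates.\<close>

definition geodesic ::
    "'m topology \<Rightarrow> ('m, 'd::finite) chart set \<Rightarrow> ('m, 'd) metric \<Rightarrow> real set \<Rightarrow> (real \<Rightarrow> 'm) \<Rightarrow> bool"
  where
  "geodesic X A g J \<gamma> \<longleftrightarrow>
     smooth_curve X A J \<gamma> \<and>
     (\<forall>c\<in>A. \<forall>t\<in>J. \<gamma> t \<in> fst c \<longrightarrow>
        (\<forall>k. vector_derivative (\<lambda>s. velocity A \<gamma> s c) (at t) $ k +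
             (\<Sum>i\<in>UNIV. \<Sum>j\<in>UNIV. christoffel A g c k i j (snd c (\<gamma> t)) *
                velocity A \<gamma> t c $ i * velocity A \<gamma> t c $ j) = 0))"


section \<open>Foliations of codimension one\<close>

text \<open>A foliation is given by its set \<open>F\<close> of leaves. In the chart \<open>c\<close>, the leaves are locally the
  levels of the \<open>k\<close>-th coordinate: the plaques, i.e. the connected components of the trace of a
  leaf on the domain of \<open>c\<close>, are levels.\<close>

definition foliated_chart ::
    "'m topology \<Rightarrow> 'm set set \<Rightarrow> ('m, 'd::finite) chart \<Rightarrow> 'd \<Rightarrow> bool" where
  "foliated_chart X F c k \<longleftrightarrow>
     (\<forall>L\<in>F. \<forall>P\<in>connected_components_of (subtopology X (fst c \<inter> L)).
        \<exists>r. P = {q \<in> fst c. snd c q $ k = r})"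

text \<open>Path-connectedness of the leaves, rather than connectedness as subsets of the manifold, is
  needed: the union of two dense leaves is a connected subset.\<close>

definition codim1_foliation ::
    "'m topology \<Rightarrow> ('m, 'd::finite) chart set \<Rightarrow> 'm set set \<Rightarrow> bool" where
  "codim1_foliation X A F \<longleftrightarrow>
     partition_on (topspace X) F \<and>
     (\<forall>L\<in>F. path_connectedin X L) \<and>
     (\<forall>p\<in>topspace X. \<exists>c\<in>A. \<exists>k. p \<in> fst c \<and> foliated_chart X F c k)"

definition foliation_tangent ::
    "'m topology \<Rightarrow> ('m, 'd::finite) chart set \<Rightarrow> 'm set set \<Rightarrow> 'm \<Rightarrow> ('m, 'd) tangent_vector set" where
  "foliation_tangent X A F p =
     {\<xi> \<in> tangent_space A p.
        \<exists>c\<in>A. \<exists>k. p \<in> fst c \<and> foliated_chart X F c k \<and> coord_differential c k \<xi> = 0}"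

text \<open>The field \<open>T F\<^sup>\<bottom>\<close>, tangent to the normal foliation if \<open>F\<close> is lightlike.\<close>

definition foliation_normal ::
    "'m topology \<Rightarrow> ('m, 'd::finite) chart set \<Rightarrow> ('m, 'd) metric \<Rightarrow> 'm set set \<Rightarrow> 'm \<Rightarrow>
     ('m, 'd) tangent_vector set" where
  "foliation_normal X A g F p =
     {\<xi> \<in> tangent_space A p. \<forall>\<eta>\<in>foliation_tangent X A F p. g p \<xi> \<eta> = 0}"

definition lightlike ::
    "'m topology \<Rightarrow> ('m, 'd::finite) chart set \<Rightarrow> ('m, 'd) metric \<Rightarrow> 'm set set \<Rightarrow> bool" where
  "lightlike X A g F \<longleftrightarrow>
     (\<forall>p\<in>topspace X. \<exists>\<xi>\<in>foliation_tangent X A F p.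
        \<xi> \<noteq> (\<lambda>c. 0) \<and> (\<forall>\<eta>\<in>foliation_tangent X A F p. g p \<xi> \<eta> = 0))"

definition totally_geodesic ::
    "'m topology \<Rightarrow> ('m, 'd::finite) chart set \<Rightarrow> ('m, 'd) metric \<Rightarrow> 'm set set \<Rightarrow> bool" where
  "totally_geodesic X A g F \<longleftrightarrow>
     (\<forall>J \<gamma> t0 L. geodesic X A g J \<gamma> \<and> t0 \<in> J \<and> L \<in> F \<and> \<gamma> t0 \<in> L \<and>
        velocity A \<gamma> t0 \<in> foliation_tangent X A F (\<gamma> t0) \<longrightarrow>
        (\<exists>\<delta>>0. \<forall>t\<in>J. \<bar>t - t0\<bar> < \<delta> \<longrightarrow> \<gamma> t \<in> L))"

text \<open>The coordinates of \<open>c\<close> are adapted to \<open>F\<close>, with \<open>ku\<close> and \<open>kv\<close> the indices of \<open>u\<close> and \<open>v\<close>.\<close>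

definition adapted_chart ::
    "'m topology \<Rightarrow> ('m, 'd::finite) chart set \<Rightarrow> ('m, 'd) metric \<Rightarrow> 'm set set \<Rightarrow>
     ('m, 'd) chart \<Rightarrow> 'd \<Rightarrow> 'd \<Rightarrow> bool" where
  "adapted_chart X A g F c ku kv \<longleftrightarrow>
     foliated_chart X F c ku \<and>
     (\<forall>p\<in>fst c. coord_vector A c kv p \<in> foliation_normal X A g F p)"


section \<open>Coordinate expressions\<close>

definition sym_prod :: "('t \<Rightarrow> real) \<Rightarrow> ('t \<Rightarrow> real) \<Rightarrow> 't \<Rightarrow> 't \<Rightarrow> real" where
  "sym_prod \<alpha> \<beta> \<xi> \<eta> = (\<alpha> \<xi> * \<beta> \<eta> + \<beta> \<xi> * \<alpha> \<eta>) / 2"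

text \<open>On \<open>S\<close>, the function \<open>f\<close> is a function of the coordinates other than the \<open>k\<close>-th one.\<close>

definition independent_of_coord :: "'d \<Rightarrow> (real ^ 'd) set \<Rightarrow> (real ^ 'd \<Rightarrow> real) \<Rightarrow> bool" where
  "independent_of_coord k S f \<longleftrightarrow>
     (\<forall>y\<in>S. \<forall>z\<in>S. (\<forall>l. l \<noteq> k \<longrightarrow> y $ l = z $ l) \<longrightarrow> f y = f z)"

end

theory Submission
  imports Defs
begin

text \<open>Let \<open>u\<close> be a local defining function of \<open>\<F>\<close>. Since \<open>\<F>\<close> is lightlike, the gradient \<open>V\<close> of \<open>u\<close>
  is tangent to \<open>\<F>\<close> and spans \<open>T \<F>\<^sup>\<bottom>\<close>. A flow box of \<open>V\<close> does not change \<open>u\<close> and gives coordinates with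
  \<open>\<partial>\<^sub>v = V\<close>, so that \<open>g (\<partial>\<^sub>v, \<cdot>) = du\<close>: this fixes all coefficients involving \<open>v\<close>. In these
  coordinates \<open>\<Gamma>\<^sup>u\<^sub>i\<^sub>j = -1/2 \<partial>\<^sub>v h\<^sub>i\<^sub>j\<close>. A geodesic with initial velocity \<open>\<xi>\<close> tangent to a leaf stays in that
  leaf, so \<open>u\<close> is constant along it and \<open>\<Gamma>\<^sup>u\<^sub>i\<^sub>j \<xi>\<^sup>i \<xi>\<^sup>j = 0\<close>; hence \<open>\<partial>\<^sub>v h\<^sub>i\<^sub>j = 0\<close>.

  Both the flow box and the geodesics need smooth dependence of solutions of differential equations on
  parameters. The derivative of the solution in a parameter solves an equation of the same form, so
  smoothness follows by induction on the order; on a time interval so short that the Lipschitz constant times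
  its length is at most \<open>1/2\<close>, all estimates are contraction estimates.\<close>

section \<open>Calculus of \<open>C\<^sup>k\<close> maps\<close>

text \<open>The gradient, and not just any field spanning the normal line, is what normalizes the
  form: \<open>g (\<partial>\<^sub>v, _) = du\<close> makes the coefficient of \<open>du dv\<close>
  constant and excludes \<open>dv^2\<close> and \<open>dv dx^i\<close> at once. Total geodesy is
  given in terms of geodesics. So geodesics must be produced in every direction tangent to a leaf,
  and an integral curve of the spray in one chart is a geodesic only after its equation has been
  verified in every chart of the maximal atlas. The transformation law needed for this is proved for
  the weak form of the equation, paired with a test vector, where no rule for Christoffel symbols is
  involved. In the induction for smooth dependence the linearized equation inherits the Lipschitz
  constant \<open>L\<close>, so the one condition \<open>r * L \<le> 1/2\<close> serves all orders.
  The new chart has a cube as image: the levels of \<open>u\<close> in it are convex, hence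
  connected, and segments in the direction of \<open>v\<close> remain inside.\<close>

lemma has_derivative_frechet:
  assumes "Ck_on (Suc k) S f" "x \<in> S"
  shows "(f has_derivative frechet_derivative f (at x)) (at x)"
  using assms by (simp add: frechet_derivative_works[symmetric])

text \<open>Regularity is tested on an explicit derivative \<open>f'\<close>, which matches the one
  chosen by \<open>frechet_derivative\<close> only on \<open>S\<close>. The inner fact
  \<open>*\<close> bridges this: on an open set the class depends only on the values there, at every
  order, since derivatives at a point of \<open>S\<close> are determined by values in
  \<open>S\<close>.\<close>

lemma Ck_on_SucI:
  assumes der: "\<And>x. x \<in> S \<Longrightarrow> (f has_derivative f' x) (at x)"
    and Ck: "\<And>v. Ck_on k S (\<lambda>x. f' x v)" and "open S"
  shows "Ck_on (Suc k) S f"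
proof -
  have *: "Ck_on k S g = Ck_on k S h" if "\<And>x. x \<in> S \<Longrightarrow> g x = h x" for g h :: "'a \<Rightarrow> 'b"
    using that
  proof (induction k arbitrary: g h)
    case 0
    then show ?case by (auto cong: continuous_on_cong)
  next
    case (Suc k)
    have D: "h differentiable at x \<and> frechet_derivative h (at x) = frechet_derivative g (at x)"
      if "g differentiable at x" "x \<in> S" "\<And>x. x \<in> S \<Longrightarrow> g x = h x" for g h :: "'a \<Rightarrow> 'b" and x
    proof -
      have "(h has_derivative frechet_derivative g (at x)) (at x)"
        using has_derivative_transform_within_open[OF _ \<open>open S\<close> that(2), of g _ UNIV h]
          that frechet_derivative_works by blast
      then show ?thesis
        using differentiableI frechet_derivative_at by metis
    qed
    show ?case
    proof
      assume g: "Ck_on (Suc k) S g"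
      then have "Ck_on k S (\<lambda>x. frechet_derivative h (at x) v)" for v
        using Suc.IH[of "\<lambda>x. frechet_derivative h (at x) v" "\<lambda>x. frechet_derivative g (at x) v"]
          D[of g _ h] Suc.prems by simp
      then show "Ck_on (Suc k) S h" using g D[of g _ h] Suc.prems by simp
    next
      assume h: "Ck_on (Suc k) S h"
      then have "Ck_on k S (\<lambda>x. frechet_derivative g (at x) v)" for v
        using Suc.IH[of "\<lambda>x. frechet_derivative h (at x) v" "\<lambda>x. frechet_derivative g (at x) v"]
          D[of h _ g] Suc.prems by simp
      then show "Ck_on (Suc k) S g" using h D[of h _ g] Suc.prems by simp
    qed
  qed
  have "frechet_derivative f (at x) = f' x" if "x \<in> S" for x
    using frechet_derivative_at[OF der[OF that]] by simp
  then have "Ck_on k S (\<lambda>x. frechet_derivative f (at x) v)" for v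
    using *[of "\<lambda>x. frechet_derivative f (at x) v" "\<lambda>x. f' x v"] Ck by simp
  then show ?thesis using der by (auto intro: differentiableI)
qed

lemma Ck_on_cong:
  assumes "open S" "\<And>x. x \<in> S \<Longrightarrow> f x = g x" "Ck_on k S f"
  shows "Ck_on k S g"
proof (cases k)
  case 0
  then show ?thesis using assms by (auto cong: continuous_on_cong)
next
  case (Suc m)
  show ?thesis unfolding Suc
  proof (rule Ck_on_SucI)
    show "(g has_derivative frechet_derivative f (at x)) (at x)" if "x \<in> S" for x
      using has_derivative_transform_within_open[OF _ assms(1) that, of f _ UNIV g]
        has_derivative_frechet assms that Suc by blast
    show "Ck_on m S (\<lambda>x. frechet_derivative f (at x) v)" for v
      using assms(3) Suc by simp
  qed fact
qed

lemma Ck_on_Suc_imp: "Ck_on (Suc k) S f \<Longrightarrow> Ck_on k S f"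
proof (induction k arbitrary: f)
  case 0
  then show ?case
    by (auto intro!: continuous_at_imp_continuous_on differentiable_imp_continuous_within)
next
  case (Suc k)
  then show ?case by (metis Ck_on.simps(2))
qed

lemma Ck_on_mono: "Ck_on k S f \<Longrightarrow> j \<le> k \<Longrightarrow> Ck_on j S f"
proof (induction k)
  case (Suc k)
  then show ?case using Ck_on_Suc_imp le_Suc_eq by metis
qed simp

lemma Ck_on_imp_continuous_on: "Ck_on k S f \<Longrightarrow> continuous_on S f"
  by (induction k) (use Ck_on_Suc_imp Ck_on.simps(1) in blast)+

lemma Ck_on_subset: "Ck_on k S f \<Longrightarrow> T \<subseteq> S \<Longrightarrow> Ck_on k T f"
  by (induction k arbitrary: f) (auto intro: continuous_on_subset)

lemma Ck_on_local:
  assumes "\<And>x. x \<in> S \<Longrightarrow> \<exists>U. open U \<and> x \<in> U \<and> Ck_on k U f"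
  shows "Ck_on k S f"
  using assms
proof (induction k arbitrary: f)
  case 0
  then show ?case
    by (auto simp: continuous_on_eq_continuous_at intro!: continuous_at_imp_continuous_on)
       (metis continuous_on_eq_continuous_at)
next
  case (Suc k)
  have "f differentiable (at x)" if "x \<in> S" for x
    using Suc.prems[OF that] by auto
  moreover have "Ck_on k S (\<lambda>x. frechet_derivative f (at x) v)" for v
    by (rule Suc.IH) (use Suc.prems in fastforce)
  ultimately show ?case by simp
qed

lemma Ck_on_const [simp]: "Ck_on k S (\<lambda>x. c)"
  by (induction k arbitrary: c) (auto simp: frechet_derivative_const)

lemma Ck_on_bounded_linear:
  assumes "bounded_linear L"
  shows "Ck_on k S L"
proof (cases k)
  case 0
  then show ?thesis using assms by (simp add: linear_continuous_on)
next
  case (Suc m)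
  have "frechet_derivative L (at x) = L" for x
    using frechet_derivative_at bounded_linear_imp_has_derivative[OF assms] by metis
  then show ?thesis
    using Suc assms bounded_linear_imp_differentiable by auto
qed

lemma Ck_on_add:
  assumes "open S" "Ck_on k S f" "Ck_on k S g"
  shows "Ck_on k S (\<lambda>x. f x + g x)"
  using assms(2,3)
proof (induction k arbitrary: f g)
  case (Suc k)
  show ?case
  proof (rule Ck_on_SucI)
    fix x assume "x \<in> S"
    show "((\<lambda>x. f x + g x) has_derivative
        (\<lambda>v. frechet_derivative f (at x) v + frechet_derivative g (at x) v)) (at x)"
      using Suc.prems \<open>x \<in> S\<close> by (intro has_derivative_add has_derivative_frechet)
  qed (use Suc assms in auto)
qed (auto intro: continuous_on_add)

lemma Ck_on_sum:
  assumes "open S" "\<And>i. i \<in> I \<Longrightarrow> Ck_on k S (f i)"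
  shows "Ck_on k S (\<lambda>x. \<Sum>i\<in>I. f i x)"
  using assms(2)
  by (induction I rule: infinite_finite_induct) (auto intro: Ck_on_add assms(1))

lemma Ck_on_bilinear:
  assumes B: "bounded_bilinear B" and "open S" "Ck_on k S f" "Ck_on k S g"
  shows "Ck_on k S (\<lambda>x. B (f x) (g x))"
  using assms(3,4)
proof (induction k arbitrary: f g)
  case 0
  then show ?case using bounded_bilinear.continuous_on[OF B] by auto
next
  case (Suc k)
  show ?case
  proof (rule Ck_on_SucI)
    fix x assume "x \<in> S"
    show "((\<lambda>x. B (f x) (g x)) has_derivative
        (\<lambda>v. B (f x) (frechet_derivative g (at x) v) + B (frechet_derivative f (at x) v) (g x))) (at x)"
      using Suc.prems \<open>x \<in> S\<close> by (intro bounded_bilinear.FDERIV[OF B] has_derivative_frechet)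
  next
    show "Ck_on k S (\<lambda>x. B (f x) (frechet_derivative g (at x) v) +
        B (frechet_derivative f (at x) v) (g x))" for v
      using Suc.prems by (intro Ck_on_add Suc.IH assms) (auto intro: Ck_on_Suc_imp)
  qed fact
qed

lemmas Ck_on_scaleR = Ck_on_bilinear[OF bounded_bilinear_scaleR]
lemmas Ck_on_mult = Ck_on_bilinear[OF bounded_bilinear_mult]
lemmas Ck_on_inner = Ck_on_bilinear[OF bounded_bilinear_inner]

lemma Ck_on_linear_compose:
  assumes L: "bounded_linear L" and "open S" "Ck_on k S f"
  shows "Ck_on k S (\<lambda>x. L (f x))"
  using assms(3)
proof (induction k arbitrary: f)
  case 0
  then show ?case using bounded_linear.continuous_on[OF L] by auto
next
  case (Suc k)
  show ?case
  proof (rule Ck_on_SucI)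
    fix x assume "x \<in> S"
    show "((\<lambda>x. L (f x)) has_derivative (\<lambda>v. L (frechet_derivative f (at x) v))) (at x)"
      using Suc.prems \<open>x \<in> S\<close> by (intro bounded_linear.has_derivative[OF L] has_derivative_frechet)
  qed (use Suc assms in auto)
qed

text \<open>\<open>Ck_on\<close> controls derivatives in fixed directions only. The expansion
  rewrites a derivative in a varying direction as a combination of those in basis directions with
  scalar coefficients; the chain rule and the variational equation below rely on it.\<close>

lemma linear_euclidean_expansion:
  fixes f :: "'a::euclidean_space \<Rightarrow> 'b::real_vector"
  assumes "linear f"
  shows "f v = (\<Sum>b\<in>Basis. (v \<bullet> b) *\<^sub>R f b)"
proof -
  have "f v = f (\<Sum>b\<in>Basis. (v \<bullet> b) *\<^sub>R b)" by (simp add: euclidean_representation)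
  then show ?thesis using assms by (simp add: linear_sum linear_scale)
qed

lemma Ck_on_compose:
  fixes f :: "'a::euclidean_space \<Rightarrow> 'b::euclidean_space"
  assumes "open S" "open T" "f ` S \<subseteq> T" "Ck_on k T g" "Ck_on k S f"
  shows "Ck_on k S (\<lambda>x. g (f x))"
  using assms(4,5)
proof (induction k arbitrary: g)
  case 0
  then show ?case using assms(3) continuous_on_compose2 by auto
next
  case (Suc k)
  let ?g = "\<lambda>y. frechet_derivative g (at y)" and ?f = "\<lambda>x. frechet_derivative f (at x)"
  show ?case
  proof (rule Ck_on_SucI)
    fix x assume x: "x \<in> S"
    have f: "(f has_derivative ?f x) (at x)" using Suc.prems x by (intro has_derivative_frechet)
    have g: "(g has_derivative ?g (f x)) (at (f x))"
      using Suc.prems x assms by (intro has_derivative_frechet) auto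
    have "((\<lambda>x. g (f x)) has_derivative (\<lambda>v. ?g (f x) (?f x v))) (at x)"
      using has_derivative_compose[OF f g] .
    moreover have "(\<lambda>v. ?g (f x) (?f x v)) = (\<lambda>v. \<Sum>b\<in>Basis. (?f x v \<bullet> b) *\<^sub>R ?g (f x) b)"
      by (rule ext, rule linear_euclidean_expansion, rule has_derivative_linear[OF g])
    ultimately show "((\<lambda>x. g (f x)) has_derivative
        (\<lambda>v. \<Sum>b\<in>Basis. (?f x v \<bullet> b) *\<^sub>R ?g (f x) b)) (at x)"
      by (simp only:)
  next
    show "Ck_on k S (\<lambda>x. \<Sum>b\<in>Basis. (?f x v \<bullet> b) *\<^sub>R ?g (f x) b)" for v
      using Suc.prems
      by (intro Ck_on_sum Ck_on_scaleR Ck_on_inner Suc.IH assms) (auto intro: Ck_on_Suc_imp)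
  qed fact
qed

lemma Ck_on_Pair:
  assumes "open S" "Ck_on k S f" "Ck_on k S g"
  shows "Ck_on k S (\<lambda>x. (f x, g x))"
proof -
  have "Ck_on k S (\<lambda>x. (f x, 0) + (0, g x))"
    using assms by (intro Ck_on_add Ck_on_linear_compose[of "\<lambda>a. (a, 0)"]
        Ck_on_linear_compose[of "\<lambda>a. (0, a)"])
      (auto intro!: bounded_linear_Pair bounded_linear_ident bounded_linear_zero)
  then show ?thesis by simp
qed

lemma Ck_on_vec:
  fixes f :: "'i::finite \<Rightarrow> 'a::euclidean_space \<Rightarrow> real"
  assumes "open S" "\<And>i. Ck_on k S (f i)"
  shows "Ck_on k S (\<lambda>x. \<chi> i. f i x)"
proof -
  have "Ck_on k S (\<lambda>x. \<Sum>i\<in>UNIV. f i x *\<^sub>R axis i (1::real))"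
    using assms by (intro Ck_on_sum Ck_on_scaleR) auto
  moreover have "(\<Sum>i\<in>UNIV. f i x *\<^sub>R axis i 1) = (\<chi> i. f i x)" for x
    by (simp add: vec_eq_iff axis_def if_distrib cong: if_cong)
  ultimately show ?thesis by (simp only:)
qed

lemma Ck_on_nth: "open S \<Longrightarrow> Ck_on k S f \<Longrightarrow> Ck_on k S (\<lambda>x. f x $ i)"
  by (rule Ck_on_linear_compose[OF bounded_linear_vec_nth])

lemma Ck_on_inverse:
  fixes f :: "'a::euclidean_space \<Rightarrow> real"
  assumes "open S" "Ck_on k S f" "\<And>x. x \<in> S \<Longrightarrow> f x \<noteq> 0"
  shows "Ck_on k S (\<lambda>x. inverse (f x))"
  using assms(2)
proof (induction k)
  case 0
  then show ?case using assms(3) by (auto intro: continuous_on_inverse)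
next
  case (Suc k)
  show ?case
  proof (rule Ck_on_SucI)
    fix x assume x: "x \<in> S"
    show "((\<lambda>x. inverse (f x)) has_derivative
        (\<lambda>v. -1 * (inverse (f x) * frechet_derivative f (at x) v * inverse (f x)))) (at x)"
      using Deriv.has_derivative_inverse[OF assms(3)[OF x] has_derivative_frechet[OF Suc.prems x]] by simp
  next
    show "Ck_on k S (\<lambda>x. -1 * (inverse (f x) * frechet_derivative f (at x) v * inverse (f x)))" for v
      using Suc Ck_on_Suc_imp[OF Suc.prems] by (intro Ck_on_mult assms Ck_on_const Suc.IH) auto
  qed fact
qed

section \<open>Determinants, linear systems and matrix inverses\<close>

lemma Ck_on_prod:
  fixes f :: "'i \<Rightarrow> 'a::euclidean_space \<Rightarrow> real"
  assumes "open S" "\<And>i. i \<in> I \<Longrightarrow> Ck_on k S (f i)"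
  shows "Ck_on k S (\<lambda>x. \<Prod>i\<in>I. f i x)"
  using assms(2)
  by (induction I rule: infinite_finite_induct) (auto intro: Ck_on_mult assms(1))

lemma Ck_on_det:
  fixes M :: "'a::euclidean_space \<Rightarrow> real ^ 'n ^ 'n"
  assumes "open S" "\<And>i j. Ck_on k S (\<lambda>x. M x $ i $ j)"
  shows "Ck_on k S (\<lambda>x. det (M x))"
  unfolding det_def using assms by (intro Ck_on_sum Ck_on_mult Ck_on_prod) auto

text \<open>Cramer's rule: \<open>?N l x\<close> is \<open>M x\<close> with column \<open>l\<close>
  replaced by \<open>b x\<close>, so every component of \<open>z\<close> is a polynomial in the
  entries divided by the nonvanishing \<open>det (M x)\<close>. The same lemma later bootstraps the
  regularity of inverse functions.\<close>

lemma Ck_on_solution: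
  fixes M :: "'a::euclidean_space \<Rightarrow> real ^ 'n ^ 'n"
  assumes "open S" "\<And>i j. Ck_on k S (\<lambda>x. M x $ i $ j)" "\<And>i. Ck_on k S (\<lambda>x. b x $ i)"
    and "\<And>x. x \<in> S \<Longrightarrow> invertible (M x)" "\<And>x. x \<in> S \<Longrightarrow> M x *v z x = b x"
  shows "Ck_on k S z"
proof -
  let ?N = "\<lambda>l x. (\<chi> i j. if j = l then b x $ i else M x $ i $ j)"
  have d: "det (M x) \<noteq> 0" if "x \<in> S" for x
    using assms(4)[OF that] by (simp add: invertible_det_nz)
  have N: "Ck_on k S (\<lambda>x. ?N l x $ i $ j)" for l i j
    using assms by (cases "j = l") auto
  have "Ck_on k S (\<lambda>x. \<chi> l. det (?N l x) * inverse (det (M x)))"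
    using assms d N by (intro Ck_on_vec Ck_on_mult Ck_on_inverse Ck_on_det) auto
  then show ?thesis
  proof (rule Ck_on_cong[OF assms(1), rotated])
    show "(\<chi> l. det (?N l x) * inverse (det (M x))) = z x" if "x \<in> S" for x
      using cramer[OF d[OF that], of "z x" "b x"] assms(5)[OF that] by (simp add: divide_inverse)
  qed
qed

lemma matrix_inv_mul:
  fixes M :: "real ^ 'n ^ 'n"
  assumes "invertible M"
  shows "M ** matrix_inv M = mat 1" "matrix_inv M ** M = mat 1"
proof -
  have "M ** matrix_inv M = mat 1 \<and> matrix_inv M ** M = mat 1"
    using assms unfolding invertible_def matrix_inv_def by (rule someI_ex)
  then show "M ** matrix_inv M = mat 1" "matrix_inv M ** M = mat 1" by simp_all
qed

lemma Ck_on_matrix_inv: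
  fixes M :: "'a::euclidean_space \<Rightarrow> real ^ 'n ^ 'n"
  assumes "open S" "\<And>i j. Ck_on k S (\<lambda>x. M x $ i $ j)" "\<And>x. x \<in> S \<Longrightarrow> invertible (M x)"
  shows "Ck_on k S (\<lambda>x. matrix_inv (M x) $ i $ j)"
proof -
  have "Ck_on k S (\<lambda>x. matrix_inv (M x) *v axis j 1)"
  proof (rule Ck_on_solution[OF assms(1,2) _ assms(3)])
    show "M x *v (matrix_inv (M x) *v axis j 1) = axis j 1" if "x \<in> S" for x
      using matrix_inv_mul(1)[OF assms(3)[OF that]] by (simp add: matrix_vector_mul_assoc)
  qed auto
  then have "Ck_on k S (\<lambda>x. (matrix_inv (M x) *v axis j 1) $ i)"
    using assms(1) by (rule Ck_on_nth[rotated])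
  then show ?thesis by (simp add: matrix_vector_mul_component inner_axis)
qed

section \<open>Ordinary differential equations with parameters\<close>

lemma norm_diff_le_vector_derivative:
  fixes f :: "real \<Rightarrow> 'a::real_normed_vector"
  assumes "convex S" and der: "\<And>x. x \<in> S \<Longrightarrow> (f has_vector_derivative f' x) (at x within S)"
    and B: "\<And>x. x \<in> S \<Longrightarrow> norm (f' x) \<le> B" and xy: "x \<in> S" "y \<in> S"
  shows "norm (f x - f y) \<le> B * \<bar>x - y\<bar>"
proof -
  have "onorm (\<lambda>h. h *\<^sub>R f' x) \<le> B" if "x \<in> S" for x
    by (rule order_trans[OF onorm_bound[of "norm (f' x)"]]) (auto simp: B that mult.commute)
  then show ?thesis
    using differentiable_bound[OF assms(1) der[unfolded has_vector_derivative_def] _ xy, of B] by simp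
qed

text \<open>This replaces Gronwall's inequality. At a maximum \<open>m\<close> of
  \<open>norm (d s)\<close> the mean value inequality, with \<open>d 0 = 0\<close>, gives
  \<open>norm (d m) \<le> r * (L * norm (d m) + e)\<close>; as \<open>r * L \<le> 1/2\<close>, the
  first term is absorbed by half of the left side. The case \<open>e = 0\<close> is
  uniqueness.\<close>

lemma ode_stability:
  fixes d :: "real \<Rightarrow> 'a::real_normed_vector"
  assumes der: "\<And>s. s \<in> {-r..r} \<Longrightarrow> (d has_vector_derivative d' s) (at s within {-r..r})"
    and "d 0 = 0" and bd: "\<And>s. s \<in> {-r..r} \<Longrightarrow> norm (d' s) \<le> L * norm (d s) + e"
    and L: "0 \<le> L" "r * L \<le> 1/2" and s: "s \<in> {-r..r}" and "e \<ge> 0"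
  shows "norm (d s) \<le> 2 * r * e"
proof -
  have r: "r \<ge> 0" using s by auto
  have "continuous_on {-r..r} (\<lambda>s. norm (d s))"
    by (rule continuous_on_norm, rule continuous_on_vector_derivative, rule der)
  then obtain m where m: "m \<in> {-r..r}" "\<And>s. s \<in> {-r..r} \<Longrightarrow> norm (d s) \<le> norm (d m)"
    using continuous_attains_sup[of "{-r..r}"] s by (metis compact_Icc empty_iff)
  have "norm (d' s) \<le> L * norm (d m) + e" if "s \<in> {-r..r}" for s
    using bd[OF that] mult_left_mono[OF m(2)[OF that] L(1)] by linarith
  from norm_diff_le_vector_derivative[OF _ der this m(1), of 0]
  have "norm (d m) \<le> (L * norm (d m) + e) * \<bar>m\<bar>" using r assms(2) by simp
  also have "\<dots> \<le> (L * norm (d m) + e) * r"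
    using m(1) L \<open>e \<ge> 0\<close> by (intro mult_left_mono) auto
  also have "\<dots> = (r * L) * norm (d m) + r * e" by (simp add: algebra_simps)
  also have "\<dots> \<le> 1/2 * norm (d m) + r * e"
    using mult_right_mono[OF L(2), of "norm (d m)"] by simp
  finally have "norm (d m) \<le> 2 * r * e" by simp
  then show ?thesis using m(2)[OF s] by simp
qed

text \<open>Picard's theorem on a short interval: the integral operator contracts by the factor
  \<open>r * L \<le> 1/2\<close> in the supremum norm.\<close>

lemma ode_existence:
  fixes F :: "real \<Rightarrow> 'e::euclidean_space \<Rightarrow> 'e"
  assumes cont: "continuous_on ({-r..r} \<times> UNIV) (\<lambda>(t, w). F t w)"
    and lip: "\<And>t w w'. t \<in> {-r..r} \<Longrightarrow> norm (F t w - F t w') \<le> L * norm (w - w')"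
    and L: "0 \<le> L" "r * L \<le> 1/2" and r: "r > 0"
  obtains z where "z 0 = 0"
    "\<And>t. t \<in> {-r..r} \<Longrightarrow> (z has_vector_derivative F t (z t)) (at t within {-r..r})"
proof -
  define J where "J g t = integral {-r..t} (\<lambda>s. F s (apply_bcontfun g s))" for g and t :: real
  \<comment> \<open>Bounded continuous functions on the whole line form the complete space.
    \<open>clamp\<close> freezes the time at the endpoints of the interval, and subtracting
    \<open>J g 0\<close> moves the base point of the integral from \<open>-r\<close> to
    \<open>0\<close>.\<close>
  define T where "T g = Bcontfun (\<lambda>t. J g (clamp (-r) r t) - J g 0)" for g
  have J: "(J g has_vector_derivative F t (apply_bcontfun g t)) (at t within {-r..r})"
    if "t \<in> {-r..r}" for g t
  proof -
    have "continuous_on {-r..r} (\<lambda>s. (\<lambda>(t, w). F t w) (s, apply_bcontfun g s))"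
      by (intro continuous_on_compose2[OF cont] continuous_intros) auto
    then show ?thesis
      unfolding J_def by (intro integral_has_vector_derivative that) simp
  qed
  have T: "apply_bcontfun (T g) t = J g (clamp (-r) r t) - J g 0" for g t
  proof -
    have c: "continuous_on (cbox (-r) r) (\<lambda>t. J g t - J g 0)"
      unfolding box_real by (rule continuous_on_diff[OF _ continuous_on_const], rule continuous_on_vector_derivative)
        (rule J, simp)
    then have "compact ((\<lambda>t. J g t - J g 0) ` cbox (-r) r)"
      using compact_cbox compact_continuous_image by blast
    then have "(\<lambda>t. J g (clamp (-r) r t) - J g 0) \<in> bcontfun"
      unfolding bcontfun_def mem_Collect_eq
      using clamp_continuous_on[OF c, of UNIV] clamp_bounded compact_imp_bounded by blast
    then show ?thesis unfolding T_def by (simp add: Bcontfun_inverse)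
  qed
  have "dist (T g) (T h) \<le> 1/2 * dist g h" for g h
  proof (rule dist_bound)
    fix t
    let ?t = "clamp (-r) r t"
    have t: "?t \<in> {-r..r}" using clamp_in_interval[of "-r" r t] r by simp
    have D: "((\<lambda>t. J g t - J h t) has_vector_derivative F s (apply_bcontfun g s) - F s (apply_bcontfun h s))
        (at s within {-r..r})" if "s \<in> {-r..r}" for s
      by (intro has_vector_derivative_diff J that)
    have B: "norm (F s (apply_bcontfun g s) - F s (apply_bcontfun h s)) \<le> L * dist g h" if "s \<in> {-r..r}" for s
      using lip[OF that, of "apply_bcontfun g s" "apply_bcontfun h s"]
        mult_left_mono[OF dist_bounded[of g s h] L(1)] by (simp add: dist_norm)
    have "dist (apply_bcontfun (T g) t) (apply_bcontfun (T h) t)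
        = norm ((J g ?t - J h ?t) - (J g 0 - J h 0))"
      by (simp add: T dist_norm algebra_simps)
    also have "\<dots> \<le> L * dist g h * \<bar>?t - 0\<bar>"
      using norm_diff_le_vector_derivative[OF _ D B t, of 0] r by simp
    also have "\<dots> \<le> L * dist g h * r"
      using t L by (intro mult_left_mono) auto
    also have "\<dots> \<le> 1/2 * dist g h"
      using mult_right_mono[OF L(2), of "dist g h"] by (simp add: mult.commute mult.left_commute)
    finally show "dist (apply_bcontfun (T g) t) (apply_bcontfun (T h) t) \<le> 1/2 * dist g h" .
  qed
  then have "\<exists>!g. T g = g" by (intro banach_fix_type[of "1/2"]) auto
  then obtain g where g: "T g = g" by blast
  have eq: "apply_bcontfun g t = J g t - J g 0" if "t \<in> {-r..r}" for t
    using T[of g t] that g by simp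
  show thesis
  proof (rule that[of "\<lambda>t. J g t - J g 0"])
    fix t assume "t \<in> {-r..r}"
    then show "((\<lambda>t. J g t - J g 0) has_vector_derivative F t (J g t - J g 0)) (at t within {-r..r})"
      using has_vector_derivative_diff[OF J[of t g] has_vector_derivative_const[of "J g 0"]] eq by simp
  qed simp
qed

text \<open>The derivative becomes a continuous map into the normed space of operators, which makes
  compactness and uniform continuity available. Continuity in each direction suffices because the
  source has finite dimension.\<close>

lemma Ck_on_blinfun:
  fixes f :: "'a::euclidean_space \<Rightarrow> 'b::euclidean_space"
  assumes "Ck_on (Suc k) S f"
  defines "D \<equiv> \<lambda>x. Blinfun (frechet_derivative f (at x))"
  shows "\<And>x. x \<in> S \<Longrightarrow> blinfun_apply (D x) = frechet_derivative f (at x)"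
    and "\<And>x. x \<in> S \<Longrightarrow> (f has_derivative blinfun_apply (D x)) (at x)"
    and "continuous_on S D"
proof -
  show eq: "blinfun_apply (D x) = frechet_derivative f (at x)" if "x \<in> S" for x
    unfolding D_def using has_derivative_frechet[OF assms(1) that]
    by (intro bounded_linear_Blinfun_apply has_derivative_bounded_linear)
  then show "(f has_derivative blinfun_apply (D x)) (at x)" if "x \<in> S" for x
    using has_derivative_frechet[OF assms(1) that] that by simp
  have "continuous_on S (\<lambda>x. blinfun_apply (D x) b)" for b
  proof -
    have "continuous_on S (\<lambda>x. frechet_derivative f (at x) b)"
      using assms(1) by (intro Ck_on_imp_continuous_on[of k]) simp
    then show ?thesis by (rule continuous_on_cong[THEN iffD1, rotated 2]) (simp_all add: eq)
  qed
  then show "continuous_on S D" by (intro continuous_on_blinfun_componentwise)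
qed

text \<open>The derivative is uniformly continuous on the compact neighbourhood \<open>C\<close> of
  \<open>K\<close>, which contains the segments from \<open>q\<close> to \<open>q + k\<close>. The
  mean value inequality on such a segment makes the remainder uniform in \<open>q\<close>.\<close>

lemma uniform_linearization:
  fixes f :: "'a::euclidean_space \<Rightarrow> 'b::euclidean_space"
  assumes f: "Ck_on (Suc 0) S f" and "open S" "compact K" "K \<subseteq> S" "e > 0"
  obtains d where "d > 0" "\<And>q k. q \<in> K \<Longrightarrow> norm k < d \<Longrightarrow> q + k \<in> S \<and>
    norm (f (q + k) - f q - frechet_derivative f (at q) k) \<le> e * norm k"
proof -
  note D = Ck_on_blinfun[OF f]
  let ?D = "\<lambda>x. Blinfun (frechet_derivative f (at x))"
  obtain d0 where d0: "d0 > 0" "(\<Union>q\<in>K. cball q d0) \<subseteq> S"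
    by (rule compact_subset_open_imp_cball_epsilon_subset[OF assms(3,2,4)])
  define C where "C = (\<Union>q\<in>K. cball q d0)"
  have C: "compact C" "C \<subseteq> S"
    unfolding C_def using d0 by (auto intro: compact_minkowski_sum_cball[OF assms(3)])
  have "uniformly_continuous_on C ?D"
    by (intro compact_uniformly_continuous continuous_on_subset[OF D(3)] C)
  then obtain d1 where d1: "d1 > 0"
    "\<And>x y. x \<in> C \<Longrightarrow> y \<in> C \<Longrightarrow> dist y x < d1 \<Longrightarrow> dist (?D y) (?D x) < e"
    using \<open>e > 0\<close> unfolding uniformly_continuous_on_def by metis
  show thesis
  proof (rule that[of "min d0 d1"])
    show "min d0 d1 > 0" using d0 d1 by simp
    fix q and k :: 'a assume q: "q \<in> K" and k: "norm k < min d0 d1"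
    have sub: "q + t *\<^sub>R k \<in> C \<and> dist (q + t *\<^sub>R k) q < d1" if "t \<in> {0..1}" for t
    proof -
      have "norm (t *\<^sub>R k) \<le> norm k" using that by (simp add: mult_left_le_one_le)
      then show ?thesis using k q unfolding C_def by (auto simp: dist_norm intro!: bexI[of _ q])
    qed
    let ?S = "(\<lambda>t. q + t *\<^sub>R k) ` {0..1}"
    have "norm (f (q + k) - f q - ?D q (q + k - q)) \<le> norm (q + k - q) * e"
    proof (rule differentiable_bound_linearization[of _ _ ?S _ "\<lambda>x. blinfun_apply (?D x)"])
      show "q + t *\<^sub>R (q + k - q) \<in> ?S" if "t \<in> {0..1}" for t using that by auto
      show "(f has_derivative blinfun_apply (?D x)) (at x within ?S)" if "x \<in> ?S" for x
        using that sub C by (auto intro!: has_derivative_at_withinI[OF D(2)])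
      show "q \<in> ?S" by (auto intro!: image_eqI[of _ _ 0])
      fix x assume "x \<in> ?S"
      then have "dist (?D x) (?D q) < e"
        using sub sub[of 0] by (auto intro!: d1)
      then show "onorm (blinfun_apply (?D x) - blinfun_apply (?D q)) \<le> e"
        by (simp add: dist_norm norm_blinfun.rep_eq minus_blinfun.rep_eq fun_diff_def)
    qed
    moreover have "q \<in> S" "q + k \<in> S" using q assms sub[of 1] C by auto
    ultimately show "q + k \<in> S \<and> norm (f (q + k) - f q - frechet_derivative f (at q) k) \<le> e * norm k"
      using D(1) by (simp add: mult.commute)
  qed
qed

text \<open>Solutions are compared with the fixed one \<open>z (y0, _)\<close>: the difference
  satisfies the hypotheses of \<open>ode_stability\<close>, with error the change of
  \<open>F\<close> along that fixed curve when the parameter moves. This error is small uniformly in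
  time, by compactness of \<open>{-t1..t1}\<close>.\<close>

lemma ode_continuous:
  fixes F :: "('p::euclidean_space \<times> real) \<times> 'e::euclidean_space \<Rightarrow> 'e"
  assumes "open Y"
    and F: "continuous_on ((Y \<times> {-r<..<r}) \<times> Z) F"
    and lip: "\<And>y t w w'. y \<in> Y \<Longrightarrow> t \<in> {-r<..<r} \<Longrightarrow> w \<in> Z \<Longrightarrow> w' \<in> Z \<Longrightarrow>
      norm (F ((y, t), w) - F ((y, t), w')) \<le> L * norm (w - w')"
    and L: "0 \<le> L" "r * L \<le> 1/2"
    and z0: "\<And>y. y \<in> Y \<Longrightarrow> z (y, 0) = 0"
    and zZ: "\<And>y t. y \<in> Y \<Longrightarrow> t \<in> {-r<..<r} \<Longrightarrow> z (y, t) \<in> Z"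
    and ode: "\<And>y t. y \<in> Y \<Longrightarrow> t \<in> {-r<..<r} \<Longrightarrow>
      ((\<lambda>t. z (y, t)) has_vector_derivative F ((y, t), z (y, t))) (at t)"
  shows "continuous_on (Y \<times> {-r<..<r}) z"
proof (rule continuous_at_imp_continuous_on, clarify)
  fix y0 t0 assume y0: "y0 \<in> Y" and t0: "t0 \<in> {-r<..<r}"
  define t1 where "t1 = (\<bar>t0\<bar> + r) / 2"
  have t1: "\<bar>t0\<bar> < t1" "t1 < r" "0 < t1" using t0 by (auto simp: t1_def abs_if)
  have t1L: "t1 * L \<le> 1/2" using t1 L mult_right_mono[of t1 r L] by linarith
  have T: "{-t1..t1} \<subseteq> {-r<..<r}" using t1 by auto
  have zc: "isCont (\<lambda>t. z (y0, t)) t" if "t \<in> {-r<..<r}" for t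
    using ode[OF y0 that] has_vector_derivative_continuous by blast
  have G: "continuous_on (Y \<times> {-t1..t1}) (\<lambda>(y, t). F ((y, t), z (y0, t)))"
    unfolding split_beta
  proof (rule continuous_on_compose2[OF F])
    have "continuous_on {-t1..t1} (\<lambda>t. z (y0, t))"
      using T by (intro continuous_at_imp_continuous_on) (auto intro!: zc)
    then have "continuous_on (Y \<times> {-t1..t1}) (\<lambda>x. z (y0, snd x))"
      by (rule continuous_on_compose2) (auto intro!: continuous_intros)
    then show "continuous_on (Y \<times> {-t1..t1}) (\<lambda>x. ((fst x, snd x), z (y0, snd x)))"
      by (intro continuous_intros)
  qed (use T zZ y0 in auto)
  show "isCont z (y0, t0)"
    unfolding isCont_def tendsto_at_iff_tendsto_nhds
  proof (rule tendstoI)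
    fix e :: real assume "e > 0"
    define e' where "e' = e / (8 * t1)"
    have e': "e' > 0" "2 * t1 * e' = e / 4" using t1 \<open>e > 0\<close> by (auto simp: e'_def)
    obtain X0 where X0: "y0 \<in> X0" "open X0"
      and X0e: "\<forall>y\<in>X0 \<inter> Y. \<forall>t\<in>{-t1..t1}. dist ((\<lambda>(y, t). F ((y, t), z (y0, t))) (y, t))
        ((\<lambda>(y, t). F ((y, t), z (y0, t))) (y0, t)) \<le> e'"
      by (rule continuous_on_prod_compactE[OF G compact_Icc y0 e'(1)])
    have st: "norm (z (y, s) - z (y0, s)) \<le> e / 4" if y: "y \<in> X0 \<inter> Y" and s: "s \<in> {-t1..t1}" for y s
      unfolding e'(2)[symmetric]
    proof (rule ode_stability[where d = "\<lambda>s. z (y, s) - z (y0, s)"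
          and d' = "\<lambda>s. F ((y, s), z (y, s)) - F ((y0, s), z (y0, s))" and L = L])
      show "((\<lambda>s. z (y, s) - z (y0, s)) has_vector_derivative
          F ((y, s), z (y, s)) - F ((y0, s), z (y0, s))) (at s within {-t1..t1})" if "s \<in> {-t1..t1}" for s
        using T that y y0 by (intro has_vector_derivative_diff) (auto intro!: has_vector_derivative_at_within[OF ode])
      show "norm (F ((y, s), z (y, s)) - F ((y0, s), z (y0, s))) \<le> L * norm (z (y, s) - z (y0, s)) + e'"
        if s: "s \<in> {-t1..t1}" for s
      proof -
        have "norm (F ((y, s), z (y, s)) - F ((y, s), z (y0, s))) \<le> L * norm (z (y, s) - z (y0, s))"
          using T s y y0 by (intro lip zZ) auto
        moreover have "norm (F ((y, s), z (y0, s)) - F ((y0, s), z (y0, s))) \<le> e'"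
          using X0e y s by (auto simp: dist_norm)
        ultimately show ?thesis
          using norm_triangle_ineq[of "F ((y, s), z (y, s)) - F ((y, s), z (y0, s))"
              "F ((y, s), z (y0, s)) - F ((y0, s), z (y0, s))"] by simp
      qed
    qed (use y y0 z0 L t1L s e'(1) in simp_all)
    have "\<forall>\<^sub>F t in nhds t0. dist (z (y0, t)) (z (y0, t0)) < e / 2"
      using zc[OF t0] \<open>e > 0\<close> unfolding isCont_def
      by (intro tendstoD[OF tendsto_at_iff_tendsto_nhds[of "\<lambda>t. z (y0, t)" t0, THEN iffD1]]) simp_all
    then obtain T2 where T2: "open T2" "t0 \<in> T2" "\<forall>t\<in>T2. dist (z (y0, t)) (z (y0, t0)) < e / 2"
      unfolding eventually_nhds by blast
    show "\<forall>\<^sub>F x in nhds (y0, t0). dist (z x) (z (y0, t0)) < e"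
      unfolding eventually_nhds
    proof (intro exI[of _ "(X0 \<inter> Y) \<times> (T2 \<inter> {-t1<..<t1})"] conjI ballI)
      show "open ((X0 \<inter> Y) \<times> (T2 \<inter> {-t1<..<t1}))"
        using X0 T2 assms(1) by (intro open_Times open_Int) auto
      show "(y0, t0) \<in> (X0 \<inter> Y) \<times> (T2 \<inter> {-t1<..<t1})" using X0 T2 y0 t1 by auto
      fix x assume "x \<in> (X0 \<inter> Y) \<times> (T2 \<inter> {-t1<..<t1})"
      then obtain y t where x: "x = (y, t)" and y: "y \<in> X0 \<inter> Y" and t: "t \<in> T2" "t \<in> {-t1..t1}" by auto
      have "dist (z (y, t)) (z (y0, t)) \<le> e / 4" using st[OF y t(2)] by (simp add: dist_norm)
      moreover have "dist (z (y0, t)) (z (y0, t0)) < e / 2" using T2 t by blast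
      ultimately show "dist (z x) (z (y0, t0)) < e"
        using dist_triangle[of "z (y, t)" "z (y0, t0)" "z (y0, t)"] \<open>e > 0\<close> x by simp
    qed
  qed
qed

text \<open>Transfers the Lipschitz constant of \<open>F\<close> to its linearization, so that the
  variational equation meets the same condition \<open>r * L \<le> 1/2\<close>. The proof compares
  \<open>f' v\<close> with a difference quotient along a short multiple of \<open>v\<close>.\<close>

lemma norm_derivative_le_lipschitz:
  assumes f: "(f has_derivative f') (at x)" and "open S" "x \<in> S"
    and lip: "\<And>y. y \<in> S \<Longrightarrow> norm (f y - f x) \<le> L * norm (y - x)"
  shows "norm (f' v) \<le> L * norm v"
proof (rule field_le_epsilon)
  fix e :: real assume "e > 0"
  define e' where "e' = e / (norm v + 1)"
  have "norm v + 1 > 0" using norm_ge_zero[of v] by linarith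
  then have e': "e' > 0" "e' * norm v \<le> e" using \<open>e > 0\<close> by (auto simp: e'_def field_simps)
  obtain d where d: "d > 0" "\<And>y. norm (y - x) < d \<Longrightarrow> norm (f y - f x - f' (y - x)) \<le> e' * norm (y - x)"
    using f e'(1) unfolding has_derivative_at_alt by blast
  obtain d1 where d1: "d1 > 0" "ball x d1 \<subseteq> S" using assms(2,3) open_contains_ball by blast
  define s where "s = min d d1 / (2 * (norm v + 1))"
  have s: "s > 0" using d d1 \<open>norm v + 1 > 0\<close> by (simp add: s_def)
  have "a / (2 * N) * N = a / 2" if "N > 0" for a N :: real using that by simp
  then have "s * (norm v + 1) = min d d1 / 2" unfolding s_def using \<open>norm v + 1 > 0\<close> .
  moreover have "s * (norm v + 1) = s * norm v + s" by (simp add: distrib_left)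
  ultimately have "s * norm v < min d d1" using s d(1) d1(1) by linarith
  then have n: "norm (s *\<^sub>R v) < d" "x + s *\<^sub>R v \<in> S"
    using s d1 by (auto simp: dist_norm intro!: subsetD[OF d1(2)])
  have "norm (s *\<^sub>R f' v) \<le> norm (f (x + s *\<^sub>R v) - f x) + norm (f (x + s *\<^sub>R v) - f x - s *\<^sub>R f' v)"
    using norm_triangle_ineq4[of "f (x + s *\<^sub>R v) - f x" "f (x + s *\<^sub>R v) - f x - s *\<^sub>R f' v"] by simp
  also have "\<dots> \<le> L * norm (s *\<^sub>R v) + e' * norm (s *\<^sub>R v)"
    using lip[OF n(2)] d(2)[of "x + s *\<^sub>R v"] n(1) linear_scale[OF has_derivative_linear[OF f]]
    by (intro add_mono) auto
  finally have "s * norm (f' v) \<le> s * (L * norm v + e' * norm v)" using s by (simp add: algebra_simps)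
  then show "norm (f' v) \<le> L * norm v + e" using s e' by simp
qed

text \<open>The candidate derivative \<open>w e\<close> solves the variational equation along
  \<open>z (y0, _)\<close>. The error \<open>z (y0 + h, _) - z (y0, _) - w h\<close> satisfies the
  homogeneous linear equation up to a linearization remainder of \<open>F\<close>, and
  \<open>ode_stability\<close> bounds it by that remainder. To make the remainder
  \<open>o (norm h)\<close>, \<open>z\<close> is first shown to be Lipschitz in the parameter
  (\<open>lipy\<close>).\<close>

lemma ode_has_derivative:
  fixes F :: "('p::euclidean_space \<times> real) \<times> 'e::euclidean_space \<Rightarrow> 'e"
  assumes "open Y" "open Z"
    and F: "Ck_on (Suc 0) ((Y \<times> {-r<..<r}) \<times> Z) F"
    and lip: "\<And>y t w w'. y \<in> Y \<Longrightarrow> t \<in> {-r<..<r} \<Longrightarrow> w \<in> Z \<Longrightarrow> w' \<in> Z \<Longrightarrow>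
      norm (F ((y, t), w) - F ((y, t), w')) \<le> L * norm (w - w')"
    and L: "0 \<le> L" "r * L \<le> 1/2"
    and z0: "\<And>y. y \<in> Y \<Longrightarrow> z (y, 0) = 0"
    and zZ: "\<And>y t. y \<in> Y \<Longrightarrow> t \<in> {-r<..<r} \<Longrightarrow> z (y, t) \<in> Z"
    and ode: "\<And>y t. y \<in> Y \<Longrightarrow> t \<in> {-r<..<r} \<Longrightarrow>
      ((\<lambda>t. z (y, t)) has_vector_derivative F ((y, t), z (y, t))) (at t)"
    and t1: "0 < t1" "t1 < r" and y0: "y0 \<in> Y"
    and w0: "\<And>e. w e 0 = 0"
    and w: "\<And>e s. s \<in> {-t1..t1} \<Longrightarrow> (w e has_vector_derivative
      frechet_derivative F (at ((y0, s), z (y0, s))) ((e, 0), w e s)) (at s within {-t1..t1})"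
    and t: "t \<in> {-t1..t1}"
  shows "((\<lambda>y. z (y, t)) has_derivative (\<lambda>e. w e t)) (at y0)"
proof -
  have T: "s \<in> {-r<..<r}" if "s \<in> {-t1..t1}" for s using that t1 by auto
  have t1L: "t1 * L \<le> 1/2" using t1 L mult_right_mono[of t1 r L] by linarith
  define q where "q s = ((y0, s), z (y0, s))" for s
  define D where "D s = frechet_derivative F (at (q s))" for s
  have qS: "q s \<in> (Y \<times> {-r<..<r}) \<times> Z" if "s \<in> {-t1..t1}" for s
    using T[OF that] y0 zZ by (simp add: q_def)
  have oS: "open ((Y \<times> {-r<..<r}) \<times> Z)" using assms(1,2) by (intro open_Times) auto
  have D: "(F has_derivative D s) (at (q s))" if "s \<in> {-t1..t1}" for s
    unfolding D_def using has_derivative_frechet[OF F qS[OF that]] .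
  have Dlin: "linear (D s)" if "s \<in> {-t1..t1}" for s
    using has_derivative_linear[OF D[OF that]] .
  have DL: "norm (D s ((0, 0), v)) \<le> L * norm v" if s: "s \<in> {-t1..t1}" for s v
  proof -
    have i: "((\<lambda>w. ((y0, s), w)) has_derivative (\<lambda>w. ((0, 0), w))) (at (z (y0, s)))"
      by (auto intro!: derivative_eq_intros simp: zero_prod_def)
    have "((\<lambda>w. F ((y0, s), w)) has_derivative (\<lambda>w. D s ((0, 0), w))) (at (z (y0, s)))"
      using has_derivative_compose[OF i] D[OF s] unfolding q_def by blast
    then show ?thesis
      by (rule norm_derivative_le_lipschitz[OF _ assms(2)]) (use T[OF s] y0 zZ lip in auto)
  qed
  define K where "K = q ` {-t1..t1}"
  have "continuous_on {-t1..t1} (\<lambda>s. z (y0, s))"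
    by (intro continuous_at_imp_continuous_on ballI has_vector_derivative_continuous[OF ode[OF y0 T]])
  then have "continuous_on {-t1..t1} q" unfolding q_def
    by (intro continuous_on_Pair continuous_on_const continuous_on_id)
  then have K: "compact K" unfolding K_def by (rule compact_continuous_image) (rule compact_Icc)
  have KS: "K \<subseteq> (Y \<times> {-r<..<r}) \<times> Z" using qS unfolding K_def by blast
  obtain B where B: "B \<ge> 0" "\<And>s k. s \<in> {-t1..t1} \<Longrightarrow> norm (D s k) \<le> B * norm k"
  proof -
    have "compact ((\<lambda>x. Blinfun (frechet_derivative F (at x))) ` K)"
      by (intro compact_continuous_image K continuous_on_subset[OF Ck_on_blinfun(3)[OF F] KS])
    then obtain B where B: "B > 0" "\<forall>x\<in>K. norm (Blinfun (frechet_derivative F (at x))) \<le> B"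
      by (auto dest!: compact_imp_bounded simp: bounded_pos)
    have "norm (D s k) \<le> B * norm k" if "s \<in> {-t1..t1}" for s k
    proof -
      have q: "q s \<in> K" using that K_def by blast
      have "norm (D s k) \<le> norm (Blinfun (D s)) * norm k"
        using norm_blinfun[of "Blinfun (D s)" k] Ck_on_blinfun(1)[OF F, of "q s"] q KS
        unfolding D_def by auto
      also have "\<dots> \<le> B * norm k" using B q unfolding D_def by (intro mult_right_mono) auto
      finally show ?thesis .
    qed
    then show thesis using that B by (meson less_imp_le)
  qed
  \<comment> \<open>The Lipschitz constant of \<open>z\<close> in the parameter:
    \<open>ode_stability\<close> gives \<open>2 * t1 * e\<close> for the error
    \<open>e = (B + 1) * norm h\<close>, where \<open>B\<close> bounds the derivative of
    \<open>F\<close> along the curve and \<open>1\<close> is the linearization error.\<close>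
  define C where "C = 2 * t1 * (B + 1)"
  have C: "C \<ge> 0" using B t1 by (simp add: C_def)
  obtain d1 where d1: "d1 > 0" "\<And>p k. p \<in> K \<Longrightarrow> norm k < d1 \<Longrightarrow> p + k \<in> (Y \<times> {-r<..<r}) \<times> Z \<and>
    norm (F (p + k) - F p - frechet_derivative F (at p) k) \<le> 1 * norm k"
    by (rule uniform_linearization[OF F oS K KS zero_less_one]) blast
  have lipy: "y0 + h \<in> Y \<and> (\<forall>s\<in>{-t1..t1}. norm (z (y0 + h, s) - z (y0, s)) \<le> C * norm h)"
    if h: "norm h < d1" for h
  proof -
    have k: "norm ((h, 0::real), 0::'e) = norm h" by (simp add: norm_Pair)
    have yh: "y0 + h \<in> Y"
      using d1(2)[of "q 0" "((h, 0), 0)"] h k t1 unfolding K_def q_def by auto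
    have Fh: "norm (F ((y0 + h, s), z (y0, s)) - F (q s)) \<le> (B + 1) * norm h" if s: "s \<in> {-t1..t1}" for s
    proof -
      have "norm (F (q s + ((h, 0), 0)) - F (q s) - D s ((h, 0), 0)) \<le> norm h"
        using d1(2)[of "q s" "((h, 0), 0)"] h k s unfolding D_def K_def by auto
      moreover have "norm (D s ((h, 0), 0)) \<le> B * norm h" using B(2)[OF s, of "((h, 0), 0)"] k by simp
      ultimately show ?thesis
        using norm_triangle_ineq[of "F (q s + ((h, 0), 0)) - F (q s) - D s ((h, 0), 0)" "D s ((h, 0), 0)"]
        by (simp add: q_def algebra_simps)
    qed
    have "norm (z (y0 + h, s) - z (y0, s)) \<le> 2 * t1 * ((B + 1) * norm h)" if s: "s \<in> {-t1..t1}" for s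
    proof (rule ode_stability[where d' = "\<lambda>s. F ((y0 + h, s), z (y0 + h, s)) - F (q s)" and L = L])
      show "((\<lambda>s. z (y0 + h, s) - z (y0, s)) has_vector_derivative
          F ((y0 + h, s), z (y0 + h, s)) - F (q s)) (at s within {-t1..t1})" if "s \<in> {-t1..t1}" for s
        using T[OF that] yh y0 unfolding q_def
        by (intro has_vector_derivative_diff) (auto intro!: has_vector_derivative_at_within[OF ode])
      show "norm (F ((y0 + h, s), z (y0 + h, s)) - F (q s))
          \<le> L * norm (z (y0 + h, s) - z (y0, s)) + (B + 1) * norm h" if s: "s \<in> {-t1..t1}" for s
        using lip[OF yh T[OF s] zZ[OF yh T[OF s]] zZ[OF y0 T[OF s]]] Fh[OF s]
          norm_triangle_ineq[of "F ((y0 + h, s), z (y0 + h, s)) - F ((y0 + h, s), z (y0, s))"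
              "F ((y0 + h, s), z (y0, s)) - F (q s)"] by simp
    qed (use yh y0 z0 L t1L s B in simp_all)
    then show ?thesis using yh by (simp add: C_def mult.assoc)
  qed
  \<comment> \<open>A linear combination of solutions of the variational equation is the solution
    for the combined direction, by uniqueness: \<open>ode_stability\<close> with error
    \<open>0\<close>.\<close>
  have lin: "linear (\<lambda>e. w e t)"
  proof -
    have "norm (w (a *\<^sub>R e + b *\<^sub>R f) t - (a *\<^sub>R w e t + b *\<^sub>R w f t)) \<le> 2 * t1 * 0" for a b e f
    proof (rule ode_stability[where d' = "\<lambda>s. D s ((0, 0), w (a *\<^sub>R e + b *\<^sub>R f) s - (a *\<^sub>R w e s + b *\<^sub>R w f s))"
          and L = L])
      fix s assume s: "s \<in> {-t1..t1}"
      interpret D: linear "D s" by (rule Dlin[OF s])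
      have *: "((a *\<^sub>R e + b *\<^sub>R f, 0::real), w (a *\<^sub>R e + b *\<^sub>R f) s)
         = a *\<^sub>R ((e, 0), w e s) + b *\<^sub>R ((f, 0), w f s)
           + ((0, 0), w (a *\<^sub>R e + b *\<^sub>R f) s - (a *\<^sub>R w e s + b *\<^sub>R w f s))"
        by simp
      have e: "D s ((0, 0), w (a *\<^sub>R e + b *\<^sub>R f) s - (a *\<^sub>R w e s + b *\<^sub>R w f s))
        = D s ((a *\<^sub>R e + b *\<^sub>R f, 0), w (a *\<^sub>R e + b *\<^sub>R f) s)
          - (a *\<^sub>R D s ((e, 0), w e s) + b *\<^sub>R D s ((f, 0), w f s))"
        unfolding * by (simp add: D.add D.scale del: add_Pair scaleR_Pair)
      have v: "(w e has_vector_derivative D s ((e, 0), w e s)) (at s within {-t1..t1})" for e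
        using w[OF s] by (simp add: D_def q_def)
      show "((\<lambda>s. w (a *\<^sub>R e + b *\<^sub>R f) s - (a *\<^sub>R w e s + b *\<^sub>R w f s)) has_vector_derivative
        D s ((0, 0), w (a *\<^sub>R e + b *\<^sub>R f) s - (a *\<^sub>R w e s + b *\<^sub>R w f s))) (at s within {-t1..t1})"
        unfolding e
        by (intro has_vector_derivative_diff has_vector_derivative_add v
            bounded_linear.has_vector_derivative[OF bounded_linear_scaleR_right])
    qed (use w0 L t1L t DL in simp_all)
    then have *: "w (a *\<^sub>R e + b *\<^sub>R f) t = a *\<^sub>R w e t + b *\<^sub>R w f t" for a b e f by simp
    show ?thesis
      using *[of 1 _ 1] *[of _ _ 0] by (intro linearI) simp_all
  qed
  show ?thesis unfolding has_derivative_at_alt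
  proof (intro conjI allI impI)
    show "bounded_linear (\<lambda>e. w e t)" using lin linear_conv_bounded_linear by blast
    fix e :: real assume "e > 0"
    \<comment> \<open>The joint displacement \<open>k\<close> of parameter and state satisfies
      \<open>norm k \<le> (1 + C) * norm h\<close>, so this precision leads to the final error
      \<open>e * norm h\<close>.\<close>
    define \<eta> where "\<eta> = e / (2 * t1 * (1 + C))"
    have "2 * t1 * (e / (2 * t1 * c) * c) = e" if "c > 0" for c using that t1 by simp
    then have \<eta>: "\<eta> > 0" "2 * t1 * (\<eta> * (1 + C)) = e"
      unfolding \<eta>_def using \<open>e > 0\<close> t1 C by simp_all
    obtain d2 where d2: "d2 > 0" "\<And>p k. p \<in> K \<Longrightarrow> norm k < d2 \<Longrightarrow> p + k \<in> (Y \<times> {-r<..<r}) \<times> Z \<and>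
      norm (F (p + k) - F p - frechet_derivative F (at p) k) \<le> \<eta> * norm k"
      by (rule uniform_linearization[OF F oS K KS \<eta>(1)]) blast
    show "\<exists>d>0. \<forall>y. norm (y - y0) < d \<longrightarrow> norm (z (y, t) - z (y0, t) - w (y - y0) t) \<le> e * norm (y - y0)"
    proof (intro exI[of _ "min d1 (d2 / (1 + C))"] conjI allI impI)
      show "0 < min d1 (d2 / (1 + C))" using d1 d2 C by simp
      fix y assume y: "norm (y - y0) < min d1 (d2 / (1 + C))"
      define h where "h = y - y0"
      have h: "norm h < d1" "(1 + C) * norm h < d2" "y = y0 + h"
        using y C by (simp_all add: h_def field_simps)
      note l = lipy[OF h(1)]
      have "norm (z (y0 + h, t) - z (y0, t) - w h t) \<le> 2 * t1 * (\<eta> * (1 + C) * norm h)"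
      proof (rule ode_stability[where d' = "\<lambda>s. F ((y0 + h, s), z (y0 + h, s)) - F (q s) - D s ((h, 0), w h s)"
            and L = L])
        fix s assume s: "s \<in> {-t1..t1}"
        have v: "(w e has_vector_derivative D s ((e, 0), w e s)) (at s within {-t1..t1})" for e
          using w[OF s] by (simp add: D_def q_def)
        show "((\<lambda>s. z (y0 + h, s) - z (y0, s) - w h s) has_vector_derivative
            F ((y0 + h, s), z (y0 + h, s)) - F (q s) - D s ((h, 0), w h s)) (at s within {-t1..t1})"
          using T[OF s] l y0 unfolding q_def
          by (intro has_vector_derivative_diff v[unfolded q_def]) (auto intro!: has_vector_derivative_at_within[OF ode])
        define k where "k = ((h, 0::real), z (y0 + h, s) - z (y0, s))"
        have "norm k \<le> norm (h, 0::real) + norm (z (y0 + h, s) - z (y0, s))"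
          unfolding k_def by (rule norm_Pair_le)
        also have "\<dots> \<le> norm h + C * norm h" using l s by (intro add_mono) (auto simp: norm_Pair)
        finally have k: "norm k \<le> (1 + C) * norm h" by (simp add: algebra_simps)
        have "norm (F (q s + k) - F (q s) - D s k) \<le> \<eta> * norm k"
          using d2(2)[of "q s" k] k h(2) s unfolding K_def D_def by auto
        also have "\<dots> \<le> \<eta> * (1 + C) * norm h" using k \<eta>(1) by (simp add: mult.assoc)
        finally have 1: "norm (F ((y0 + h, s), z (y0 + h, s)) - F (q s) - D s k) \<le> \<eta> * (1 + C) * norm h"
          by (simp add: k_def q_def)
        \<comment> \<open>\<open>D s k\<close> differs from the term of the variational equation by
          \<open>D s\<close> applied to the error itself; by \<open>DL\<close> this contributes the
          factor \<open>L\<close> that \<open>ode_stability\<close> absorbs.\<close>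
        have "D s k = D s ((h, 0), w h s) + D s ((0, 0), z (y0 + h, s) - z (y0, s) - w h s)"
          unfolding k_def linear_add[OF Dlin[OF s], symmetric] by simp
        then show "norm (F ((y0 + h, s), z (y0 + h, s)) - F (q s) - D s ((h, 0), w h s))
          \<le> L * norm (z (y0 + h, s) - z (y0, s) - w h s) + \<eta> * (1 + C) * norm h"
          using 1 DL[OF s, of "z (y0 + h, s) - z (y0, s) - w h s"]
            norm_triangle_ineq[of "F ((y0 + h, s), z (y0 + h, s)) - F (q s) - D s k"
              "D s ((0, 0), z (y0 + h, s) - z (y0, s) - w h s)"] by simp
      qed (use l y0 z0 w0 L t1L t C \<eta>(1) in simp_all)
      also have "\<dots> = 2 * t1 * (\<eta> * (1 + C)) * norm h" by simp
      finally show "norm (z (y, t) - z (y0, t) - w (y - y0) t) \<le> e * norm (y - y0)"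
        unfolding \<eta>(2) using h by simp
    qed
  qed
qed

text \<open>Bootstrapping: the induction hypothesis gives that \<open>z\<close> has class
  \<open>k\<close>, hence so do the coefficients of the variational equation; applied to that
  equation, it gives class \<open>k\<close> for the solutions \<open>w\<close>, the derivatives of
  \<open>z\<close> in the parameter. The derivative in time is \<open>F\<close> along
  \<open>z\<close>. All first derivatives being of class \<open>k\<close>, \<open>z\<close> has
  class \<open>Suc k\<close>.\<close>

lemma Ck_on_ode:
  fixes F :: "('p::euclidean_space \<times> real) \<times> 'e::euclidean_space \<Rightarrow> 'e"
  assumes "open Y" "open Z"
    and "Ck_on k ((Y \<times> {-r<..<r}) \<times> Z) F"
    and "\<And>y t w w'. y \<in> Y \<Longrightarrow> t \<in> {-r<..<r} \<Longrightarrow> w \<in> Z \<Longrightarrow> w' \<in> Z \<Longrightarrow>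
      norm (F ((y, t), w) - F ((y, t), w')) \<le> L * norm (w - w')"
    and "0 \<le> L" "r * L \<le> 1/2"
    and "\<And>y. y \<in> Y \<Longrightarrow> z (y, 0) = 0"
    and "\<And>y t. y \<in> Y \<Longrightarrow> t \<in> {-r<..<r} \<Longrightarrow> z (y, t) \<in> Z"
    and "\<And>y t. y \<in> Y \<Longrightarrow> t \<in> {-r<..<r} \<Longrightarrow>
      ((\<lambda>t. z (y, t)) has_vector_derivative F ((y, t), z (y, t))) (at t)"
  shows "Ck_on k (Y \<times> {-r<..<r}) z"
  using assms(2-)
proof (induction k arbitrary: F Z z r)
  case 0
  show ?case
    using ode_continuous[OF assms(1) _ 0(3-)] 0(2) by simp
next
  case (Suc k)
  note Z = Suc.prems(1) and F = Suc.prems(2) and lip = Suc.prems(3) and L = Suc.prems(4,5)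
    and z0 = Suc.prems(6) and zZ = Suc.prems(7) and ode = Suc.prems(8)
  let ?Q = "Y \<times> {-r<..<r}"
  have oQ: "open ?Q" using assms(1) by (intro open_Times) auto
  have oS: "open (?Q \<times> Z)" using oQ Z by (rule open_Times)
  have z: "Ck_on k ?Q z"
    by (rule Suc.IH[OF Z Ck_on_Suc_imp[OF F] lip L z0 zZ ode])
  define D where "D q = frechet_derivative F (at (q, z q))" for q
  have qS: "(q, z q) \<in> ?Q \<times> Z" if "q \<in> ?Q" for q using that zZ by auto
  have gr: "Ck_on k ?Q (\<lambda>q. (q, z q))"
    by (intro Ck_on_Pair oQ z Ck_on_bounded_linear bounded_linear_ident)
  have D: "Ck_on k ?Q (\<lambda>q. D q v)" for v
  proof -
    have "Ck_on k (?Q \<times> Z) (\<lambda>p. frechet_derivative F (at p) v)"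
      using F unfolding Ck_on.simps by blast
    from Ck_on_compose[OF oQ oS _ this gr] show ?thesis unfolding D_def using qS by auto
  qed
  have Fz: "Ck_on k ?Q (\<lambda>q. F (q, z q))"
    using qS by (intro Ck_on_compose[OF oQ oS _ Ck_on_Suc_imp[OF F] gr]) auto
  have FD: "(F has_derivative D q) (at (q, z q))" if "q \<in> ?Q" for q
    unfolding D_def using has_derivative_frechet[OF F qS[OF that]] .
  have Dlin: "linear (D q)" if "q \<in> ?Q" for q
    using has_derivative_linear[OF FD[OF that]] .
  have DL: "norm (D (y, s) ((0, 0), v)) \<le> L * norm v" if y: "(y, s) \<in> ?Q" for y s v
  proof -
    have i: "((\<lambda>w. ((y, s), w)) has_derivative (\<lambda>w. ((0, 0), w))) (at (z (y, s)))"
      by (auto intro!: derivative_eq_intros simp: zero_prod_def)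
    have "((\<lambda>w. F ((y, s), w)) has_derivative (\<lambda>w. D (y, s) ((0, 0), w))) (at (z (y, s)))"
      using has_derivative_compose[OF i] FD[OF y] by blast
    then show ?thesis
      by (rule norm_derivative_le_lipschitz[OF _ Z]) (use y zZ lip in auto)
  qed
  \<comment> \<open>The right-hand side of the variational equation in the direction
    \<open>e\<close>. It is affine in the state \<open>snd p\<close>, so all of \<open>UNIV\<close>
    serves as state set, with the same constant \<open>L\<close>.\<close>
  define F' where "F' e p = D (fst p) ((e, 0), snd p)" for e p
  have oQ': "open (?Q \<times> (UNIV::'e set))" using oQ open_UNIV by (rule open_Times)
  have F': "Ck_on k (?Q \<times> UNIV) (F' e)" for e
  proof -
    have fst: "Ck_on k (?Q \<times> (UNIV::'e set)) (\<lambda>p. D (fst p) v)" for v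
      by (rule Ck_on_compose[OF oQ' oQ _ D]) (auto intro!: Ck_on_bounded_linear bounded_linear_fst)
    have "Ck_on k (?Q \<times> (UNIV::'e set))
        (\<lambda>p. D (fst p) ((e, 0), 0) + (\<Sum>b\<in>Basis. (snd p \<bullet> b) *\<^sub>R D (fst p) ((0, 0), b)))"
      by (intro Ck_on_add Ck_on_sum Ck_on_scaleR Ck_on_inner oQ' fst Ck_on_const
          Ck_on_bounded_linear bounded_linear_snd)
    moreover have "D (fst p) ((e, 0), 0) + (\<Sum>b\<in>Basis. (snd p \<bullet> b) *\<^sub>R D (fst p) ((0, 0), b)) = F' e p"
      if "p \<in> ?Q \<times> UNIV" for p
    proof -
      have l: "linear (D (fst p))" using that Dlin by auto
      have "linear (\<lambda>w. D (fst p) ((0, 0), w))"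
        using linear_compose[OF _ l, of "\<lambda>w. ((0, 0), w)"] by (simp add: o_def linear_iff)
      then have "D (fst p) ((0, 0), snd p) = (\<Sum>b\<in>Basis. (snd p \<bullet> b) *\<^sub>R D (fst p) ((0, 0), b))"
        by (rule linear_euclidean_expansion)
      then show ?thesis using linear_add[OF l, of "((e, 0), 0)" "((0, 0), snd p)"] by (simp add: F'_def)
    qed
    ultimately show ?thesis by (rule Ck_on_cong[OF oQ', rotated])
  qed
  have F'lip: "norm (F' e ((y, t), w) - F' e ((y, t), w')) \<le> L * norm (w - w')" if "(y, t) \<in> ?Q" for e y t w w'
    using linear_diff[OF Dlin[OF that], of "((e, 0), w)" "((e, 0), w')"] DL[OF that, of "w - w'"]
    by (simp add: F'_def zero_prod_def)
  show ?case
  proof (rule Ck_on_local, clarify)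
    fix y0 t0 assume y0: "y0 \<in> Y" and t0: "t0 \<in> {-r<..<r}"
    \<comment> \<open>The interval is shrunk because \<open>ode_existence\<close> needs continuous
      coefficients up to the endpoints.\<close>
    define t1 where "t1 = (\<bar>t0\<bar> + r) / 2"
    have t1: "\<bar>t0\<bar> < t1" "t1 < r" "0 < t1" using t0 by (auto simp: t1_def abs_if)
    have t1L: "t1 * L \<le> 1/2" using t1 L mult_right_mono[of t1 r L] by linarith
    let ?U = "Y \<times> {-t1<..<t1}"
    have oU: "open ?U" using assms(1) by (intro open_Times) auto
    have UQ: "?U \<subseteq> ?Q" using t1 by auto
    have ex: "\<exists>w. w 0 = 0 \<and> (\<forall>t\<in>{-t1..t1}. (w has_vector_derivative F' e ((y, t), w t)) (at t within {-t1..t1}))"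
      if y: "y \<in> Y" for e y
    proof (rule ode_existence)
      have "continuous_on ({-t1..t1} \<times> (UNIV :: 'e set)) (\<lambda>p. F' e ((y, fst p), snd p))"
      proof (rule continuous_on_compose2[OF Ck_on_imp_continuous_on[OF F']])
        show "continuous_on ({-t1..t1} \<times> (UNIV :: 'e set)) (\<lambda>p. ((y, fst p), snd p))"
          by (intro continuous_on_Pair continuous_on_const continuous_on_fst continuous_on_snd continuous_on_id)
      qed (use y t1 in auto)
      then show "continuous_on ({-t1..t1} \<times> UNIV) (\<lambda>(t, w). F' e ((y, t), w))"
        by (simp add: split_beta)
      show "norm (F' e ((y, t), w) - F' e ((y, t), w')) \<le> L * norm (w - w')" if "t \<in> {-t1..t1}" for t w w'
        using that y t1 by (intro F'lip) auto
    qed (use L t1 t1L in auto)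
    define w where "w e y = (SOME w. w 0 = 0 \<and>
      (\<forall>t\<in>{-t1..t1}. (w has_vector_derivative F' e ((y, t), w t)) (at t within {-t1..t1})))" for e y
    have w0: "w e y 0 = 0"
      and w: "t \<in> {-t1..t1} \<Longrightarrow>
        (w e y has_vector_derivative F' e ((y, t), w e y t)) (at t within {-t1..t1})"
      if "y \<in> Y" for e y t
      using someI_ex[OF ex[OF that, of e]] unfolding w_def by blast+
    have W: "Ck_on k ?U (\<lambda>(y, t). w e y t)" for e
    proof (rule Suc.IH[where F = "F' e" and Z = UNIV])
      show "Ck_on k (?U \<times> UNIV) (F' e)" using UQ by (intro Ck_on_subset[OF F']) auto
      show "norm (F' e ((y, t), w) - F' e ((y, t), w')) \<le> L * norm (w - w')"
        if "y \<in> Y" "t \<in> {-t1<..<t1}" for y t w w'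
        using that t1 by (intro F'lip) auto
      show "((\<lambda>t. case (y, t) of (y, t) \<Rightarrow> w e y t) has_vector_derivative
          F' e ((y, t), case (y, t) of (y, t) \<Rightarrow> w e y t)) (at t)" if "y \<in> Y" "t \<in> {-t1<..<t1}" for y t
        using w[OF that(1), of t e] that at_within_Icc_at[of "-t1" t t1] by simp
    qed (use L t1L w0 in auto)
    have der: "(z has_derivative (\<lambda>v. (case x of (y, t) \<Rightarrow> w (fst v) y t) + snd v *\<^sub>R F (x, z x))) (at x)"
      if x: "x \<in> ?U" for x
    proof -
      obtain y t where yt: "x = (y, t)" "y \<in> Y" "t \<in> {-t1<..<t1}" using x by auto
      \<comment> \<open>The partial derivative in \<open>y\<close> at one point and a continuous
        partial derivative in time give the total derivative.\<close>
      have "((\<lambda>(y, t). z (y, t)) has_derivative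
          (\<lambda>(ty, tt). w ty y t + blinfun_scaleR_left (F ((y, t), z (y, t))) tt)) (at (y, t) within ?U)"
      proof (rule has_derivative_partialsI)
        show "((\<lambda>y. z (y, t)) has_derivative (\<lambda>ty. w ty y t)) (at y within Y)"
        proof (rule has_derivative_at_withinI,
            rule ode_has_derivative[OF assms(1) Z Ck_on_mono[OF F] lip L z0 zZ ode t1(3,2) yt(2)])
          show "(w e y has_vector_derivative frechet_derivative F (at ((y, s), z (y, s))) ((e, 0), w e y s))
              (at s within {-t1..t1})" if "s \<in> {-t1..t1}" for e s
            using w[OF yt(2) that] by (simp add: F'_def D_def)
        qed (use yt w0 in auto)
        show "((\<lambda>t. z (y, t)) has_derivative
            blinfun_apply (blinfun_scaleR_left (F ((y, t), z (y, t))))) (at t within {-t1<..<t1})"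
          if "y \<in> Y" "t \<in> {-t1<..<t1}" for y t
          using has_vector_derivative_at_within[OF ode[of y t]] that t1
          by (simp add: has_vector_derivative_def)
        have "continuous_on ?U (\<lambda>q. blinfun_scaleR_left (F (q, z q)))"
          using continuous_on_subset[OF Ck_on_imp_continuous_on[OF Fz] UQ]
          by (intro continuous_on_blinfun_componentwise) (auto intro!: continuous_on_scaleR)
        then show "continuous (at (y, t) within ?U) (\<lambda>(y, t). blinfun_scaleR_left (F ((y, t), z (y, t))))"
          using x yt(1) unfolding continuous_on_eq_continuous_within split_beta prod.collapse by blast
      qed (use yt in auto)
      moreover have "at (y, t) within ?U = at (y, t)" using at_within_open[OF x oU] yt(1) by simp
      ultimately show ?thesis using yt(1) by (simp add: case_prod_unfold)
    qed
    have "Ck_on (Suc k) ?U z"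
    proof (rule Ck_on_SucI[OF der _ oU])
      show "Ck_on k ?U (\<lambda>x. (case x of (y, t) \<Rightarrow> w (fst v) y t) + snd v *\<^sub>R F (x, z x))" for v
        by (intro Ck_on_add W Ck_on_scaleR oU Ck_on_const Ck_on_subset[OF Fz UQ])
    qed
    then show "\<exists>U. open U \<and> (y0, t0) \<in> U \<and> Ck_on (Suc k) U z"
      using oU y0 t1 by (intro exI[of _ ?U]) auto
  qed
qed

section \<open>Local flow of a smooth vector field\<close>

lemma Ck_on_lipschitz:
  fixes f :: "'a::euclidean_space \<Rightarrow> 'b::euclidean_space"
  assumes f: "Ck_on (Suc 0) U f" and K: "compact K" "convex K" "K \<subseteq> U"
  obtains L where "L > 0" "\<And>x y. x \<in> K \<Longrightarrow> y \<in> K \<Longrightarrow> norm (f x - f y) \<le> L * norm (x - y)"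
proof -
  let ?D = "\<lambda>x. Blinfun (frechet_derivative f (at x))"
  have "compact (?D ` K)"
    by (intro compact_continuous_image K continuous_on_subset[OF Ck_on_blinfun(3)[OF f]])
  then obtain L where L: "L > 0" "\<forall>x\<in>K. norm (?D x) \<le> L"
    by (auto dest!: compact_imp_bounded simp: bounded_pos)
  have "norm (f x - f y) \<le> L * norm (x - y)" if "x \<in> K" "y \<in> K" for x y
  proof (rule differentiable_bound[OF K(2) _ _ that])
    show "(f has_derivative blinfun_apply (?D x)) (at x within K)" if "x \<in> K" for x
      using that K by (intro has_derivative_at_withinI[OF Ck_on_blinfun(2)[OF f]]) auto
    show "onorm (blinfun_apply (?D x)) \<le> L" if "x \<in> K" for x
      using L that by (simp add: norm_blinfun.rep_eq)
  qed
  then show thesis using that L by blast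
qed

text \<open>The unknown is the displacement \<open>\<xi>\<close> from the starting point, so that
  all initial values are \<open>0\<close> as in \<open>ode_existence\<close>. Composing with the
  nearest-point projection \<open>?P\<close> makes the right-hand side globally Lipschitz; a short
  time keeps \<open>\<xi>\<close> inside the ball where \<open>?P\<close> is the identity, and there
  it solves the original equation.\<close>

theorem smooth_flow:
  fixes V :: "'a::euclidean_space \<Rightarrow> 'a"
  assumes U: "open U" and V: "smooth_on U V" and y0: "y0 \<in> U"
  obtains Y r \<phi> where "open Y" "y0 \<in> Y" "r > 0" "smooth_on (Y \<times> {-r<..<r}) \<phi>"
    "\<And>y. y \<in> Y \<Longrightarrow> \<phi> (y, 0) = y"
    "\<And>y t. y \<in> Y \<Longrightarrow> t \<in> {-r<..<r} \<Longrightarrow> \<phi> (y, t) \<in> U"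
    "\<And>y t. y \<in> Y \<Longrightarrow> t \<in> {-r<..<r} \<Longrightarrow> ((\<lambda>t. \<phi> (y, t)) has_vector_derivative V (\<phi> (y, t))) (at t)"
proof -
  obtain \<rho>' where \<rho>': "\<rho>' > 0" "cball y0 \<rho>' \<subseteq> U" using U y0 open_contains_cball by blast
  define \<rho> where "\<rho> = \<rho>' / 2"
  let ?K = "cball y0 (2 * \<rho>)" and ?P = "closest_point (cball 0 \<rho>)" and ?Y = "ball y0 \<rho>"
  have \<rho>: "\<rho> > 0" "?K \<subseteq> U" using \<rho>' by (auto simp: \<rho>_def)
  have C1: "Ck_on (Suc 0) U V" using V unfolding smooth_on_def by blast
  obtain L where L: "L > 0" "\<And>x y. x \<in> ?K \<Longrightarrow> y \<in> ?K \<Longrightarrow> norm (V x - V y) \<le> L * norm (x - y)"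
    by (rule Ck_on_lipschitz[OF C1 compact_cball convex_cball \<rho>(2)]) blast
  have cV: "continuous_on ?K V"
    using continuous_on_subset[OF Ck_on_imp_continuous_on[OF C1] \<rho>(2)] .
  then obtain M where M: "M > 0" "\<forall>x\<in>?K. norm (V x) \<le> M"
    using compact_imp_bounded[OF compact_continuous_image[OF cV compact_cball]] by (auto simp: bounded_pos)
  \<comment> \<open>The first bound makes the Picard operator a contraction, the second keeps the
    displacement at most \<open>\<rho> / 2\<close>.\<close>
  define r where "r = min (1 / (2 * L)) (\<rho> / (2 * M))"
  have r0: "r > 0" using L M \<rho> by (simp add: r_def)
  have "r * L \<le> 1 / (2 * L) * L" "r * M \<le> \<rho> / (2 * M) * M"
    unfolding r_def using L(1) M(1) by (intro mult_right_mono; simp)+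
  then have r: "r * L \<le> 1/2" "r * M < \<rho>" using L M \<rho> by auto
  have P: "?P w \<in> cball 0 \<rho>" for w using \<rho> by (intro closest_point_in_set) auto
  have K: "y + w \<in> ?K" if "y \<in> ?Y" "w \<in> cball 0 \<rho>" for y w
    using that norm_triangle_ineq4[of "y0 - y" w] by (simp add: dist_norm algebra_simps)
  have ex: "\<exists>\<xi>. \<xi> 0 = 0 \<and> (\<forall>t\<in>{-r..r}. (\<xi> has_vector_derivative V (y + ?P (\<xi> t))) (at t within {-r..r}))"
    if y: "y \<in> ?Y" for y
  proof (rule ode_existence)
    have "continuous_on ({-r..r} \<times> UNIV) (\<lambda>p. V (y + ?P (snd p)))"
    proof (rule continuous_on_compose2[OF cV])
      have "continuous_on UNIV ?P" using \<rho> by (intro continuous_on_closest_point) auto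
      then have "continuous_on ({-r..r} \<times> UNIV) (\<lambda>p. ?P (snd p))"
        by (rule continuous_on_compose2[OF _ continuous_on_snd[OF continuous_on_id]]) simp
      then show "continuous_on ({-r..r} \<times> UNIV) (\<lambda>p. y + ?P (snd p))"
        by (rule continuous_on_add[OF continuous_on_const])
    qed (use K[OF y P] in blast)
    then show "continuous_on ({-r..r} \<times> UNIV) (\<lambda>(t, w). V (y + ?P w))" by (simp add: split_beta)
    show "norm (V (y + ?P w) - V (y + ?P w')) \<le> L * norm (w - w')" for w w'
    proof -
      have "norm (?P w - ?P w') \<le> norm (w - w')"
        using closest_point_lipschitz[of "cball 0 \<rho>" w w'] \<rho> by (simp add: dist_norm)
      then show ?thesis
        using L(2)[OF K[OF y P[of w]] K[OF y P[of w']]] L(1) mult_left_mono[of _ _ L]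
        by (smt (verit) add_diff_cancel_left)
    qed
  qed (use L r r0 in auto)
  define \<xi> where "\<xi> y = (SOME \<xi>. \<xi> 0 = 0 \<and>
    (\<forall>t\<in>{-r..r}. (\<xi> has_vector_derivative V (y + ?P (\<xi> t))) (at t within {-r..r})))" for y
  have \<xi>0: "\<xi> y 0 = 0"
    and \<xi>: "t \<in> {-r..r} \<Longrightarrow>
      (\<xi> y has_vector_derivative V (y + ?P (\<xi> y t))) (at t within {-r..r})" if "y \<in> ?Y" for y t
    using someI_ex[OF ex[OF that]] unfolding \<xi>_def by blast+
  have \<xi>Z: "\<xi> y t \<in> ball 0 \<rho>" if y: "y \<in> ?Y" and t: "t \<in> {-r..r}" for y t
  proof -
    have "norm (\<xi> y t - \<xi> y 0) \<le> M * \<bar>t - 0\<bar>"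
      by (rule norm_diff_le_vector_derivative[OF _ \<xi>[OF y]]) (use M K[OF y P] t r0 in auto)
    also have "\<dots> \<le> M * r" using t M by (intro mult_left_mono) auto
    also have "\<dots> < \<rho>" using r by (simp add: mult.commute)
    finally show ?thesis using \<xi>0[OF y] by simp
  qed
  have \<xi>': "((\<lambda>t. \<xi> y t) has_vector_derivative V (y + \<xi> y t)) (at t)"
    if "y \<in> ?Y" "t \<in> {-r<..<r}" for y t
  proof -
    have "?P (\<xi> y t) = \<xi> y t" using \<xi>Z[of y t] that by (intro closest_point_self) auto
    then show ?thesis using \<xi>[of y t] that at_within_Icc_at[of "-r" t r] by auto
  qed
  have yU: "y + w \<in> U" if "y \<in> ?Y" "w \<in> ball 0 \<rho>" for y w
    using K[of y w] that \<rho>(2) by auto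
  let ?S = "(?Y \<times> {-r<..<r}) \<times> ball 0 \<rho>"
  have oS: "open ?S" "open (?Y \<times> {-r<..<r})" by (intro open_Times open_ball open_greaterThanLessThan)+
  \<comment> \<open>\<open>?P\<close> is not smooth, so regularity is derived from the equation
    without it, on the open ball where the solutions live.\<close>
  have V': "Ck_on k ?S (\<lambda>p. V (fst (fst p) + snd p))" for k
  proof (rule Ck_on_compose[OF oS(1) U, where f = "\<lambda>p. fst (fst p) + snd p"])
    show "Ck_on k U V" using V unfolding smooth_on_def by blast
    show "Ck_on k ?S (\<lambda>p. fst (fst p) + snd p)"
      by (intro Ck_on_bounded_linear bounded_linear_add bounded_linear_snd
          bounded_linear_compose[OF bounded_linear_fst bounded_linear_fst])
  qed (use yU in auto)
  have "Ck_on k (?Y \<times> {-r<..<r}) (\<lambda>(y, t). \<xi> y t)" for k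
  proof (rule Ck_on_ode[OF open_ball open_ball V'])
    show "norm (V (fst (fst ((y, t), w)) + snd ((y, t), w)) - V (fst (fst ((y, t), w')) + snd ((y, t), w')))
        \<le> L * norm (w - w')" if "y \<in> ?Y" "w \<in> ball 0 \<rho>" "w' \<in> ball 0 \<rho>" for y t w w'
      using L(2)[OF K[of y w] K[of y w']] that by simp
  qed (use L r \<xi>0 \<xi>Z \<xi>' in auto)
  then have "Ck_on k (?Y \<times> {-r<..<r}) (\<lambda>p. fst p + (\<lambda>(y, t). \<xi> y t) p)" for k
    by (rule Ck_on_add[OF oS(2) Ck_on_bounded_linear[OF bounded_linear_fst]])
  then have sm: "smooth_on (?Y \<times> {-r<..<r}) (\<lambda>(y, t). y + \<xi> y t)"
    unfolding smooth_on_def by (simp add: case_prod_unfold)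
  show thesis
  proof (rule that[OF open_ball _ r0 sm])
    show "(case (y, t) of (y, t) \<Rightarrow> y + \<xi> y t) \<in> U" if "y \<in> ?Y" "t \<in> {-r<..<r}" for y t
      using yU[OF that(1) \<xi>Z] that by auto
    show "((\<lambda>t. case (y, t) of (y, t) \<Rightarrow> y + \<xi> y t) has_vector_derivative
        V (case (y, t) of (y, t) \<Rightarrow> y + \<xi> y t)) (at t)" if "y \<in> ?Y" "t \<in> {-r<..<r}" for y t
      using has_vector_derivative_add[OF has_vector_derivative_const \<xi>'[OF that], of y] by simp
  qed (use \<rho> \<xi>0 in auto)
qed

section \<open>Smooth maps, inverse functions, symmetry of second derivatives\<close>

lemma frechet_derivative_eqI:
  "(f has_derivative f') (at x) \<Longrightarrow> frechet_derivative f (at x) = f'"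
  using frechet_derivative_at by metis

lemma smooth_on_imp_Ck: "smooth_on S f \<Longrightarrow> Ck_on k S f"
  unfolding smooth_on_def by blast

lemma smooth_on_has_derivative:
  "smooth_on S f \<Longrightarrow> x \<in> S \<Longrightarrow> (f has_derivative frechet_derivative f (at x)) (at x)"
  by (rule has_derivative_frechet[OF smooth_on_imp_Ck])

lemma smooth_on_linear: "smooth_on S f \<Longrightarrow> x \<in> S \<Longrightarrow> linear (frechet_derivative f (at x))"
  using has_derivative_linear smooth_on_has_derivative by blast

lemma smooth_on_frechet: "smooth_on S f \<Longrightarrow> smooth_on S (\<lambda>x. frechet_derivative f (at x) v)"
  unfolding smooth_on_def by (metis Ck_on.simps(2))

lemma smooth_on_imp_continuous_on: "smooth_on S f \<Longrightarrow> continuous_on S f"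
  by (rule Ck_on_imp_continuous_on[OF smooth_on_imp_Ck])

lemma smooth_on_compose:
  fixes f :: "'a::euclidean_space \<Rightarrow> 'b::euclidean_space"
  assumes "open S" "open T" "f ` S \<subseteq> T" "smooth_on T g" "smooth_on S f"
  shows "smooth_on S (\<lambda>x. g (f x))"
  using Ck_on_compose[OF assms(1-3)] assms(4,5) unfolding smooth_on_def by blast

lemma smooth_on_subset: "smooth_on S f \<Longrightarrow> T \<subseteq> S \<Longrightarrow> smooth_on T f"
  unfolding smooth_on_def using Ck_on_subset by blast

lemma smooth_on_cong:
  "open S \<Longrightarrow> (\<And>x. x \<in> S \<Longrightarrow> f x = g x) \<Longrightarrow> smooth_on S f \<Longrightarrow> smooth_on S g"
  unfolding smooth_on_def using Ck_on_cong by blast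

lemma smooth_on_const: "smooth_on S (\<lambda>x. c)"
  unfolding smooth_on_def by simp

lemma smooth_on_bounded_linear: "bounded_linear f \<Longrightarrow> smooth_on S f"
  unfolding smooth_on_def using Ck_on_bounded_linear by blast

lemma smooth_on_add: "open S \<Longrightarrow> smooth_on S f \<Longrightarrow> smooth_on S g \<Longrightarrow> smooth_on S (\<lambda>x. f x + g x)"
  unfolding smooth_on_def using Ck_on_add by blast

lemma smooth_on_mult:
  fixes f g :: "'a::euclidean_space \<Rightarrow> real"
  shows "open S \<Longrightarrow> smooth_on S f \<Longrightarrow> smooth_on S g \<Longrightarrow> smooth_on S (\<lambda>x. f x * g x)"
  unfolding smooth_on_def using Ck_on_mult by blast

lemma smooth_on_sum:
  "open S \<Longrightarrow> (\<And>i. i \<in> I \<Longrightarrow> smooth_on S (f i)) \<Longrightarrow> smooth_on S (\<lambda>x. \<Sum>i\<in>I. f i x)"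
  by (simp add: smooth_on_def Ck_on_sum)

lemma smooth_on_linear_compose:
  "bounded_linear L \<Longrightarrow> open S \<Longrightarrow> smooth_on S f \<Longrightarrow> smooth_on S (\<lambda>x. L (f x))"
  by (simp add: smooth_on_def Ck_on_linear_compose)

lemma smooth_on_vec:
  fixes f :: "'i::finite \<Rightarrow> 'a::euclidean_space \<Rightarrow> real"
  shows "open S \<Longrightarrow> (\<And>i. smooth_on S (f i)) \<Longrightarrow> smooth_on S (\<lambda>x. \<chi> i. f i x)"
  by (simp add: smooth_on_def Ck_on_vec)

lemma smooth_on_Pair:
  "open S \<Longrightarrow> smooth_on S f \<Longrightarrow> smooth_on S g \<Longrightarrow> smooth_on S (\<lambda>x. (f x, g x))"
  by (simp add: smooth_on_def Ck_on_Pair)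

lemma smooth_on_nth: "open S \<Longrightarrow> smooth_on S f \<Longrightarrow> smooth_on S (\<lambda>x. f x $ i)"
  by (simp add: smooth_on_def Ck_on_nth)

lemma smooth_on_matrix_inv:
  fixes M :: "'a::euclidean_space \<Rightarrow> real ^ 'n ^ 'n"
  shows "open S \<Longrightarrow> smooth_on S M \<Longrightarrow> (\<And>x. x \<in> S \<Longrightarrow> invertible (M x)) \<Longrightarrow>
    smooth_on S (\<lambda>x. matrix_inv (M x) $ i $ j)"
  by (simp add: smooth_on_def Ck_on_matrix_inv Ck_on_nth)

text \<open>The derivative of \<open>g\<close> solves the linear system
  \<open>Df (g y) (Dg y v) = v\<close>, whose matrix is as regular as \<open>g\<close> itself. By
  \<open>Ck_on_solution\<close>, class \<open>k\<close> of \<open>g\<close> gives class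
  \<open>k\<close> of its derivative, hence class \<open>Suc k\<close> of \<open>g\<close>.\<close>

lemma smooth_on_local_inverse:
  fixes f g :: "real ^ 'n \<Rightarrow> real ^ 'n"
  assumes "open S" "open T" and f: "smooth_on S f" and gS: "g ` T \<subseteq> S"
    and fg: "\<And>y. y \<in> T \<Longrightarrow> f (g y) = y" and g: "\<And>y. y \<in> T \<Longrightarrow> g differentiable (at y)"
  shows "smooth_on T g"
proof -
  have "Ck_on k T g" for k
  proof (induction k)
    case 0
    show ?case
      using g by (auto intro!: continuous_at_imp_continuous_on differentiable_imp_continuous_within)
  next
    case (Suc k)
    let ?M = "\<lambda>y. matrix (frechet_derivative f (at (g y)))"
    have Df: "(f has_derivative frechet_derivative f (at (g y))) (at (g y))" if "y \<in> T" for y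
      using f gS that by (intro smooth_on_has_derivative) auto
    have Dg: "(g has_derivative frechet_derivative g (at y)) (at y)" if "y \<in> T" for y
      using g[OF that] frechet_derivative_works by blast
    have id: "frechet_derivative f (at (g y)) (frechet_derivative g (at y) v) = v" if "y \<in> T" for y v
    proof -
      have "((\<lambda>y. f (g y)) has_derivative (\<lambda>v. frechet_derivative f (at (g y)) (frechet_derivative g (at y) v))) (at y)"
        by (rule has_derivative_compose[OF Dg Df]) (rule that)+
      moreover have "((\<lambda>y. f (g y)) has_derivative (\<lambda>v. v)) (at y)"
        by (rule has_derivative_transform_within_open[OF has_derivative_ident assms(2) that]) (simp add: fg)
      ultimately show ?thesis using has_derivative_unique by metis
    qed
    have M: "?M y *v v = frechet_derivative f (at (g y)) v" if "y \<in> T" for y v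
      using has_derivative_linear[OF Df[OF that]] by (simp add: matrix_works)
    have "Ck_on k T (\<lambda>y. frechet_derivative g (at y) v)" for v
    proof (rule Ck_on_solution[OF assms(2), where b = "\<lambda>y. v" and M = ?M])
      show "Ck_on k T (\<lambda>y. ?M y $ i $ j)" for i j
      proof -
        have "Ck_on k S (\<lambda>x. frechet_derivative f (at x) (axis j 1) $ i)"
          using smooth_on_imp_Ck[OF smooth_on_frechet[OF f]] by (intro Ck_on_nth assms(1))
        from Ck_on_compose[OF assms(2,1) gS this Suc]
        show ?thesis by (simp add: matrix_def)
      qed
      show "invertible (?M y)" if "y \<in> T" for y
      proof -
        have "surj (\<lambda>v. ?M y *v v)"
          unfolding surj_def using id[OF that] M[OF that] by metis
        then have "\<exists>B. ?M y ** B = mat 1" using matrix_right_invertible_surjective by blast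
        then show ?thesis by (simp add: invertible_right_inverse)
      qed
      show "?M y *v frechet_derivative g (at y) v = v" if "y \<in> T" for y
        using id M that by simp
    qed simp
    then show ?case by (intro Ck_on_SucI[OF Dg _ assms(2)])
  qed
  then show ?thesis unfolding smooth_on_def by blast
qed

lemma smooth_inverse_function:
  fixes f :: "real ^ 'n \<Rightarrow> real ^ 'n"
  assumes "open U" and f: "smooth_on U f" and x0: "x0 \<in> U"
    and inj: "\<And>v. frechet_derivative f (at x0) v = 0 \<Longrightarrow> v = 0"
  obtains U' V g where "open U'" "U' \<subseteq> U" "x0 \<in> U'" "open V" "f x0 \<in> V" "homeomorphism U' V f g"
    "smooth_on V g"
proof -
  let ?D = "\<lambda>x. Blinfun (frechet_derivative f (at x))"
  note D = Ck_on_blinfun[OF smooth_on_imp_Ck[OF f]]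
  have lin: "linear (frechet_derivative f (at x0))" using smooth_on_linear[OF f x0] .
  have "inj (frechet_derivative f (at x0))"
    using inj linear_injective_0[OF lin] by blast
  then obtain h where h: "linear h" "h \<circ> frechet_derivative f (at x0) = id"
    using linear_injective_left_inverse[OF lin] by blast
  have bh: "blinfun_apply (Blinfun h) = h"
    using h(1) by (intro bounded_linear_Blinfun_apply) (simp add: linear_conv_bounded_linear)
  have "Blinfun h o\<^sub>L ?D x0 = id_blinfun"
    using h(2) D(1)[OF x0] bh by (intro blinfun_eqI) (simp add: fun_eq_iff)
  from inverse_function_theorem[OF assms(1) D(2,3) x0 this]
  obtain U' V g g' where *: "open U'" "U' \<subseteq> U" "x0 \<in> U'" "open V" "f x0 \<in> V" "homeomorphism U' V f g"
    and g': "\<And>y. y \<in> V \<Longrightarrow> (g has_derivative (g' y)) (at y)"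
    by metis
  have "smooth_on V g"
    using * g' by (intro smooth_on_local_inverse[OF assms(1) _ f])
      (auto simp: homeomorphism_def differentiable_def)
  then show thesis using that * by blast
qed

text \<open>The mean value theorem is applied twice: in \<open>s\<close> to the difference of
  \<open>f\<close> on the two sides of the parallelogram parallel to \<open>u\<close>, then in
  \<open>t\<close> to the derivative of \<open>f\<close> along \<open>u\<close>. The second
  difference is symmetric in \<open>u\<close> and \<open>w\<close>, which is what the next lemma
  exploits.\<close>

lemma second_difference_mean_value:
  fixes f :: "'a::euclidean_space \<Rightarrow> real"
  assumes f: "smooth_on S f" and h: "h > 0"
    and S: "\<And>s t. 0 \<le> s \<Longrightarrow> s \<le> h \<Longrightarrow> 0 \<le> t \<Longrightarrow> t \<le> h \<Longrightarrow> x + s *\<^sub>R u + t *\<^sub>R w \<in> S"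
  obtains s t where "0 < s" "s < h" "0 < t" "t < h"
    "f (x + h *\<^sub>R u + h *\<^sub>R w) - f (x + h *\<^sub>R u) - f (x + h *\<^sub>R w) + f x
      = h * h * frechet_derivative (\<lambda>y. frechet_derivative f (at y) u) (at (x + s *\<^sub>R u + t *\<^sub>R w)) w"
proof -
  let ?f = "\<lambda>y. frechet_derivative f (at y)"
  let ?g = "\<lambda>y. frechet_derivative (\<lambda>y. ?f y u) (at y)"
  have 1: "((\<lambda>s. f (x + s *\<^sub>R u + t *\<^sub>R w)) has_real_derivative ?f (x + s *\<^sub>R u + t *\<^sub>R w) u) (at s)"
    if "0 \<le> s" "s \<le> h" "0 \<le> t" "t \<le> h" for s t
  proof -
    have "((\<lambda>s. x + s *\<^sub>R u + t *\<^sub>R w) has_derivative (\<lambda>d. d *\<^sub>R u)) (at s)"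
      by (auto intro!: derivative_eq_intros)
    from has_derivative_compose[OF this smooth_on_has_derivative[OF f S[OF that]]]
    show ?thesis
      using linear_scale[OF smooth_on_linear[OF f S[OF that]]]
      by (simp add: has_field_derivative_def mult_commute_abs)
  qed
  have 2: "((\<lambda>t. ?f (x + s *\<^sub>R u + t *\<^sub>R w) u) has_real_derivative ?g (x + s *\<^sub>R u + t *\<^sub>R w) w) (at t)"
    if "0 \<le> s" "s \<le> h" "0 \<le> t" "t \<le> h" for s t
  proof -
    note g = smooth_on_frechet[OF f, of u]
    have "((\<lambda>t. x + s *\<^sub>R u + t *\<^sub>R w) has_derivative (\<lambda>d. d *\<^sub>R w)) (at t)"
      by (auto intro!: derivative_eq_intros)
    from has_derivative_compose[OF this smooth_on_has_derivative[OF g S[OF that]]]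
    show ?thesis
      using linear_scale[OF smooth_on_linear[OF g S[OF that]]]
      by (simp add: has_field_derivative_def mult_commute_abs)
  qed
  have "\<exists>s. 0 < s \<and> s < h \<and>
    (f (x + h *\<^sub>R u + h *\<^sub>R w) - f (x + h *\<^sub>R u + 0 *\<^sub>R w)) - (f (x + 0 *\<^sub>R u + h *\<^sub>R w) - f (x + 0 *\<^sub>R u + 0 *\<^sub>R w))
    = (h - 0) * (?f (x + s *\<^sub>R u + h *\<^sub>R w) u - ?f (x + s *\<^sub>R u + 0 *\<^sub>R w) u)"
    using h by (intro MVT2 DERIV_diff 1) auto
  then obtain s where s: "0 < s" "s < h" "f (x + h *\<^sub>R u + h *\<^sub>R w) - f (x + h *\<^sub>R u) - f (x + h *\<^sub>R w) + f x
    = h * (?f (x + s *\<^sub>R u + h *\<^sub>R w) u - ?f (x + s *\<^sub>R u + 0 *\<^sub>R w) u)" by (auto simp: algebra_simps)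
  have "\<exists>t. 0 < t \<and> t < h \<and> ?f (x + s *\<^sub>R u + h *\<^sub>R w) u - ?f (x + s *\<^sub>R u + 0 *\<^sub>R w) u
    = (h - 0) * ?g (x + s *\<^sub>R u + t *\<^sub>R w) w"
    using h s by (intro MVT2 2) auto
  then show thesis using that s by auto
qed

text \<open>The second difference over a parallelogram does not depend on the order of
  \<open>u\<close> and \<open>w\<close>, and equals \<open>h * h\<close> times either mixed
  derivative at some point of the parallelogram. For small \<open>h\<close> both values are close to
  those at \<open>x\<close> by continuity.\<close>

lemma frechet_derivative_symmetric_real:
  fixes f :: "'a::euclidean_space \<Rightarrow> real"
  assumes f: "smooth_on S f" and S: "open S" "x \<in> S"
  shows "frechet_derivative (\<lambda>y. frechet_derivative f (at y) u) (at x) w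
    = frechet_derivative (\<lambda>y. frechet_derivative f (at y) w) (at x) u"
proof -
  let ?g = "\<lambda>u w y. frechet_derivative (\<lambda>y. frechet_derivative f (at y) u) (at y) w"
  have c: "isCont (?g u w) x" for u w
    using smooth_on_imp_continuous_on[OF smooth_on_frechet[OF smooth_on_frechet[OF f]]] S
    by (simp add: continuous_on_eq_continuous_at)
  have le: "\<bar>?g u w x - ?g w u x\<bar> \<le> e" if "e > 0" for e
  proof -
    have "\<forall>\<^sub>F y in nhds x. dist (?g u w y) (?g u w x) < e/2 \<and> dist (?g w u y) (?g w u x) < e/2 \<and> y \<in> S"
      using tendstoD[OF tendsto_at_iff_tendsto_nhds[of "?g u w" x, THEN iffD1, OF c[unfolded isCont_def]], of "e/2"]
        tendstoD[OF tendsto_at_iff_tendsto_nhds[of "?g w u" x, THEN iffD1, OF c[unfolded isCont_def]], of "e/2"]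
        eventually_nhds_in_open[OF S] \<open>e > 0\<close> by (simp add: eventually_conj_iff)
    then obtain d where d: "d > 0" "\<And>y. dist y x < d \<Longrightarrow>
      dist (?g u w y) (?g u w x) < e/2 \<and> dist (?g w u y) (?g w u x) < e/2 \<and> y \<in> S"
      unfolding eventually_nhds_metric by blast
    \<comment> \<open>A positive number exceeding \<open>norm u + norm w\<close>, so that the
      parallelogram of size \<open>h = d / N\<close> lies within distance \<open>d\<close> of
      \<open>x\<close>.\<close>
    define N where "N = norm u + norm w + 1"
    have N: "N > 0" "norm u + norm w < N" unfolding N_def using norm_ge_zero[of u] norm_ge_zero[of w] by linarith+
    define h where "h = d / N"
    have h: "h > 0" "h * N = d" using d N by (auto simp: h_def)
    have in_ball: "dist (x + s *\<^sub>R u + t *\<^sub>R w) x < d" "dist (x + t *\<^sub>R w + s *\<^sub>R u) x < d"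
      if "0 \<le> s" "s \<le> h" "0 \<le> t" "t \<le> h" for s t
    proof -
      have "norm (s *\<^sub>R u + t *\<^sub>R w) \<le> s * norm u + t * norm w"
        using norm_triangle_ineq[of "s *\<^sub>R u" "t *\<^sub>R w"] that by simp
      also have "\<dots> \<le> h * norm u + h * norm w" using that by (intro add_mono mult_right_mono) auto
      also have "\<dots> < h * N" using mult_strict_left_mono[OF N(2) h(1)] by (simp add: distrib_left)
      finally show "dist (x + s *\<^sub>R u + t *\<^sub>R w) x < d" "dist (x + t *\<^sub>R w + s *\<^sub>R u) x < d"
        using h by (auto simp: dist_norm algebra_simps)
    qed
    obtain s t where 1: "0 < s" "s < h" "0 < t" "t < h"
      "f (x + h *\<^sub>R u + h *\<^sub>R w) - f (x + h *\<^sub>R u) - f (x + h *\<^sub>R w) + f x = h * h * ?g u w (x + s *\<^sub>R u + t *\<^sub>R w)"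
      by (rule second_difference_mean_value[OF f h(1), of x u w]) (use in_ball d in auto)
    obtain s' t' where 2: "0 < s'" "s' < h" "0 < t'" "t' < h"
      "f (x + h *\<^sub>R w + h *\<^sub>R u) - f (x + h *\<^sub>R w) - f (x + h *\<^sub>R u) + f x = h * h * ?g w u (x + s' *\<^sub>R w + t' *\<^sub>R u)"
      by (rule second_difference_mean_value[OF f h(1), of x w u]) (use in_ball d in auto)
    have "h * h * ?g u w (x + s *\<^sub>R u + t *\<^sub>R w) = h * h * ?g w u (x + s' *\<^sub>R w + t' *\<^sub>R u)"
      unfolding 1(5)[symmetric] 2(5)[symmetric] by (simp add: algebra_simps)
    then have "?g u w (x + s *\<^sub>R u + t *\<^sub>R w) = ?g w u (x + s' *\<^sub>R w + t' *\<^sub>R u)" using h by simp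
    moreover have "dist (?g u w (x + s *\<^sub>R u + t *\<^sub>R w)) (?g u w x) < e/2"
      using d(2) in_ball(1)[of s t] 1 by auto
    moreover have "dist (?g w u (x + s' *\<^sub>R w + t' *\<^sub>R u)) (?g w u x) < e/2"
      using d(2) in_ball(2)[of t' s'] 2 by auto
    ultimately show ?thesis unfolding dist_real_def by linarith
  qed
  have "a = b" if "\<And>e. e > 0 \<Longrightarrow> \<bar>a - b\<bar> \<le> e" for a b :: real
    using that[of "\<bar>a - b\<bar> / 2"] by fastforce
  then show ?thesis using le by blast
qed

lemma frechet_derivative_linear_compose:
  assumes L: "bounded_linear L" and "smooth_on S f" "x \<in> S"
  shows "frechet_derivative (\<lambda>y. L (f y)) (at x) v = L (frechet_derivative f (at x) v)"
  using frechet_derivative_eqI[OF bounded_linear.has_derivative[OF L smooth_on_has_derivative[OF assms(2,3)]]]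
  by simp

lemma frechet_derivative_symmetric:
  fixes f :: "'a::euclidean_space \<Rightarrow> 'b::euclidean_space"
  assumes f: "smooth_on S f" and S: "open S" "x \<in> S"
  shows "frechet_derivative (\<lambda>y. frechet_derivative f (at y) u) (at x) w
    = frechet_derivative (\<lambda>y. frechet_derivative f (at y) w) (at x) u"
proof (rule euclidean_eqI)
  fix b :: 'b
  note b = bounded_linear_inner_left[of b]
  have fb: "smooth_on S (\<lambda>y. f y \<bullet> b)" using b S(1) f by (rule smooth_on_linear_compose)
  have "frechet_derivative (\<lambda>y. frechet_derivative (\<lambda>y. f y \<bullet> b) (at y) u) (at x) w
    = frechet_derivative (\<lambda>y. frechet_derivative f (at y) u) (at x) w \<bullet> b" for u w
  proof -
    note D = frechet_derivative_linear_compose[OF b]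
    have "((\<lambda>y. frechet_derivative f (at y) u \<bullet> b) has_derivative
      (\<lambda>w. frechet_derivative (\<lambda>y. frechet_derivative f (at y) u) (at x) w \<bullet> b)) (at x)"
      by (rule bounded_linear.has_derivative[OF b smooth_on_has_derivative[OF smooth_on_frechet[OF f] S(2)]])
    then have "((\<lambda>y. frechet_derivative (\<lambda>y. f y \<bullet> b) (at y) u) has_derivative
      (\<lambda>w. frechet_derivative (\<lambda>y. frechet_derivative f (at y) u) (at x) w \<bullet> b)) (at x)"
      by (rule has_derivative_transform_within_open[OF _ S]) (simp add: D[OF f])
    then show ?thesis by (simp add: frechet_derivative_eqI)
  qed
  then show "frechet_derivative (\<lambda>y. frechet_derivative f (at y) u) (at x) w \<bullet> b
    = frechet_derivative (\<lambda>y. frechet_derivative f (at y) w) (at x) u \<bullet> b"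
    using frechet_derivative_symmetric_real[OF fb S] by metis
qed

section \<open>Charts and tangent vectors\<close>

text \<open>The tangent vector with component \<open>a\<close> in the chart \<open>c\<close>,
  carried to other charts by the Jacobians. It reduces computations to a single vector of
  \<open>real ^ 'd\<close> and extends \<open>coord_vector\<close> from \<open>axis k 1\<close> to
  any \<open>a\<close>.\<close>

definition tvec :: "('m, 'd::finite) chart set \<Rightarrow> ('m, 'd) chart \<Rightarrow> 'm \<Rightarrow> real ^ 'd \<Rightarrow> ('m, 'd) tangent_vector"
  where "tvec A c p a =
    (\<lambda>c'. if c' \<in> A \<and> p \<in> fst c' then frechet_derivative (transition c c') (at (snd c p)) a else 0)"

lemma coord_vector_eq_tvec: "coord_vector A c k p = tvec A c p (axis k 1)"
  by (simp add: coord_vector_def tvec_def)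

locale atlas =
  fixes X :: "'m topology" and A :: "('m, 'd::finite) chart set"
  assumes smooth_structure: "smooth_structure X A"
begin

abbreviation "cinv c \<equiv> inv_into (fst c) (snd c)"
abbreviation "Dtr c c' p \<equiv> frechet_derivative (transition c c') (at (snd c p))"

lemma is_chart: "c \<in> A \<Longrightarrow> is_chart X c"
  using smooth_structure unfolding smooth_structure_def by blast

lemma openin_chart: "c \<in> A \<Longrightarrow> openin X (fst c)"
  and open_chart_image: "c \<in> A \<Longrightarrow> open (chart_image c)"
  using is_chart unfolding is_chart_def by blast+

lemma chart_homeo:
  "c \<in> A \<Longrightarrow> homeomorphic_map (subtopology X (fst c)) (top_of_set (chart_image c)) (snd c)"
  using is_chart unfolding is_chart_def by blast

lemma chart_subset: "c \<in> A \<Longrightarrow> fst c \<subseteq> topspace X"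
  using openin_chart openin_subset by blast

lemma chart_inj: "c \<in> A \<Longrightarrow> inj_on (snd c) (fst c)"
  using chart_homeo[of c] chart_subset[of c] homeomorphic_imp_injective_map
  by (fastforce simp: inf.absorb2)

lemma cinv_chart: "c \<in> A \<Longrightarrow> p \<in> fst c \<Longrightarrow> cinv c (snd c p) = p"
  using chart_inj inv_into_f_f by metis

lemma chart_cinv: "y \<in> chart_image c \<Longrightarrow> snd c (cinv c y) = y"
  and cinv_in: "y \<in> chart_image c \<Longrightarrow> cinv c y \<in> fst c"
  unfolding chart_image_def by (auto intro: f_inv_into_f inv_into_into)

lemma in_chart_image: "p \<in> fst c \<Longrightarrow> snd c p \<in> chart_image c"
  unfolding chart_image_def by blast

lemma continuous_map_chart:
  "c \<in> A \<Longrightarrow> continuous_map (subtopology X (fst c)) (top_of_set (chart_image c)) (snd c)"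
  using chart_homeo homeomorphic_imp_continuous_map by blast

lemma continuous_map_chart_cinv:
  assumes "c \<in> A"
  shows "continuous_map (top_of_set (chart_image c)) (subtopology X (fst c)) (cinv c)"
proof -
  obtain f where f: "homeomorphic_maps (subtopology X (fst c)) (top_of_set (chart_image c)) (snd c) f"
    using chart_homeo[OF assms] homeomorphic_map_maps by blast
  have "f y = cinv c y" if "y \<in> chart_image c" for y
  proof -
    have "f y \<in> fst c" "snd c (f y) = y"
      using f that chart_subset[OF assms] unfolding homeomorphic_maps_def continuous_map_def
      by auto
    then show ?thesis using cinv_chart[OF assms] by metis
  qed
  then show ?thesis
    using f continuous_map_eq[of "top_of_set (chart_image c)" "subtopology X (fst c)" f "cinv c"]
    unfolding homeomorphic_maps_def by simp
qed

lemma open_chart_openin: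
  assumes "c \<in> A" "openin X W"
  shows "open (snd c ` (fst c \<inter> W))"
proof -
  have "openin (subtopology X (fst c)) (fst c \<inter> W)"
    using assms(2) by (simp add: openin_subtopology_Int2)
  then have "openin (top_of_set (chart_image c)) (snd c ` (fst c \<inter> W))"
    using homeomorphic_imp_open_map[OF chart_homeo[OF assms(1)]] unfolding open_map_def by blast
  then show ?thesis using openin_open_eq open_chart_image[OF assms(1)] by blast
qed

lemma openin_chart_vimage:
  assumes "c \<in> A" "open U"
  shows "openin X {p \<in> fst c. snd c p \<in> U}"
proof -
  have "openin (top_of_set (chart_image c)) (chart_image c \<inter> U)" using assms(2) by auto
  then have "openin (subtopology X (fst c)) {p \<in> topspace (subtopology X (fst c)). snd c p \<in> chart_image c \<inter> U}"
    using openin_continuous_map_preimage[OF continuous_map_chart[OF assms(1)]] by blast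
  moreover have "{p \<in> topspace (subtopology X (fst c)). snd c p \<in> chart_image c \<inter> U} = {p \<in> fst c. snd c p \<in> U}"
    using chart_subset[OF assms(1)] by (auto simp: chart_image_def)
  ultimately show ?thesis using openin_chart[OF assms(1)] openin_trans_full by metis
qed

lemma transition_apply: "c \<in> A \<Longrightarrow> p \<in> fst c \<Longrightarrow> transition c c' (snd c p) = snd c' p"
  by (simp add: transition_def cinv_chart)

lemma smooth_transition:
  "c \<in> A \<Longrightarrow> c' \<in> A \<Longrightarrow> smooth_on (snd c ` (fst c \<inter> fst c')) (transition c c')"
  using smooth_structure unfolding smooth_structure_def compatible_def by blast

lemma open_overlap: "c \<in> A \<Longrightarrow> c' \<in> A \<Longrightarrow> open (snd c ` (fst c \<inter> fst c'))"
  by (simp add: open_chart_openin openin_chart)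

lemma transition_has_derivative:
  assumes "c \<in> A" "c' \<in> A" "p \<in> fst c" "p \<in> fst c'"
  shows "(transition c c' has_derivative Dtr c c' p) (at (snd c p))"
  by (rule smooth_on_has_derivative[OF smooth_transition]) (use assms in auto)

lemma Dtr_linear:
  "c \<in> A \<Longrightarrow> c' \<in> A \<Longrightarrow> p \<in> fst c \<Longrightarrow> p \<in> fst c' \<Longrightarrow> linear (Dtr c c' p)"
  using transition_has_derivative has_derivative_linear by blast

lemma Dtr_cocycle:
  assumes c: "c \<in> A" "c' \<in> A" "c'' \<in> A" and p: "p \<in> fst c" "p \<in> fst c'" "p \<in> fst c''"
  shows "Dtr c' c'' p (Dtr c c' p a) = Dtr c c'' p a"
proof -
  have tr: "transition c c' (snd c p) = snd c' p" using c p by (simp add: transition_apply)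
  have "((\<lambda>y. transition c' c'' (transition c c' y)) has_derivative (\<lambda>a. Dtr c' c'' p (Dtr c c' p a)))
    (at (snd c p))"
    using has_derivative_compose[OF transition_has_derivative[of c c' p], of "transition c' c''" "Dtr c' c'' p"]
      transition_has_derivative[of c' c'' p] c p by (simp add: tr)
  then have "(transition c c'' has_derivative (\<lambda>a. Dtr c' c'' p (Dtr c c' p a))) (at (snd c p))"
  proof (rule has_derivative_transform_within_open)
    show "open (snd c ` (fst c \<inter> (fst c' \<inter> fst c'')))"
      using c by (intro open_chart_openin openin_Int openin_chart)
    show "transition c' c'' (transition c c' y) = transition c c'' y"
      if "y \<in> snd c ` (fst c \<inter> (fst c' \<inter> fst c''))" for y
      using that c by (auto simp: transition_apply)
  qed (use p in auto)
  from frechet_derivative_eqI[OF this] show ?thesis by simp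
qed

lemma Dtr_id:
  assumes c: "c \<in> A" and p: "p \<in> fst c"
  shows "Dtr c c p a = a"
proof -
  have "(transition c c has_derivative (\<lambda>a. a)) (at (snd c p))"
    by (rule has_derivative_transform_within_open[OF has_derivative_ident open_chart_image[OF c]])
      (use p c in \<open>auto simp: chart_image_def transition_apply\<close>)
  from frechet_derivative_eqI[OF this] show ?thesis by simp
qed

lemma Dtr_inverse:
  "c \<in> A \<Longrightarrow> c' \<in> A \<Longrightarrow> p \<in> fst c \<Longrightarrow> p \<in> fst c' \<Longrightarrow> Dtr c' c p (Dtr c c' p a) = a"
  by (simp add: Dtr_cocycle Dtr_id)

lemma tvec_in: "c \<in> A \<Longrightarrow> p \<in> fst c \<Longrightarrow> tvec A c p a \<in> tangent_space A p"
  unfolding tangent_space_def tvec_def by (auto simp: Dtr_cocycle)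

lemma tvec_apply: "c \<in> A \<Longrightarrow> c' \<in> A \<Longrightarrow> p \<in> fst c' \<Longrightarrow> tvec A c p a c' = Dtr c c' p a"
  by (simp add: tvec_def)

lemma tvec_self: "c \<in> A \<Longrightarrow> p \<in> fst c \<Longrightarrow> tvec A c p a c = a"
  by (simp add: tvec_def Dtr_id)

lemma tvec_eq:
  assumes "\<xi> \<in> tangent_space A p" "c \<in> A" "p \<in> fst c"
  shows "\<xi> = tvec A c p (\<xi> c)"
proof
  fix c'
  show "\<xi> c' = tvec A c p (\<xi> c) c'"
  proof (cases "c' \<in> A \<and> p \<in> fst c'")
    case True
    then have "\<xi> c' = Dtr c c' p (\<xi> c)" using assms unfolding tangent_space_def by blast
    with True show ?thesis unfolding tvec_def by presburger
  next
    case False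
    then have "\<xi> c' = 0" using assms unfolding tangent_space_def by blast
    with False show ?thesis unfolding tvec_def by presburger
  qed
qed

lemma tvec_lin_comb:
  assumes "c \<in> A" "p \<in> fst c"
  shows "tvec A c p (s *\<^sub>R a + t *\<^sub>R b) = (\<lambda>c'. s *\<^sub>R tvec A c p a c' + t *\<^sub>R tvec A c p b c')"
  using assms Dtr_linear by (auto simp: tvec_def linear_add linear_scale fun_eq_iff)

text \<open>Membership in \<open>A\<close> comes from maximality of the atlas, by verifying
  compatibility with every member. This is how the coordinates of a flow box become an admissible
  chart; the formula for the transition lets its Jacobian be read off from
  \<open>\<Theta>'\<close>.\<close>

lemma chart_change:
  assumes c0: "c0 \<in> A" and hom: "homeomorphism U V \<Theta> \<Theta>'" and U: "open U" "U \<subseteq> chart_image c0"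
    and V: "open V" and sm: "smooth_on U \<Theta>" "smooth_on V \<Theta>'"
  defines "c \<equiv> ({p \<in> fst c0. snd c0 p \<in> U}, \<Theta> \<circ> snd c0)"
  shows "c \<in> A" "chart_image c = V" "\<And>s. s \<in> V \<Longrightarrow> transition c c0 s = \<Theta>' s"
proof -
  have dom: "fst c \<subseteq> fst c0" unfolding c_def by auto
  have inU: "snd c0 p \<in> U" if "p \<in> fst c" for p using that unfolding c_def by simp
  have img0: "snd c0 ` fst c = U"
    using U(2) unfolding c_def chart_image_def by auto
  show img: "chart_image c = V"
    using homeomorphism_image1[OF hom] img0 by (simp add: chart_image_def c_def image_image[symmetric])
  have inj: "inj_on (snd c) (fst c)"
    unfolding c_def using chart_inj[OF c0] homeomorphism_apply1[OF hom]
    by (auto simp: inj_on_def) metis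
  have sndc: "snd c p = \<Theta> (snd c0 p)" for p unfolding c_def by simp
  have inv: "cinv c s = cinv c0 (\<Theta>' s)" if "s \<in> V" for s
  proof -
    have "\<Theta>' s \<in> U" using hom that unfolding homeomorphism_def by blast
    then have "cinv c0 (\<Theta>' s) \<in> fst c" "snd c (cinv c0 (\<Theta>' s)) = s"
      using cinv_in[of "\<Theta>' s" c0] chart_cinv[of "\<Theta>' s" c0] U(2) homeomorphism_apply2[OF hom that]
      by (auto simp: c_def subset_iff)
    then show ?thesis using inv_into_f_f[OF inj] by metis
  qed
  show tr: "transition c c0 s = \<Theta>' s" if "s \<in> V" for s
  proof -
    have "\<Theta>' s \<in> U" using hom that unfolding homeomorphism_def by blast
    then show ?thesis using inv[OF that] U(2) chart_cinv[of "\<Theta>' s" c0] by (auto simp: transition_def)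
  qed
  have op: "openin X (fst c)" unfolding c_def using openin_chart_vimage[OF c0 U(1)] by simp
  have "homeomorphic_maps (subtopology X (fst c)) (top_of_set V) (snd c) (\<lambda>s. cinv c0 (\<Theta>' s))"
    unfolding homeomorphic_maps_def
  proof (intro conjI ballI)
    have "continuous_map (subtopology X (fst c)) (top_of_set (chart_image c0)) (snd c0)"
      using continuous_map_from_subtopology_mono[OF continuous_map_chart[OF c0] dom] .
    then have "continuous_map (subtopology X (fst c)) (top_of_set U) (snd c0)"
      using inU unfolding continuous_map_in_subtopology by auto
    moreover have "continuous_map (top_of_set U) (top_of_set V) \<Theta>"
      using hom unfolding homeomorphism_def by (auto simp: continuous_map_in_subtopology)
    ultimately have "continuous_map (subtopology X (fst c)) (top_of_set V) (\<Theta> \<circ> snd c0)"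
      by (rule continuous_map_compose)
    then show "continuous_map (subtopology X (fst c)) (top_of_set V) (snd c)" by (simp add: c_def)
    have "continuous_map (top_of_set V) (top_of_set (chart_image c0)) \<Theta>'"
      using hom U(2) unfolding homeomorphism_def by (auto simp: continuous_map_in_subtopology)
    from continuous_map_compose[OF this continuous_map_chart_cinv[OF c0]]
    have "continuous_map (top_of_set V) X (\<lambda>s. cinv c0 (\<Theta>' s))"
      by (simp add: continuous_map_in_subtopology o_def)
    moreover have "cinv c0 (\<Theta>' s) \<in> fst c" if "s \<in> V" for s
      using inv[OF that] inv_into_into[of s "snd c" "fst c"] that img unfolding chart_image_def by auto
    ultimately show "continuous_map (top_of_set V) (subtopology X (fst c)) (\<lambda>s. cinv c0 (\<Theta>' s))"
      by (auto simp: continuous_map_in_subtopology)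
  next
    fix p assume "p \<in> topspace (subtopology X (fst c))"
    then have "p \<in> fst c" by simp
    then show "cinv c0 (\<Theta>' (snd c p)) = p"
      using dom inU homeomorphism_apply1[OF hom] cinv_chart[OF c0] by (simp add: sndc subset_iff)
  next
    fix s assume "s \<in> topspace (top_of_set V)"
    then have s: "s \<in> V" by simp
    then show "snd c (cinv c0 (\<Theta>' s)) = s"
      using chart_cinv[of s c] inv img by simp
  qed
  then have chart: "is_chart X c"
    unfolding is_chart_def img using op V homeomorphic_map_maps by blast
  have "compatible c c'" if c': "c' \<in> A" for c'
  proof -
    \<comment> \<open>\<open>open_chart_openin\<close> applies to members of \<open>A\<close>, which
      \<open>c\<close> is not yet known to be; the overlap is therefore written as a preimage under
      \<open>\<Theta>'\<close>.\<close>
    have o1: "open (snd c ` (fst c \<inter> fst c'))"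
    proof -
      have "snd c ` (fst c \<inter> fst c') = V \<inter> \<Theta>' -` (snd c0 ` (fst c0 \<inter> fst c'))" (is "?L = ?R")
      proof
        show "?L \<subseteq> ?R" using dom inU homeomorphism_apply1[OF hom] img
          by (auto simp: sndc chart_image_def)
        show "?R \<subseteq> ?L"
        proof
          fix s assume s: "s \<in> ?R"
          then obtain p where p: "p \<in> fst c0" "p \<in> fst c'" "\<Theta>' s = snd c0 p" by auto
          have "\<Theta>' s \<in> U" using hom s unfolding homeomorphism_def by blast
          then have "p \<in> fst c" using p unfolding c_def by simp
          moreover have "snd c p = s" using p s homeomorphism_apply2[OF hom, of s] by (simp add: sndc)
          ultimately show "s \<in> ?L" using p by auto
        qed
      qed
      then show ?thesis
        using continuous_open_preimage[OF smooth_on_imp_continuous_on[OF sm(2)] V open_overlap[OF c0 c']] by simp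
    qed
    have sub: "snd c ` (fst c \<inter> fst c') \<subseteq> V" using img unfolding chart_image_def by auto
    have "smooth_on (snd c ` (fst c \<inter> fst c')) (\<lambda>s. transition c0 c' (\<Theta>' s))"
    proof (rule smooth_on_compose[OF o1 open_overlap[OF c0 c'] _ smooth_transition[OF c0 c']
          smooth_on_subset[OF sm(2) sub]])
      show "\<Theta>' ` (snd c ` (fst c \<inter> fst c')) \<subseteq> snd c0 ` (fst c0 \<inter> fst c')"
        using dom inU homeomorphism_apply1[OF hom] by (auto simp: sndc)
    qed
    then have 1: "smooth_on (snd c ` (fst c \<inter> fst c')) (transition c c')"
      using o1 sub by (rule_tac smooth_on_cong) (auto simp: transition_def inv subset_iff)
    have o2: "open (snd c' ` (fst c \<inter> fst c'))"
      using open_chart_openin[OF c' op] by (simp add: Int_commute)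
    have "smooth_on (snd c' ` (fst c \<inter> fst c')) (\<lambda>y. \<Theta> (transition c' c0 y))"
    proof (rule smooth_on_compose[OF o2 U(1) _ sm(1)])
      show "smooth_on (snd c' ` (fst c \<inter> fst c')) (transition c' c0)"
        using smooth_transition[OF c' c0] dom by (rule_tac smooth_on_subset) auto
      show "transition c' c0 ` (snd c' ` (fst c \<inter> fst c')) \<subseteq> U"
        using inU by (auto simp: transition_apply[OF c'])
    qed
    then have 2: "smooth_on (snd c' ` (fst c \<inter> fst c')) (transition c' c)"
      using o2 by (rule_tac smooth_on_cong) (auto simp: transition_apply[OF c'] sndc)
    show ?thesis unfolding compatible_def using 1 2 by (simp add: Int_commute)
  qed
  then show "c \<in> A" using smooth_structure chart unfolding smooth_structure_def by blast
qed

end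

section \<open>Lorentzian metrics and geodesics\<close>

lemma linear_axis_expansion:
  fixes f :: "real ^ 'n \<Rightarrow> 'b::real_vector"
  assumes "linear f"
  shows "f v = (\<Sum>i\<in>UNIV. v $ i *\<^sub>R f (axis i 1))"
proof -
  have "f v = f (\<Sum>i\<in>UNIV. v $ i *\<^sub>R axis i 1)"
    by (rule arg_cong[of _ _ f]) (simp add: vec_eq_iff axis_def if_distrib cong: if_cong)
  then show ?thesis using assms by (simp add: linear_sum linear_scale)
qed

lemma bounded_bilinear_matrix_vector:
  "bounded_bilinear (\<lambda>(M :: real ^ 'n ^ 'm) v. M *v v)"
  unfolding bilinear_conv_bounded_bilinear[symmetric] bilinear_def
  by (auto intro!: linearI simp: matrix_vector_right_distrib matrix_vector_mult_add_rdistrib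
      scaleR_matrix_vector_assoc matrix_scaleR_vector_ac)

lemma second_derivative_linear:
  fixes f :: "'a::euclidean_space \<Rightarrow> 'b::euclidean_space"
  assumes f: "smooth_on S f" and S: "open S" "x \<in> S"
  shows "linear (\<lambda>u. frechet_derivative (\<lambda>y. frechet_derivative f (at y) u) (at x) w)"
  unfolding frechet_derivative_symmetric[OF f S, of _ w]
  by (rule smooth_on_linear[OF smooth_on_frechet[OF f] S(2)])

text \<open>Product rule for a Jacobian applied to a moving vector. With \<open>f\<close> a
  transition map, \<open>y\<close> a curve and \<open>v\<close> its velocity, it computes the
  acceleration in another chart: the Jacobian of the acceleration plus a second-derivative
  term.\<close>

lemma has_vector_derivative_frechet_along:
  fixes f :: "'a::euclidean_space \<Rightarrow> 'b::euclidean_space"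
  assumes f: "smooth_on S f" and S: "open S" and J: "open J" "t \<in> J" "\<And>s. s \<in> J \<Longrightarrow> y s \<in> S"
    and y: "(y has_vector_derivative y') (at t)" and v: "(v has_vector_derivative v') (at t)"
  shows "((\<lambda>s. frechet_derivative f (at (y s)) (v s)) has_vector_derivative
    frechet_derivative f (at (y t)) v' +
    frechet_derivative (\<lambda>z. frechet_derivative f (at z) (v t)) (at (y t)) y') (at t)"
proof -
  let ?D = "\<lambda>z. frechet_derivative f (at z)"
  let ?D2 = "\<lambda>u. frechet_derivative (\<lambda>z. ?D z u) (at (y t))"
  have yt: "y t \<in> S" using J by blast
  have Db: "((\<lambda>s. ?D (y s) b) has_vector_derivative ?D2 b y') (at t)" for b
  proof -
    have "((\<lambda>s. ?D (y s) b) has_derivative (\<lambda>h. ?D2 b (h *\<^sub>R y'))) (at t)"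
      using has_derivative_compose[OF y[unfolded has_vector_derivative_def]
        smooth_on_has_derivative[OF smooth_on_frechet[OF f] yt]] .
    then show ?thesis
      using linear_scale[OF smooth_on_linear[OF smooth_on_frechet[OF f] yt]]
      by (simp add: has_vector_derivative_def)
  qed
  have vb: "((\<lambda>s. v s \<bullet> b) has_vector_derivative v' \<bullet> b) (at t)" for b
    by (rule bounded_linear.has_vector_derivative[OF bounded_linear_inner_left v])
  have "((\<lambda>s. \<Sum>b\<in>Basis. (v s \<bullet> b) *\<^sub>R ?D (y s) b) has_vector_derivative
    (\<Sum>b\<in>Basis. (v t \<bullet> b) *\<^sub>R ?D2 b y' + (v' \<bullet> b) *\<^sub>R ?D (y t) b)) (at t)"
    by (intro has_vector_derivative_sum has_vector_derivative_scaleR Db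
        vb[unfolded has_real_derivative_iff_has_vector_derivative[symmetric]])
  moreover have "(\<Sum>b\<in>Basis. (v t \<bullet> b) *\<^sub>R ?D2 b y' + (v' \<bullet> b) *\<^sub>R ?D (y t) b)
    = ?D (y t) v' + ?D2 (v t) y'"
    using linear_euclidean_expansion[OF smooth_on_linear[OF f yt], of v']
      linear_euclidean_expansion[OF second_derivative_linear[OF f S yt, of y'], of "v t"]
    by (simp add: sum.distrib)
  moreover have "(\<Sum>b\<in>Basis. (v s \<bullet> b) *\<^sub>R ?D (y s) b) = ?D (y s) (v s)" if "s \<in> J" for s
    using linear_euclidean_expansion[OF smooth_on_linear[OF f J(3)[OF that]], of "v s"] by simp
  ultimately show ?thesis
    using has_vector_derivative_transform_within_open[OF _ J(1,2)] by fastforce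
qed

locale lorentz = atlas X A for X :: "'m topology" and A :: "('m, 'd::finite) chart set" +
  fixes g :: "('m, 'd) metric"
  assumes lorentzian: "lorentzian_metric X A g"
begin

abbreviation "G c \<equiv> gram A g c"
abbreviation "dG c y u \<equiv> frechet_derivative (gram A g c) (at y) u"

lemma smooth_gram: "c \<in> A \<Longrightarrow> smooth_on (chart_image c) (G c)"
  using lorentzian unfolding lorentzian_metric_def by blast

lemma metric_tvec:
  assumes c: "c \<in> A" "p \<in> fst c"
  shows "g p (tvec A c p a) (tvec A c p b) = a \<bullet> (G c (snd c p) *v b)"
proof -
  let ?B = "\<lambda>a b. g p (tvec A c p a) (tvec A c p b)"
  have p: "p \<in> topspace X" using chart_subset c by blast
  note T = tvec_in[OF c]
  have sym: "?B a b = ?B b a" for a b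
    using lorentzian p T unfolding lorentzian_metric_def by blast
  have comb: "?B (s *\<^sub>R a + t *\<^sub>R a') b = s * ?B a b + t * ?B a' b" for s t a a' b
    unfolding tvec_lin_comb[OF c]
    using lorentzian p T unfolding lorentzian_metric_def by blast
  have lin1: "linear (\<lambda>a. ?B a b)" for b
    using comb[of 1 _ 1] comb[of _ _ 0] by (intro linearI) simp_all
  then have lin2: "linear (?B a)" for a using sym[of a] by simp
  have "?B a b = (\<Sum>i\<in>UNIV. a $ i *\<^sub>R ?B (axis i 1) b)"
    by (rule linear_axis_expansion[OF lin1])
  also have "\<dots> = (\<Sum>i\<in>UNIV. a $ i *\<^sub>R (\<Sum>j\<in>UNIV. b $ j *\<^sub>R ?B (axis i 1) (axis j 1)))"
    by (intro sum.cong refl arg_cong2[of _ _ _ _ scaleR] linear_axis_expansion[OF lin2])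
  also have "\<dots> = (\<Sum>i\<in>UNIV. a $ i * (\<Sum>j\<in>UNIV. b $ j * ?B (axis i 1) (axis j 1)))"
    by simp
  also have "\<dots> = a \<bullet> (G c (snd c p) *v b)"
    unfolding gram_def Let_def cinv_chart[OF c] coord_vector_eq_tvec inner_vec_def matrix_vector_mult_def
    by (simp add: mult.commute)
  finally show ?thesis .
qed

lemma metric_expansion:
  assumes "c \<in> A" "p \<in> fst c" "\<xi> \<in> tangent_space A p" "\<eta> \<in> tangent_space A p"
  shows "g p \<xi> \<eta> = \<xi> c \<bullet> (G c (snd c p) *v \<eta> c)"
proof -
  have "g p \<xi> \<eta> = g p (tvec A c p (\<xi> c)) (tvec A c p (\<eta> c))"
    using tvec_eq[OF assms(3,1,2)] tvec_eq[OF assms(4,1,2)] by simp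
  then show ?thesis unfolding metric_tvec[OF assms(1,2)] .
qed

lemma gram_sym:
  assumes c: "c \<in> A" "y \<in> chart_image c"
  shows "a \<bullet> (G c y *v b) = b \<bullet> (G c y *v a)"
proof -
  let ?p = "cinv c y"
  have p: "?p \<in> fst c" "snd c ?p = y" using c cinv_in chart_cinv by blast+
  then have "?p \<in> topspace X" using chart_subset c by blast
  then have "g ?p (tvec A c ?p a) (tvec A c ?p b) = g ?p (tvec A c ?p b) (tvec A c ?p a)"
    using lorentzian tvec_in[OF c(1) p(1)] unfolding lorentzian_metric_def by blast
  then show ?thesis unfolding metric_tvec[OF c(1) p(1)] p(2) .
qed

lemma gram_nth: "axis i 1 \<bullet> (M *v axis j 1) = (M :: real ^ 'd ^ 'd) $ i $ j"
  by (simp add: inner_axis' matrix_vector_mul_component inner_axis)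

lemma gram_sym_nth: "c \<in> A \<Longrightarrow> y \<in> chart_image c \<Longrightarrow> G c y $ i $ j = G c y $ j $ i"
  using gram_sym[of c y "axis i 1" "axis j 1"] by (simp only: gram_nth)

text \<open>With the components of an orthonormal basis as rows of \<open>M\<close>, the product
  \<open>M ** G c y ** transpose M\<close> is the signature matrix \<open>D\<close>, and
  \<open>D ** D = mat 1\<close>. Moving \<open>transpose M\<close> to the front exhibits a left
  inverse of the Gram matrix.\<close>

lemma gram_invertible:
  assumes c: "c \<in> A" "y \<in> chart_image c"
  shows "invertible (G c y)"
proof -
  let ?p = "cinv c y"
  have p: "?p \<in> fst c" "snd c ?p = y" using c cinv_in chart_cinv by blast+
  then have "?p \<in> topspace X" using chart_subset c by blast
  then obtain e :: "'d \<Rightarrow> ('m, 'd) tangent_vector" and i0 where e: "\<And>i. e i \<in> tangent_space A ?p"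
    "\<And>i j. g ?p (e i) (e j) = (if i = j then if i = i0 then - 1 else 1 else 0)"
    using lorentzian unfolding lorentzian_metric_def by blast
  define M :: "real ^ 'd ^ 'd" where "M = (\<chi> i. e i c)"
  define D :: "real ^ 'd ^ 'd" where "D = (\<chi> i j. if i = j then if i = i0 then - 1 else 1 else 0)"
  have "M ** G c y ** transpose M = D"
  proof -
    have "(M ** G c y ** transpose M) $ i $ j = D $ i $ j" for i j
    proof -
      have "(M ** G c y ** transpose M) $ i $ j = e i c \<bullet> (G c y *v e j c)"
        unfolding matrix_mul_assoc[symmetric]
        by (simp add: matrix_matrix_mult_def matrix_vector_mult_def M_def transpose_def inner_vec_def)
      also have "\<dots> = g ?p (e i) (e j)" using metric_expansion[OF c(1) p(1) e(1) e(1)] p(2) by simp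
      finally show ?thesis by (simp add: D_def e(2))
    qed
    then show ?thesis by (simp add: vec_eq_iff)
  qed
  moreover have "D ** D = mat 1"
    by (simp add: D_def matrix_matrix_mult_def mat_def vec_eq_iff if_distrib[of "\<lambda>x. x * _"] cong: if_cong)
  moreover have "D ** M ** G c y ** transpose M = D ** (M ** G c y ** transpose M)"
    by (simp only: matrix_mul_assoc)
  ultimately have "D ** M ** G c y ** transpose M = mat 1" by simp
  then have "transpose M ** (D ** M ** G c y) = mat 1"
    using matrix_left_right_inverse by blast
  then have "(transpose M ** (D ** M)) ** G c y = mat 1" by (simp add: matrix_mul_assoc)
  then show ?thesis using invertible_left_inverse by blast
qed

lemma gram_change:
  assumes c: "c \<in> A" "c' \<in> A" and p: "p \<in> fst c" "p \<in> fst c'"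
  shows "a \<bullet> (G c (snd c p) *v b) = Dtr c c' p a \<bullet> (G c' (snd c' p) *v Dtr c c' p b)"
  using metric_expansion[OF c(2) p(2) tvec_in[OF c(1) p(1)] tvec_in[OF c(1) p(1)], of a b]
  unfolding metric_tvec[OF c(1) p(1)] by (simp add: tvec_apply[OF c p(2)])

text \<open>The lowered Christoffel symbols, contracted twice with \<open>v\<close>: the geodesic equation
  reads \<open>G y'' + christoffel_form y' = 0\<close>.\<close>

definition christoffel_form :: "('m, 'd) chart \<Rightarrow> real ^ 'd \<Rightarrow> real ^ 'd \<Rightarrow> real ^ 'd" where
  "christoffel_form c y v = (\<chi> l. \<Sum>i\<in>UNIV. \<Sum>j\<in>UNIV.
     (dG c y (axis i 1) $ j $ l - 1/2 * dG c y (axis l 1) $ i $ j) * v $ i * v $ j)"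

lemma dG_nth:
  assumes "c \<in> A" "y \<in> chart_image c"
  shows "frechet_derivative (\<lambda>z. G c z $ i $ j) (at y) u = dG c y u $ i $ j"
proof -
  have b: "bounded_linear (\<lambda>M :: real ^ 'd ^ 'd. M $ i $ j)"
    by (intro bounded_linear_compose[OF bounded_linear_vec_nth bounded_linear_vec_nth])
  show ?thesis using frechet_derivative_linear_compose[OF b smooth_gram[OF assms(1)] assms(2)] .
qed

lemma dG_linear: "c \<in> A \<Longrightarrow> y \<in> chart_image c \<Longrightarrow> linear (\<lambda>u. dG c y u)"
  using smooth_on_linear[OF smooth_gram] by blast

lemma dG_expansion:
  assumes "c \<in> A" "y \<in> chart_image c"
  shows "a \<bullet> (dG c y u *v b) = (\<Sum>i\<in>UNIV. \<Sum>j\<in>UNIV. \<Sum>l\<in>UNIV. u $ i * dG c y (axis i 1) $ j $ l * a $ j * b $ l)"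
proof -
  have "dG c y u $ j $ l = (\<Sum>i\<in>UNIV. u $ i * dG c y (axis i 1) $ j $ l)" for j l
    unfolding linear_axis_expansion[OF dG_linear[OF assms], of u] by simp
  then have "a \<bullet> (dG c y u *v b)
      = (\<Sum>j\<in>UNIV. \<Sum>l\<in>UNIV. \<Sum>i\<in>UNIV. u $ i * dG c y (axis i 1) $ j $ l * a $ j * b $ l)"
    by (simp add: inner_vec_def matrix_vector_mult_def sum_distrib_left sum_distrib_right mult.commute mult.left_commute)
  also have "\<dots> = (\<Sum>j\<in>UNIV. \<Sum>i\<in>UNIV. \<Sum>l\<in>UNIV. u $ i * dG c y (axis i 1) $ j $ l * a $ j * b $ l)"
    by (intro sum.cong refl sum.swap)
  also have "\<dots> = (\<Sum>i\<in>UNIV. \<Sum>j\<in>UNIV. \<Sum>l\<in>UNIV. u $ i * dG c y (axis i 1) $ j $ l * a $ j * b $ l)"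
    by (rule sum.swap)
  finally show ?thesis .
qed

lemma inner_christoffel_form:
  assumes "c \<in> A" "y \<in> chart_image c"
  shows "w \<bullet> christoffel_form c y v = v \<bullet> (dG c y v *v w) - 1/2 * (v \<bullet> (dG c y w *v v))"
proof -
  let ?d = "\<lambda>i j l. dG c y (axis i 1) $ j $ l"
  have "w \<bullet> christoffel_form c y v
    = (\<Sum>l\<in>UNIV. \<Sum>i\<in>UNIV. \<Sum>j\<in>UNIV. v $ i * ?d i j l * v $ j * w $ l)
      - 1/2 * (\<Sum>l\<in>UNIV. \<Sum>i\<in>UNIV. \<Sum>j\<in>UNIV. w $ l * ?d l i j * v $ i * v $ j)"
    by (simp add: inner_vec_def christoffel_form_def sum_distrib_left sum_subtractf algebra_simps)
  also have "(\<Sum>l\<in>UNIV. \<Sum>i\<in>UNIV. \<Sum>j\<in>UNIV. v $ i * ?d i j l * v $ j * w $ l)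
    = (\<Sum>i\<in>UNIV. \<Sum>l\<in>UNIV. \<Sum>j\<in>UNIV. v $ i * ?d i j l * v $ j * w $ l)" by (rule sum.swap)
  also have "\<dots> = (\<Sum>i\<in>UNIV. \<Sum>j\<in>UNIV. \<Sum>l\<in>UNIV. v $ i * ?d i j l * v $ j * w $ l)"
    by (intro sum.cong refl sum.swap)
  finally show ?thesis unfolding dG_expansion[OF assms] .
qed

text \<open>Contraction with \<open>v\<close> twice identifies the first two of the three derivative
  terms of the Christoffel symbol (\<open>sw\<close>); this cancels the factor \<open>1/2\<close> in
  front of them and leaves \<open>christoffel_form\<close> with its index raised.\<close>

lemma christoffel_contracted:
  assumes "c \<in> A" "y \<in> chart_image c"
  shows "(\<Sum>i\<in>UNIV. \<Sum>j\<in>UNIV. christoffel A g c k i j y * v $ i * v $ j)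
    = (matrix_inv (G c y) *v christoffel_form c y v) $ k"
proof -
  let ?d = "\<lambda>i j l. dG c y (axis i 1) $ j $ l" and ?H = "\<lambda>l. matrix_inv (G c y) $ k $ l"
  have sw: "(\<Sum>i\<in>UNIV. \<Sum>j\<in>UNIV. ?d j i l * v $ i * v $ j) = (\<Sum>i\<in>UNIV. \<Sum>j\<in>UNIV. ?d i j l * v $ i * v $ j)" for l
    by (subst sum.swap) (simp add: mult.commute mult.left_commute)
  have "(\<Sum>i\<in>UNIV. \<Sum>j\<in>UNIV. christoffel A g c k i j y * v $ i * v $ j)
    = (\<Sum>i\<in>UNIV. \<Sum>j\<in>UNIV. \<Sum>l\<in>UNIV. ?H l * (1/2 * (?d i j l + ?d j i l - ?d l i j) * v $ i * v $ j))"
    unfolding christoffel_def Let_def dG_nth[OF assms]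
    by (simp add: sum_distrib_left sum_distrib_right mult.commute mult.left_commute)
  also have "\<dots> = (\<Sum>i\<in>UNIV. \<Sum>l\<in>UNIV. \<Sum>j\<in>UNIV. ?H l * (1/2 * (?d i j l + ?d j i l - ?d l i j) * v $ i * v $ j))"
    by (intro sum.cong refl sum.swap)
  also have "\<dots> = (\<Sum>l\<in>UNIV. \<Sum>i\<in>UNIV. \<Sum>j\<in>UNIV. ?H l * (1/2 * (?d i j l + ?d j i l - ?d l i j) * v $ i * v $ j))"
    by (rule sum.swap)
  also have "\<dots> = (\<Sum>l\<in>UNIV. ?H l * (1/2 * (\<Sum>i\<in>UNIV. \<Sum>j\<in>UNIV. ?d i j l * v $ i * v $ j)
      + 1/2 * (\<Sum>i\<in>UNIV. \<Sum>j\<in>UNIV. ?d j i l * v $ i * v $ j)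
      - 1/2 * (\<Sum>i\<in>UNIV. \<Sum>j\<in>UNIV. ?d l i j * v $ i * v $ j)))"
    by (intro sum.cong refl)
      (simp only: sum_distrib_left[symmetric], simp add: sum_distrib_left sum_subtractf sum.distrib algebra_simps)
  also have "\<dots> = (\<Sum>l\<in>UNIV. ?H l * christoffel_form c y v $ l)"
    unfolding sw by (intro sum.cong refl)
      (simp add: christoffel_form_def sum_distrib_left sum_subtractf sum.distrib algebra_simps)
  finally show ?thesis by (simp add: matrix_vector_mult_def)
qed

text \<open>The weak form: lowered with the invertible Gram matrix and paired with all test vectors
  \<open>w\<close>, the geodesic equation is the Euler-Lagrange equation of the energy
  \<open>1/2 g (v, v)\<close>.\<close>

lemma geodesic_equation_iff:
  assumes c: "c \<in> A" "y \<in> chart_image c"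
  shows "(\<forall>k. a $ k + (\<Sum>i\<in>UNIV. \<Sum>j\<in>UNIV. christoffel A g c k i j y * v $ i * v $ j) = 0)
    \<longleftrightarrow> (\<forall>w. w \<bullet> (G c y *v a) + (v \<bullet> (dG c y v *v w) - 1/2 * (v \<bullet> (dG c y w *v v))) = 0)"
proof -
  let ?S = "christoffel_form c y v" and ?I = "matrix_inv (G c y)"
  note I = matrix_inv_mul[OF gram_invertible[OF c]]
  have "(\<forall>k. a $ k + (\<Sum>i\<in>UNIV. \<Sum>j\<in>UNIV. christoffel A g c k i j y * v $ i * v $ j) = 0)
    \<longleftrightarrow> a + ?I *v ?S = 0"
    unfolding christoffel_contracted[OF c] by (simp add: vec_eq_iff)
  also have "\<dots> \<longleftrightarrow> G c y *v a + ?S = 0"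
  proof
    assume "a + ?I *v ?S = 0"
    then have "G c y *v (a + ?I *v ?S) = 0" by simp
    then show "G c y *v a + ?S = 0" by (simp add: matrix_vector_right_distrib matrix_vector_mul_assoc I)
  next
    assume "G c y *v a + ?S = 0"
    then have "?I *v (G c y *v a + ?S) = 0" by simp
    then show "a + ?I *v ?S = 0" by (simp add: matrix_vector_right_distrib matrix_vector_mul_assoc I)
  qed
  also have "\<dots> \<longleftrightarrow> (\<forall>w. w \<bullet> (G c y *v a + ?S) = 0)"
    by (metis inner_eq_zero_iff inner_zero_right)
  finally show ?thesis unfolding inner_add_right inner_christoffel_form[OF c] .
qed


section \<open>Invariance of the geodesic equation under changes of chart\<close>

abbreviation "D2tr c c' p a u \<equiv>
  frechet_derivative (\<lambda>z. frechet_derivative (transition c c') (at z) a) (at (snd c p)) u"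

text \<open>The product rule for \<open>gram_change\<close>, read as an identity of functions near
  \<open>snd c p\<close>: besides the new Gram matrix, both Jacobian factors are differentiated,
  giving the two terms with \<open>D2tr\<close>.\<close>

lemma gram_derivative_change:
  assumes c: "c \<in> A" "c' \<in> A" and p: "p \<in> fst c" "p \<in> fst c'"
  shows "a \<bullet> (dG c (snd c p) u *v b)
    = Dtr c c' p a \<bullet> (dG c' (snd c' p) (Dtr c c' p u) *v Dtr c c' p b)
      + D2tr c c' p a u \<bullet> (G c' (snd c' p) *v Dtr c c' p b)
      + Dtr c c' p a \<bullet> (G c' (snd c' p) *v D2tr c c' p b u)"
proof -
  let ?S = "snd c ` (fst c \<inter> fst c')" and ?y = "snd c p" and ?\<phi> = "transition c c'"
  let ?D = "\<lambda>z. frechet_derivative ?\<phi> (at z)"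
  have S: "open ?S" "?y \<in> ?S" using open_overlap c p by auto
  have \<phi>y: "?\<phi> ?y = snd c' p" using c p by (simp add: transition_apply)
  note sm = smooth_transition[OF c]
  have P: "((\<lambda>z. ?D z a) has_derivative D2tr c c' p a) (at ?y)" for a
    by (rule smooth_on_has_derivative[OF smooth_on_frechet[OF sm] S(2)])
  have Q: "((\<lambda>z. G c' (?\<phi> z)) has_derivative (\<lambda>u. dG c' (snd c' p) (?D ?y u))) (at ?y)"
    using has_derivative_compose[OF smooth_on_has_derivative[OF sm S(2)],
        of "G c'" "\<lambda>u. dG c' (snd c' p) u"]
      smooth_on_has_derivative[OF smooth_gram[OF c(2)] in_chart_image[OF p(2)]]
    by (simp add: \<phi>y)
  note bounded_bilinear.FDERIV[OF bounded_bilinear_inner P[of a]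
      bounded_bilinear.FDERIV[OF bounded_bilinear_matrix_vector Q P[of b]]]
  then have 1: "((\<lambda>z. a \<bullet> (G c z *v b)) has_derivative
    (\<lambda>u. ?D ?y a \<bullet> (G c' (?\<phi> ?y) *v D2tr c c' p b u + dG c' (snd c' p) (?D ?y u) *v ?D ?y b)
      + D2tr c c' p a u \<bullet> (G c' (?\<phi> ?y) *v ?D ?y b))) (at ?y)"
  proof (rule has_derivative_transform_within_open[OF _ S])
    fix z assume "z \<in> ?S"
    then obtain q where q: "q \<in> fst c" "q \<in> fst c'" "z = snd c q" by auto
    then show "?D z a \<bullet> (G c' (?\<phi> z) *v ?D z b) = a \<bullet> (G c z *v b)"
      using gram_change[OF c q(1,2), of a b] c by (simp add: transition_apply)
  qed
  have 2: "((\<lambda>z. a \<bullet> (G c z *v b)) has_derivative (\<lambda>u. a \<bullet> (dG c ?y u *v b))) (at ?y)"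
  proof -
    have "bounded_linear (\<lambda>M. a \<bullet> (M *v b))"
      by (intro bounded_linear_compose[OF bounded_linear_inner_right]
          bounded_bilinear.bounded_linear_left[OF bounded_bilinear_matrix_vector])
    from bounded_linear.has_derivative[OF this smooth_on_has_derivative[OF smooth_gram[OF c(1)] in_chart_image[OF p(1)]]]
    show ?thesis .
  qed
  show ?thesis using fun_cong[OF has_derivative_unique[OF 1 2], of u]
    by (simp add: inner_add_right \<phi>y)
qed

text \<open>The acceleration picks up \<open>D2tr c c' p v v\<close>, which is matched by a term
  from the derivative of the metric. The remaining terms, in the mixed second derivative
  \<open>D2tr c c' p v w\<close>, cancel because second derivatives and the Gram matrix are
  symmetric; the factor \<open>1/2\<close> makes them balance.\<close>

lemma geodesic_form_change:
  assumes c: "c \<in> A" "c' \<in> A" and p: "p \<in> fst c" "p \<in> fst c'"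
  defines "E \<equiv> \<lambda>c y v a w. w \<bullet> (G c y *v a) + (v \<bullet> (dG c y v *v w) - 1/2 * (v \<bullet> (dG c y w *v v)))"
  shows "E c (snd c p) v a w
    = E c' (snd c' p) (Dtr c c' p v) (Dtr c c' p a + D2tr c c' p v v) (Dtr c c' p w)"
proof -
  have "snd c p \<in> snd c ` (fst c \<inter> fst c')" using p by auto
  then have s: "D2tr c c' p w v = D2tr c c' p v w"
    by (rule frechet_derivative_symmetric[OF smooth_transition[OF c] open_overlap[OF c]])
  note gs = gram_sym[OF c(2) in_chart_image[OF p(2)]]
  show ?thesis
    unfolding E_def gram_change[OF c p] gram_derivative_change[OF c p] s
    using gs[of "Dtr c c' p w" "D2tr c c' p v v"] gs[of "Dtr c c' p v" "D2tr c c' p v w"]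
    by (simp add: matrix_vector_right_distrib inner_add_right add_divide_distrib)
qed

lemma geodesic_equation_change:
  assumes c: "c \<in> A" "c' \<in> A" and p: "p \<in> fst c" "p \<in> fst c'"
    and eq: "\<forall>k. a $ k + (\<Sum>i\<in>UNIV. \<Sum>j\<in>UNIV. christoffel A g c k i j (snd c p) * v $ i * v $ j) = 0"
  shows "(Dtr c c' p a + D2tr c c' p v v) $ k + (\<Sum>i\<in>UNIV. \<Sum>j\<in>UNIV.
    christoffel A g c' k i j (snd c' p) * Dtr c c' p v $ i * Dtr c c' p v $ j) = 0"
proof -
  note e = eq[unfolded geodesic_equation_iff[OF c(1) in_chart_image[OF p(1)]] geodesic_form_change[OF c p]]
  have "\<forall>k. (Dtr c c' p a + D2tr c c' p v v) $ k + (\<Sum>i\<in>UNIV. \<Sum>j\<in>UNIV.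
    christoffel A g c' k i j (snd c' p) * Dtr c c' p v $ i * Dtr c c' p v $ j) = 0"
    unfolding geodesic_equation_iff[OF c(2) in_chart_image[OF p(2)]]
  proof
    fix w
    show "w \<bullet> (G c' (snd c' p) *v (Dtr c c' p a + D2tr c c' p v v))
      + (Dtr c c' p v \<bullet> (dG c' (snd c' p) (Dtr c c' p v) *v w)
        - 1 / 2 * (Dtr c c' p v \<bullet> (dG c' (snd c' p) w *v Dtr c c' p v))) = 0"
      \<comment> \<open>Every test vector \<open>w\<close> of the new chart is the image of
        \<open>Dtr c' c p w\<close>.\<close>
      using e[rule_format, of "Dtr c' c p w"] Dtr_inverse[OF c(2,1) p(2,1), of w] by simp
  qed
  then show ?thesis by blast
qed

section \<open>Geodesics as integral curves of the spray\<close>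

lemma smooth_christoffel:
  assumes c: "c \<in> A"
  shows "smooth_on (chart_image c) (christoffel A g c k i j)"
proof -
  note o = open_chart_image[OF c]
  have d: "smooth_on (chart_image c) (\<lambda>y. frechet_derivative (\<lambda>z. G c z $ a $ b) (at y) u)" for a b u
    by (intro smooth_on_frechet smooth_on_nth o smooth_gram c)
  have "smooth_on (chart_image c) (\<lambda>y. 1/2 * (\<Sum>l\<in>UNIV. matrix_inv (G c y) $ k $ l *
    (frechet_derivative (\<lambda>z. G c z $ j $ l) (at y) (axis i 1) +
     frechet_derivative (\<lambda>z. G c z $ i $ l) (at y) (axis j 1) +
     -1 * frechet_derivative (\<lambda>z. G c z $ i $ j) (at y) (axis l 1))))"
    by (intro smooth_on_mult smooth_on_sum smooth_on_add smooth_on_const d o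
        smooth_on_matrix_inv smooth_gram gram_invertible c)
  then show ?thesis by (simp add: christoffel_def[abs_def] Let_def)
qed

text \<open>The geodesic spray of the chart turns the second-order equation into a first-order one
  for position and velocity, to which \<open>smooth_flow\<close> applies.\<close>

lemma smooth_spray:
  assumes c: "c \<in> A"
  shows "smooth_on (chart_image c \<times> UNIV)
    (\<lambda>p. (snd p, \<chi> k. - (\<Sum>i\<in>UNIV. \<Sum>j\<in>UNIV. christoffel A g c k i j (fst p) * snd p $ i * snd p $ j)))"
proof -
  have o: "open (chart_image c \<times> (UNIV :: (real ^ 'd) set))"
    using open_chart_image[OF c] open_UNIV by (rule open_Times)
  have f: "smooth_on (chart_image c \<times> (UNIV :: (real ^ 'd) set)) (\<lambda>p. christoffel A g c k i j (fst p))" for k i j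
    by (rule smooth_on_compose[OF o open_chart_image[OF c] _ smooth_christoffel[OF c]])
      (auto intro: smooth_on_bounded_linear bounded_linear_fst)
  have s: "smooth_on (chart_image c \<times> (UNIV :: (real ^ 'd) set)) (\<lambda>p. snd p $ i)" for i
    by (intro smooth_on_nth o smooth_on_bounded_linear bounded_linear_snd)
  have "smooth_on (chart_image c \<times> UNIV) (\<lambda>p. (snd p,
      \<chi> k. -1 * (\<Sum>i\<in>UNIV. \<Sum>j\<in>UNIV. christoffel A g c k i j (fst p) * snd p $ i * snd p $ j)))"
    by (intro smooth_on_Pair smooth_on_vec smooth_on_mult smooth_on_sum smooth_on_const o f s
        smooth_on_bounded_linear bounded_linear_snd)
  then show ?thesis by simp
qed

text \<open>The integral curve of the spray solves the equation in \<open>c\<close>; the definition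
  of a geodesic asks for it in every chart, whence \<open>geodesic_equation_change\<close>. The
  conclusions on \<open>v\<close> and \<open>a\<close> retain the coordinate equation at time
  \<open>0\<close>, from which a single component is isolated later.\<close>

lemma geodesic_existence:
  assumes c: "c \<in> A" "p \<in> fst c"
  obtains r \<gamma> v a where "r > 0" "geodesic X A g {-r<..<r} \<gamma>" "\<gamma> 0 = p"
    "velocity A \<gamma> 0 = tvec A c p b"
    "\<And>t. t \<in> {-r<..<r} \<Longrightarrow> \<gamma> t \<in> fst c"
    "\<And>t. t \<in> {-r<..<r} \<Longrightarrow> ((\<lambda>t. snd c (\<gamma> t)) has_vector_derivative v t) (at t)"
    "v 0 = b" "(v has_vector_derivative a) (at 0)"
    "\<And>k. a $ k = - (\<Sum>i\<in>UNIV. \<Sum>j\<in>UNIV. christoffel A g c k i j (snd c p) * b $ i * b $ j)"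
proof -
  let ?U = "chart_image c \<times> (UNIV :: (real ^ 'd) set)"
  let ?V = "\<lambda>p. (snd p, \<chi> k. - (\<Sum>i\<in>UNIV. \<Sum>j\<in>UNIV. christoffel A g c k i j (fst p) * snd p $ i * snd p $ j))"
  have o: "open ?U" using open_chart_image[OF c(1)] open_UNIV by (rule open_Times)
  have "(snd c p, b) \<in> ?U" using in_chart_image c by simp
  then obtain Y r \<phi> where Y: "open Y" "(snd c p, b) \<in> Y" and r: "r > 0" and sm: "smooth_on (Y \<times> {-r<..<r}) \<phi>"
    and \<phi>0: "\<And>y. y \<in> Y \<Longrightarrow> \<phi> (y, 0) = y"
    and \<phi>U: "\<And>y t. y \<in> Y \<Longrightarrow> t \<in> {-r<..<r} \<Longrightarrow> \<phi> (y, t) \<in> ?U"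
    and \<phi>: "\<And>y t. y \<in> Y \<Longrightarrow> t \<in> {-r<..<r} \<Longrightarrow> ((\<lambda>t. \<phi> (y, t)) has_vector_derivative ?V (\<phi> (y, t))) (at t)"
    by (rule smooth_flow[OF o smooth_spray[OF c(1)]]) blast
  define y where "y t = fst (\<phi> ((snd c p, b), t))" for t
  define v where "v t = snd (\<phi> ((snd c p, b), t))" for t
  define a where "a t = (\<chi> k. - (\<Sum>i\<in>UNIV. \<Sum>j\<in>UNIV. christoffel A g c k i j (y t) * v t $ i * v t $ j))" for t
  let ?J = "{-r<..<r}"
  have J: "open ?J" by simp
  have y': "(y has_vector_derivative v t) (at t)" and v': "(v has_vector_derivative a t) (at t)" if "t \<in> ?J" for t
    using bounded_linear.has_vector_derivative[OF bounded_linear_fst \<phi>[OF Y(2) that]]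
      bounded_linear.has_vector_derivative[OF bounded_linear_snd \<phi>[OF Y(2) that]]
    by (simp_all add: y_def[abs_def] v_def[abs_def] a_def)
  have y0: "y 0 = snd c p" and v0: "v 0 = b" using \<phi>0[OF Y(2)] by (simp_all add: y_def v_def)
  have yc: "y t \<in> chart_image c" if "t \<in> ?J" for t
    using \<phi>U[OF Y(2) that] by (auto simp: y_def mem_Times_iff)
  have ysm: "smooth_on ?J y"
  proof -
    have "smooth_on ?J (\<lambda>t. ((snd c p, b), t))"
      by (rule smooth_on_Pair[OF J smooth_on_const smooth_on_bounded_linear[OF bounded_linear_ident]])
    from smooth_on_compose[OF J open_Times[OF Y(1) J] _ sm this]
    have "smooth_on ?J (\<lambda>t. \<phi> ((snd c p, b), t))" using Y(2) by (simp add: image_subset_iff)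
    from smooth_on_linear_compose[OF bounded_linear_fst J this]
    show ?thesis unfolding y_def[abs_def] .
  qed
  define \<gamma> where "\<gamma> t = cinv c (y t)" for t
  have \<gamma>c: "\<gamma> t \<in> fst c" and \<gamma>y: "snd c (\<gamma> t) = y t" if "t \<in> ?J" for t
    using cinv_in[OF yc[OF that]] chart_cinv[OF yc[OF that]] by (auto simp: \<gamma>_def)
  have ycont: "continuous_on ?J y" by (rule smooth_on_imp_continuous_on[OF ysm])
  have \<gamma>cont: "continuous_map (top_of_set ?J) X \<gamma>"
  proof -
    have "continuous_map (top_of_set ?J) (top_of_set (chart_image c)) y"
      using ycont yc by (auto simp: continuous_map_in_subtopology)
    from continuous_map_compose[OF this continuous_map_chart_cinv[OF c(1)]]
    show ?thesis by (simp add: continuous_map_in_subtopology \<gamma>_def[abs_def] o_def)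
  qed
  \<comment> \<open>All that the definition requires in another chart \<open>c'\<close>. The curve
    may be only partly in its domain, so derivatives are taken on the open set of times spent
    there.\<close>
  have *: "smooth_on {t \<in> ?J. \<gamma> t \<in> fst c'} (snd c' \<circ> \<gamma>) \<and> open {t \<in> ?J. \<gamma> t \<in> fst c'} \<and>
      (\<forall>t\<in>?J. \<gamma> t \<in> fst c' \<longrightarrow> velocity A \<gamma> t c' = Dtr c c' (\<gamma> t) (v t) \<and>
        vector_derivative (\<lambda>s. velocity A \<gamma> s c') (at t)
          = Dtr c c' (\<gamma> t) (a t) + D2tr c c' (\<gamma> t) (v t) (v t))" if c': "c' \<in> A" for c'
  proof -
    let ?T = "{t \<in> ?J. \<gamma> t \<in> fst c'}" and ?S = "snd c ` (fst c \<inter> fst c')"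
    have T: "?T = ?J \<inter> y -` ?S"
    proof -
      have "\<gamma> t \<in> fst c'" if "t \<in> ?J" "y t = snd c q" "q \<in> fst c" "q \<in> fst c'" for t q
        using that cinv_chart[OF c(1)] by (simp add: \<gamma>_def)
      moreover have "y t \<in> ?S" if "t \<in> ?J" "\<gamma> t \<in> fst c'" for t
        using that \<gamma>c \<gamma>y by (intro image_eqI[of _ _ "\<gamma> t"]) auto
      ultimately show ?thesis by blast
    qed
    have oT: "open ?T"
      unfolding T by (rule continuous_open_preimage[OF ycont J open_overlap[OF c(1) c']])
    have tr: "snd c' (\<gamma> t) = transition c c' (y t)" if "t \<in> ?T" for t
      using that transition_apply[OF c(1) \<gamma>c, of t] \<gamma>y by simp
    have "smooth_on ?T (\<lambda>t. transition c c' (y t))"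
      by (rule smooth_on_compose[OF oT open_overlap[OF c(1) c'] _ smooth_transition[OF c(1) c']
            smooth_on_subset[OF ysm]]) (use T in auto)
    then have sm: "smooth_on ?T (snd c' \<circ> \<gamma>)"
      by (rule smooth_on_cong[OF oT, rotated]) (simp add: tr)
    have vel: "velocity A \<gamma> t c' = frechet_derivative (transition c c') (at (y t)) (v t)"
      if t: "t \<in> ?T" for t
    proof -
      have yS: "y t \<in> ?S" using t T by blast
      note d = smooth_on_has_derivative[OF smooth_transition[OF c(1) c'] yS]
      have "((\<lambda>t. transition c c' (y t)) has_vector_derivative frechet_derivative (transition c c') (at (y t)) (v t)) (at t)"
        using has_derivative_compose[OF y'[unfolded has_vector_derivative_def] d]
          linear_scale[OF has_derivative_linear[OF d]] t
        by (simp add: has_vector_derivative_def)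
      then have "((snd c' \<circ> \<gamma>) has_vector_derivative frechet_derivative (transition c c') (at (y t)) (v t)) (at t)"
        by (rule has_vector_derivative_transform_within_open[OF _ oT t]) (simp add: tr)
      from vector_derivative_at[OF this] show ?thesis using t c' by (simp add: velocity_def)
    qed
    have acc: "vector_derivative (\<lambda>s. velocity A \<gamma> s c') (at t)
          = frechet_derivative (transition c c') (at (y t)) (a t) +
            frechet_derivative (\<lambda>z. frechet_derivative (transition c c') (at z) (v t)) (at (y t)) (v t)"
      if t: "t \<in> ?T" for t
    proof (rule vector_derivative_at, rule has_vector_derivative_transform_within_open[OF _ oT t])
      show "((\<lambda>s. frechet_derivative (transition c c') (at (y s)) (v s)) has_vector_derivative
        frechet_derivative (transition c c') (at (y t)) (a t) +
            frechet_derivative (\<lambda>z. frechet_derivative (transition c c') (at z) (v t)) (at (y t)) (v t)) (at t)"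
        using t T by (intro has_vector_derivative_frechet_along[OF smooth_transition[OF c(1) c'] open_overlap[OF c(1) c'] oT]
            y' v') auto
      show "frechet_derivative (transition c c') (at (y s)) (v s) = velocity A \<gamma> s c'" if "s \<in> ?T" for s
        using vel[OF that] by simp
    qed
    show ?thesis using sm oT vel acc \<gamma>y by simp
  qed
  have geo: "geodesic X A g ?J \<gamma>"
    unfolding geodesic_def smooth_curve_def
  proof (intro conjI ballI impI allI)
    show "is_interval ?J" by simp
    show "smooth_on {t \<in> ?J. \<gamma> t \<in> fst c'} (snd c' \<circ> \<gamma>)" if "c' \<in> A" for c' using *[OF that] by blast
    fix c' t k assume c': "c' \<in> A" and t: "t \<in> ?J" "\<gamma> t \<in> fst c'"
    have eq: "\<forall>k. a t $ k + (\<Sum>i\<in>UNIV. \<Sum>j\<in>UNIV. christoffel A g c k i j (snd c (\<gamma> t)) * v t $ i * v t $ j) = 0"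
      by (simp add: a_def \<gamma>y[OF t(1)])
    show "vector_derivative (\<lambda>s. velocity A \<gamma> s c') (at t) $ k +
             (\<Sum>i\<in>UNIV. \<Sum>j\<in>UNIV. christoffel A g c' k i j (snd c' (\<gamma> t)) *
                velocity A \<gamma> t c' $ i * velocity A \<gamma> t c' $ j) = 0"
      using geodesic_equation_change[OF c(1) c' \<gamma>c[OF t(1)] t(2) eq, of k] *[OF c'] t by simp
  qed (use \<gamma>cont in auto)
  show thesis
  proof (rule that[OF r geo _ _ \<gamma>c _ v0 v'])
    show \<gamma>0: "\<gamma> 0 = p" using y0 cinv_chart[OF c] by (simp add: \<gamma>_def)
    show "velocity A \<gamma> 0 = tvec A c p b"
    proof
      fix c'
      show "velocity A \<gamma> 0 c' = tvec A c p b c'"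
        using * r by (cases "c' \<in> A \<and> p \<in> fst c'") (auto simp: \<gamma>0 v0 tvec_def velocity_def)
    qed
    show "((\<lambda>t. snd c (\<gamma> t)) has_vector_derivative v t) (at t)" if "t \<in> ?J" for t
      by (rule has_vector_derivative_transform_within_open[OF y'[OF that] J that]) (simp add: \<gamma>y)
    show "a 0 $ k = - (\<Sum>i\<in>UNIV. \<Sum>j\<in>UNIV. christoffel A g c k i j (snd c p) * b $ i * b $ j)" for k
      by (simp add: a_def y0 v0)
  qed (use r in auto)
qed

end

section \<open>Foliated charts\<close>

lemma foliated_chart_constant:
  assumes fol: "foliated_chart X F c k" "L \<in> F" and S: "connectedin X S" "S \<subseteq> fst c \<inter> L"
    and ab: "a \<in> S" "b \<in> S"
  shows "snd c a $ k = snd c b $ k"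
proof -
  let ?T = "subtopology X (fst c \<inter> L)"
  have S': "connectedin ?T S" using S by (simp add: connectedin_subtopology)
  have "a \<in> topspace ?T" using S' ab connectedin_subset_topspace by blast
  then have "connected_component_of_set ?T a \<in> connected_components_of ?T"
    unfolding connected_components_of_def by blast
  then obtain r where "connected_component_of_set ?T a = {q \<in> fst c. snd c q $ k = r}"
    using fol unfolding foliated_chart_def by blast
  moreover have "S \<subseteq> connected_component_of_set ?T a"
    by (rule connected_component_of_maximal[OF S' ab(1)])
  ultimately show ?thesis using ab by auto
qed

text \<open>The plaque through \<open>a\<close> is by definition a full level of the coordinate,
  hence contains \<open>b\<close>.\<close>

lemma foliated_chart_leaf:
  assumes fol: "foliated_chart X F c k" "L \<in> F" and a: "a \<in> fst c" "a \<in> L" "a \<in> topspace X"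
    and b: "b \<in> fst c" "snd c a $ k = snd c b $ k"
  shows "b \<in> L"
proof -
  let ?T = "subtopology X (fst c \<inter> L)"
  have aT: "a \<in> topspace ?T" using a by simp
  then have P: "connected_component_of_set ?T a \<in> connected_components_of ?T"
    unfolding connected_components_of_def by blast
  then obtain r where r: "connected_component_of_set ?T a = {q \<in> fst c. snd c q $ k = r}"
    using fol unfolding foliated_chart_def by blast
  have "a \<in> connected_component_of_set ?T a"
    using aT by (simp add: connected_component_of_refl)
  then have "b \<in> connected_component_of_set ?T a" using r b by auto
  then show ?thesis using connected_components_of_subset[OF P] by auto
qed

context lorentz
begin

lemma connectedin_cinv:
  assumes "c \<in> A" "connected S" "S \<subseteq> chart_image c"
  shows "connectedin X (cinv c ` S)"
proof -
  have "continuous_map (top_of_set (chart_image c)) X (cinv c)"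
    using continuous_map_chart_cinv[OF assms(1)] by (simp add: continuous_map_in_subtopology)
  moreover have "connectedin (top_of_set (chart_image c)) S"
    using assms by (simp add: connectedin_subtopology)
  ultimately show ?thesis using connectedin_continuous_map_image by blast
qed

text \<open>A straight segment in the chart \<open>c\<close> with direction \<open>a\<close> stays
  on a level, hence in one leaf and, being connected, in one plaque of \<open>c'\<close>.
  Differentiating the constant coordinate \<open>k'\<close> along it gives the claim, which makes
  tangency to the foliation independent of the foliated chart.\<close>

lemma foliated_transition:
  assumes F: "codim1_foliation X A F" and c: "c \<in> A" "c' \<in> A" and p: "p \<in> fst c" "p \<in> fst c'"
    and fol: "foliated_chart X F c k" "foliated_chart X F c' k'" and a: "a $ k = 0"
  shows "Dtr c c' p a $ k' = 0"
proof -
  let ?y = "snd c p" and ?S = "snd c ` (fst c \<inter> fst c')"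
  have pX: "p \<in> topspace X" using chart_subset c p by blast
  then obtain L where L: "L \<in> F" "p \<in> L"
    using F unfolding codim1_foliation_def partition_on_def by blast
  obtain d where d: "d > 0" "ball ?y d \<subseteq> ?S"
    using open_overlap[OF c] p open_contains_ball by blast
  define e where "e = d / (norm a + 1)"
  have n: "norm a + 1 > 0" using norm_ge_zero[of a] by linarith
  have e: "e > 0" using d n by (simp add: e_def)
  have yt: "?y + t *\<^sub>R a \<in> ?S" if "t \<in> {-e<..<e}" for t
  proof -
    have "\<bar>t\<bar> * norm a \<le> e * norm a" using that by (intro mult_right_mono) auto
    also have "\<dots> < e * (norm a + 1)" using e by simp
    also have "\<dots> = d" using n by (simp add: e_def)
    finally show ?thesis by (intro subsetD[OF d(2)]) (simp add: dist_norm)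
  qed
  let ?\<sigma> = "\<lambda>t. cinv c (?y + t *\<^sub>R a)"
  have Sc: "?S \<subseteq> chart_image c" unfolding chart_image_def by blast
  have \<sigma>: "?\<sigma> t \<in> fst c" "?\<sigma> t \<in> fst c'" "snd c (?\<sigma> t) = ?y + t *\<^sub>R a" if t: "t \<in> {-e<..<e}" for t
  proof -
    obtain q where q: "q \<in> fst c" "q \<in> fst c'" "?y + t *\<^sub>R a = snd c q" using yt[OF t] by blast
    then show "?\<sigma> t \<in> fst c" "?\<sigma> t \<in> fst c'" "snd c (?\<sigma> t) = ?y + t *\<^sub>R a"
      using cinv_chart[OF c(1), of q] by auto
  qed
  have \<sigma>L: "?\<sigma> t \<in> L" if "t \<in> {-e<..<e}" for t
    using foliated_chart_leaf[OF fol(1) L(1) p(1) L(2) pX \<sigma>(1)[OF that]] \<sigma>(3)[OF that] a by simp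
  have "connected ((\<lambda>t. ?y + t *\<^sub>R a) ` {-e<..<e})"
    by (intro connected_continuous_image continuous_intros) auto
  then have "connectedin X (cinv c ` ((\<lambda>t. ?y + t *\<^sub>R a) ` {-e<..<e}))"
    using yt Sc by (intro connectedin_cinv c) auto
  then have con: "connectedin X (?\<sigma> ` {-e<..<e})" by (simp only: image_image)
  have const: "snd c' (?\<sigma> t) $ k' = snd c' (?\<sigma> 0) $ k'" if "t \<in> {-e<..<e}" for t
  proof (rule foliated_chart_constant[OF fol(2) L(1) con])
    show "?\<sigma> ` {-e<..<e} \<subseteq> fst c' \<inter> L" using \<sigma>(2) \<sigma>L by blast
    show "?\<sigma> t \<in> ?\<sigma> ` {-e<..<e}" by (rule imageI[OF that])
    show "?\<sigma> 0 \<in> ?\<sigma> ` {-e<..<e}" by (rule imageI) (use e in simp)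
  qed
  have tr: "transition c c' (?y + t *\<^sub>R a) = snd c' (?\<sigma> t)" for t
    by (simp add: transition_def)
  have "((\<lambda>t. ?y + t *\<^sub>R a) has_derivative (\<lambda>t. t *\<^sub>R a)) (at 0)"
    by (auto intro!: derivative_eq_intros)
  moreover have "(transition c c' has_derivative Dtr c c' p) (at (?y + 0 *\<^sub>R a))"
    using transition_has_derivative c p by simp
  ultimately have "((\<lambda>t. transition c c' (?y + t *\<^sub>R a)) has_derivative (\<lambda>t. Dtr c c' p (t *\<^sub>R a))) (at 0)"
    by (rule has_derivative_compose)
  from bounded_linear.has_derivative[OF bounded_linear_vec_nth this, of k']
  have 1: "((\<lambda>t. snd c' (?\<sigma> t) $ k') has_derivative (\<lambda>t. Dtr c c' p (t *\<^sub>R a) $ k')) (at 0)"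
    by (simp only: tr)
  have 2: "((\<lambda>t. snd c' (?\<sigma> t) $ k') has_derivative (\<lambda>t. 0)) (at 0)"
    by (rule has_derivative_transform_within_open[OF has_derivative_const[of "snd c' (?\<sigma> 0) $ k'"],
          of "{-e<..<e}"]) (use e const in auto)
  show ?thesis using fun_cong[OF has_derivative_unique[OF 1 2], of 1] by simp
qed

lemma foliation_tangent_eq:
  assumes F: "codim1_foliation X A F" and c: "c \<in> A" "p \<in> fst c" "foliated_chart X F c k"
  shows "foliation_tangent X A F p = {\<xi> \<in> tangent_space A p. \<xi> c $ k = 0}"
proof -
  have "\<xi> c $ k = 0" if "\<xi> \<in> tangent_space A p" "c' \<in> A" "p \<in> fst c'" "foliated_chart X F c' k'" "\<xi> c' $ k' = 0"
    for \<xi> c' k'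
  proof -
    have "\<xi> c = Dtr c' c p (\<xi> c')" using that(1-3) c unfolding tangent_space_def by blast
    then show ?thesis using foliated_transition[OF F that(2) c(1) that(3) c(2) that(4) c(3) that(5)] by simp
  qed
  then show ?thesis
    using c unfolding foliation_tangent_def coord_differential_def by blast
qed

text \<open>The vector in question is the gradient of the coordinate \<open>k\<close>. The
  degenerate direction \<open>\<xi>\<close> of the leaf is orthogonal to all \<open>axis i 1\<close>
  with \<open>i \<noteq> k\<close>, so lowering its index gives a multiple of
  \<open>axis k 1\<close>, and \<open>\<xi>\<close> is a nonzero multiple of the gradient;
  \<open>\<xi>\<close> being tangent, so is the gradient.\<close>

lemma grad_tangent:
  assumes F: "codim1_foliation X A F" and l: "lightlike X A g F"
    and c: "c \<in> A" "y \<in> chart_image c" "foliated_chart X F c k"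
  shows "(matrix_inv (G c y) *v axis k 1) $ k = 0"
proof -
  let ?p = "cinv c y"
  have p: "?p \<in> fst c" "snd c ?p = y" using c cinv_in chart_cinv by blast+
  then have "?p \<in> topspace X" using chart_subset c by blast
  then obtain \<xi> where \<xi>: "\<xi> \<in> foliation_tangent X A F ?p" "\<xi> \<noteq> (\<lambda>c. 0)"
    "\<And>\<eta>. \<eta> \<in> foliation_tangent X A F ?p \<Longrightarrow> g ?p \<xi> \<eta> = 0"
    using l unfolding lightlike_def by blast
  note ft = foliation_tangent_eq[OF F c(1) p(1) c(3)]
  have \<xi>T: "\<xi> \<in> tangent_space A ?p" "\<xi> c $ k = 0" using \<xi>(1) ft by auto
  have nz: "\<xi> c \<noteq> 0"
  proof
    assume "\<xi> c = 0"
    then have "\<xi> = tvec A c ?p (0 *\<^sub>R 0 + 0 *\<^sub>R 0)" using tvec_eq[OF \<xi>T(1) c(1) p(1)] by simp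
    then show False using \<xi>(2) unfolding tvec_lin_comb[OF c(1) p(1)] by simp
  qed
  have "axis i 1 \<bullet> (G c y *v \<xi> c) = 0" if "i \<noteq> k" for i
  proof -
    have "tvec A c ?p (axis i 1) \<in> foliation_tangent X A F ?p"
      unfolding ft using that tvec_in[OF c(1) p(1)] tvec_self[OF c(1) p(1)] by (simp add: axis_def)
    then have "g ?p \<xi> (tvec A c ?p (axis i 1)) = 0" by (rule \<xi>(3))
    then show ?thesis
      using metric_expansion[OF c(1) p(1) \<xi>T(1) tvec_in[OF c(1) p(1)]] gram_sym[OF c(1,2)] p(2)
        tvec_self[OF c(1) p(1)] by metis
  qed
  then have "(G c y *v \<xi> c) $ i = 0" if "i \<noteq> k" for i using that by (simp add: inner_axis')
  then have "G c y *v \<xi> c = (G c y *v \<xi> c) $ k *\<^sub>R axis k 1"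
    by (auto simp: vec_eq_iff axis_def)
  moreover have "matrix_inv (G c y) *v (G c y *v \<xi> c) = \<xi> c"
    using matrix_inv_mul(2)[OF gram_invertible[OF c(1,2)]] by (simp add: matrix_vector_mul_assoc)
  ultimately have "\<xi> c = (G c y *v \<xi> c) $ k *\<^sub>R (matrix_inv (G c y) *v axis k 1)"
    by (metis matrix_vector_mult_scaleR)
  then show ?thesis using nz \<xi>T(2) by (metis mult_eq_0_iff scaleR_eq_0_iff vector_scaleR_component)
qed

end

section \<open>Flow boxes\<close>

definition box_at_0 :: "real \<Rightarrow> (real ^ 'd) set" where
  "box_at_0 d = {s. \<forall>i. \<bar>s $ i\<bar> < d}"

lemma open_box_at_0: "open (box_at_0 d :: (real ^ 'd) set)"
proof -
  have "open {s :: real ^ 'd. \<bar>s $ i\<bar> < d}" for i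
    by (intro open_Collect_less continuous_intros)
  moreover have "box_at_0 d = (\<Inter>i\<in>UNIV. {s :: real ^ 'd. \<bar>s $ i\<bar> < d})" by (auto simp: box_at_0_def)
  ultimately show ?thesis by (simp add: open_INT)
qed

lemma convex_box_at_0: "convex (box_at_0 d :: (real ^ 'd) set)"
proof -
  have "convex {s :: real ^ 'd. \<bar>s $ i\<bar> < d}" for i
  proof -
    have "{s :: real ^ 'd. \<bar>s $ i\<bar> < d} = {s. axis i 1 \<bullet> s < d} \<inter> {s. axis i 1 \<bullet> s > - d}"
      by (auto simp: inner_axis' abs_less_iff)
    then show ?thesis by (simp add: convex_halfspace_lt convex_halfspace_gt convex_Int)
  qed
  moreover have "box_at_0 d = (\<Inter>i\<in>UNIV. {s :: real ^ 'd. \<bar>s $ i\<bar> < d})" by (auto simp: box_at_0_def)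
  ultimately show ?thesis by (simp add: convex_INT)
qed

lemma box_at_0_subset:
  assumes "open U" "(0 :: real ^ 'd) \<in> U"
  obtains d where "d > 0" "box_at_0 d \<subseteq> U"
proof -
  obtain e where e: "e > 0" "ball 0 e \<subseteq> U" using assms open_contains_ball by blast
  define d where "d = e / CARD('d)"
  have "box_at_0 d \<subseteq> ball (0 :: real ^ 'd) e"
  proof
    fix s :: "real ^ 'd" assume s: "s \<in> box_at_0 d"
    have "norm s \<le> (\<Sum>i\<in>UNIV. \<bar>s $ i\<bar>)" by (rule norm_le_l1_cart)
    also have "\<dots> < (\<Sum>i\<in>(UNIV :: 'd set). d)"
      using s by (intro sum_strict_mono) (auto simp: box_at_0_def)
    also have "\<dots> = e" by (simp add: d_def)
    finally show "s \<in> ball 0 e" by simp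
  qed
  moreover have "d > 0" using e by (simp add: d_def)
  ultimately show thesis using that e by blast
qed

text \<open>\<open>\<Psi> s\<close> flows for time \<open>s $ kv\<close> from a starting point in a
  hyperplane that is transverse to \<open>V\<close> at \<open>y0\<close> because
  \<open>V y0 $ k1 \<noteq> 0\<close>. The permutation \<open>\<sigma>\<close> matches old
  coordinates with new ones: the coordinate \<open>k0\<close> becomes \<open>ku\<close>, and the
  flow time takes the place of \<open>k1\<close>, as \<open>kv\<close>.\<close>

lemma flow_box:
  fixes V :: "real ^ 'd::finite \<Rightarrow> real ^ 'd" and \<sigma> :: "'d \<Rightarrow> 'd"
  assumes U: "open U" "y0 \<in> U" and V: "smooth_on U V"
    and k0: "\<And>y. y \<in> U \<Longrightarrow> V y $ k0 = 0" and k1: "V y0 $ k1 \<noteq> 0"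
    and \<sigma>: "bij \<sigma>" "\<sigma> k0 = ku" "\<sigma> k1 = kv"
  obtains d O' \<Psi> \<Theta> where "d > 0" "open O'" "y0 \<in> O'" "O' \<subseteq> U" "homeomorphism O' (box_at_0 d) \<Theta> \<Psi>"
    "smooth_on O' \<Theta>" "smooth_on (box_at_0 d) \<Psi>"
    "\<And>s. s \<in> box_at_0 d \<Longrightarrow> \<Psi> s $ k0 = y0 $ k0 + s $ ku"
    "\<And>s. s \<in> box_at_0 d \<Longrightarrow> frechet_derivative \<Psi> (at s) (axis kv 1) = V (\<Psi> s)"
proof -
  obtain Y r \<phi> where Y: "open Y" "y0 \<in> Y" and r: "r > 0" and sm: "smooth_on (Y \<times> {-r<..<r}) \<phi>"
    and \<phi>0: "\<And>y. y \<in> Y \<Longrightarrow> \<phi> (y, 0) = y"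
    and \<phi>U: "\<And>y t. y \<in> Y \<Longrightarrow> t \<in> {-r<..<r} \<Longrightarrow> \<phi> (y, t) \<in> U"
    and \<phi>: "\<And>y t. y \<in> Y \<Longrightarrow> t \<in> {-r<..<r} \<Longrightarrow> ((\<lambda>t. \<phi> (y, t)) has_vector_derivative V (\<phi> (y, t))) (at t)"
    by (rule smooth_flow[OF U(1) V U(2)]) blast
  have k01: "k0 \<noteq> k1" using k0[OF U(2)] k1 by auto
  have \<sigma>eq: "\<sigma> i = \<sigma> j \<longleftrightarrow> i = j" for i j using \<sigma>(1) by (auto dest: bij_is_inj injD)
  \<comment> \<open>The relabelled coordinates with component \<open>k1\<close> set to
    \<open>0\<close>: the starting points lie in the hyperplane on which coordinate
    \<open>k1\<close> equals that of \<open>y0\<close>.\<close>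
  define Lm where "Lm s = (\<chi> i. s $ \<sigma> i) - s $ kv *\<^sub>R axis k1 1" for s :: "real ^ 'd"
  have Lm: "linear Lm"
    unfolding Lm_def by (rule linearI) (auto simp: vec_eq_iff algebra_simps)
  have Lv: "Lm (axis kv 1) = 0"
    using \<sigma>eq[of _ k1] unfolding Lm_def \<sigma>(3) by (auto simp: vec_eq_iff axis_def)
  have Lk0: "Lm s $ k0 = s $ ku" for s using k01 \<sigma>(2) by (simp add: Lm_def axis_def)
  have bL: "bounded_linear Lm" using Lm by (simp add: linear_conv_bounded_linear)
  have L0: "Lm 0 = 0" using linear_0[OF Lm] .
  define \<iota> where "\<iota> s = (y0 + Lm s, s $ kv)" for s
  let ?Q = "Y \<times> {-r<..<r}"
  have oQ: "open ?Q" using Y by (intro open_Times) auto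
  define W where "W = \<iota> -` ?Q"
  have \<iota>': "(\<iota> has_derivative (\<lambda>v. (Lm v, v $ kv))) (at s)" for s
    unfolding \<iota>_def by (auto intro!: derivative_eq_intros bounded_linear_imp_has_derivative bL bounded_linear_vec_nth)
  have "continuous_on UNIV \<iota>"
    using \<iota>' has_derivative_continuous by (intro continuous_at_imp_continuous_on) blast
  then have oW: "open W" unfolding W_def using oQ by (rule open_vimage[rotated])
  have W0: "0 \<in> W" using Y r by (simp add: W_def \<iota>_def L0)
  define \<Psi> where "\<Psi> s = \<phi> (\<iota> s)" for s
  have smW: "smooth_on W \<Psi>"
  proof -
    have "smooth_on W \<iota>" unfolding \<iota>_def[abs_def]
      by (intro smooth_on_Pair smooth_on_add smooth_on_const smooth_on_bounded_linear bL
          bounded_linear_vec_nth oW)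
    from smooth_on_compose[OF oW oQ _ sm this] show ?thesis
      unfolding \<Psi>_def[abs_def] by (auto simp: W_def)
  qed
  have \<Psi>': "(\<Psi> has_derivative (\<lambda>v. frechet_derivative \<phi> (at (\<iota> s)) (Lm v, v $ kv))) (at s)" if "s \<in> W" for s
    unfolding \<Psi>_def
    by (rule has_derivative_compose[OF \<iota>' smooth_on_has_derivative[OF sm]]) (use that W_def in auto)
  have D\<phi>: "linear (frechet_derivative \<phi> (at q))" if "q \<in> ?Q" for q
    using smooth_on_linear[OF sm that] .
  have time: "frechet_derivative \<phi> (at (y, t)) (0, 1) = V (\<phi> (y, t))" if "(y, t) \<in> ?Q" for y t
  proof -
    have "((\<lambda>s. (y, s)) has_derivative (\<lambda>s. (0, s))) (at t)" by (auto intro!: derivative_eq_intros)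
    from has_derivative_compose[OF this smooth_on_has_derivative[OF sm that]]
    have "((\<lambda>s. \<phi> (y, s)) has_derivative (\<lambda>s. frechet_derivative \<phi> (at (y, t)) (0, s))) (at t)" .
    moreover have "((\<lambda>s. \<phi> (y, s)) has_derivative (\<lambda>s. s *\<^sub>R V (\<phi> (y, t)))) (at t)"
      using \<phi>[of y t] that by (simp add: has_vector_derivative_def)
    ultimately show ?thesis using has_derivative_unique[of "\<lambda>s. \<phi> (y, s)"] by (metis scaleR_one)
  qed
  have space: "frechet_derivative \<phi> (at (y, 0)) (w, 0) = w" if "y \<in> Y" for y w
  proof -
    have y: "(y, 0) \<in> ?Q" using that r by simp
    have "((\<lambda>z. (z, 0::real)) has_derivative (\<lambda>w. (w, 0))) (at y)" by (auto intro!: derivative_eq_intros)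
    from has_derivative_compose[OF this smooth_on_has_derivative[OF sm y]]
    have "((\<lambda>z. \<phi> (z, 0)) has_derivative (\<lambda>w. frechet_derivative \<phi> (at (y, 0)) (w, 0))) (at y)" .
    moreover have "((\<lambda>z. \<phi> (z, 0)) has_derivative (\<lambda>w. w)) (at y)"
      by (rule has_derivative_transform_within_open[OF has_derivative_ident Y(1) that]) (simp add: \<phi>0)
    ultimately show ?thesis using has_derivative_unique[of "\<lambda>z. \<phi> (z, 0)"] by metis
  qed
  have \<Psi>v: "frechet_derivative \<Psi> (at s) (axis kv 1) = V (\<Psi> s)" if "s \<in> W" for s
  proof -
    have "\<iota> s \<in> ?Q" using that by (simp add: W_def)
    then show ?thesis
      unfolding frechet_derivative_eqI[OF \<Psi>'[OF that]] using time
      by (simp add: Lv \<iota>_def \<Psi>_def)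
  qed
  \<comment> \<open>The derivative at \<open>0\<close> is
    \<open>Lm v + v $ kv *\<^sub>R V y0\<close>. Its component \<open>k1\<close> sees only the flow
    and forces \<open>v $ kv = 0\<close>; the other components then give
    \<open>v = 0\<close>.\<close>
  have inj: "v = 0" if v: "frechet_derivative \<Psi> (at 0) v = 0" for v
  proof -
    have \<iota>0: "\<iota> 0 = (y0, 0)" "\<iota> 0 \<in> ?Q" using W0 by (auto simp: \<iota>_def L0 W_def)
    have "frechet_derivative \<Psi> (at 0) v = frechet_derivative \<phi> (at (y0, 0)) ((Lm v, 0) + v $ kv *\<^sub>R (0, 1))"
      unfolding frechet_derivative_eqI[OF \<Psi>'[OF W0]] \<iota>0(1) by simp
    also have "\<dots> = Lm v + v $ kv *\<^sub>R V y0"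
      using linear_add[OF D\<phi>[OF \<iota>0(2)]] linear_scale[OF D\<phi>[OF \<iota>0(2)]] time[of y0 0] \<iota>0 space[OF Y(2)] \<phi>0[OF Y(2)]
      by (simp del: add_Pair scaleR_Pair)
    finally have eq: "Lm v + v $ kv *\<^sub>R V y0 = 0" using v by simp
    have "(Lm v + v $ kv *\<^sub>R V y0) $ k1 = v $ kv * V y0 $ k1"
      using \<sigma>(3) by (simp add: Lm_def axis_def)
    then have kv0: "v $ kv = 0" using eq k1 by simp
    then have "v $ \<sigma> i = 0" for i using eq by (simp add: Lm_def vec_eq_iff)
    then show "v = 0" using \<sigma>(1) by (metis bij_pointE vec_eq_iff zero_index)
  qed
  obtain W' V' \<Theta> where W': "open W'" "W' \<subseteq> W" "0 \<in> W'" "open V'" "homeomorphism W' V' \<Psi> \<Theta>" "smooth_on V' \<Theta>"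
    by (rule smooth_inverse_function[OF oW smW W0 inj]) blast
  obtain d where d: "d > 0" "box_at_0 d \<subseteq> W'" by (rule box_at_0_subset[OF W'(1,3)])
  let ?O = "\<Psi> ` box_at_0 d"
  have hom: "homeomorphism (box_at_0 d) ?O \<Psi> \<Theta>"
    by (rule homeomorphism_of_subsets[OF W'(5) d(2)]) (use W'(5) d(2) in \<open>auto simp: homeomorphism_def\<close>)
  have OV: "?O \<subseteq> V'" using W'(5) d(2) unfolding homeomorphism_def by blast
  have "?O = V' \<inter> \<Theta> -` box_at_0 d"
    using W'(5) d(2) OV homeomorphism_apply1[OF W'(5)] homeomorphism_apply2[OF W'(5)]
    by (auto simp: image_iff) (metis)
  then have oO: "open ?O"
    using continuous_open_preimage[OF smooth_on_imp_continuous_on[OF W'(6)] W'(4) open_box_at_0] by simp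
  have bW: "s \<in> W" if "s \<in> box_at_0 d" for s using d W' that by blast
  show thesis
  proof (rule that[OF d(1) oO])
    show "y0 \<in> ?O"
      using d(1) \<phi>0[OF Y(2)] by (intro image_eqI[of _ _ 0]) (auto simp: \<Psi>_def \<iota>_def L0 box_at_0_def)
    show "?O \<subseteq> U" using bW \<phi>U by (auto simp: \<Psi>_def W_def \<iota>_def)
    show "homeomorphism ?O (box_at_0 d) \<Theta> \<Psi>" using hom by (simp add: homeomorphism_symD)
    show "smooth_on ?O \<Theta>" using smooth_on_subset[OF W'(6) OV] .
    show "smooth_on (box_at_0 d) \<Psi>" using smooth_on_subset[OF smW] bW by blast
    show "frechet_derivative \<Psi> (at s) (axis kv 1) = V (\<Psi> s)" if "s \<in> box_at_0 d" for s
      using \<Psi>v[OF bW[OF that]] .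
    fix s :: "real ^ 'd" assume "s \<in> box_at_0 d"
    then have q: "y0 + Lm s \<in> Y" "s $ kv \<in> {-r<..<r}" using bW by (auto simp: W_def \<iota>_def)
    have "norm (\<phi> (y0 + Lm s, s $ kv) $ k0 - \<phi> (y0 + Lm s, 0) $ k0) \<le> 0 * \<bar>s $ kv - 0\<bar>"
    proof (rule norm_diff_le_vector_derivative[of "{-r<..<r}"])
      show "((\<lambda>t. \<phi> (y0 + Lm s, t) $ k0) has_vector_derivative 0) (at t within {-r<..<r})"
        if "t \<in> {-r<..<r}" for t
        using bounded_linear.has_vector_derivative[OF bounded_linear_vec_nth \<phi>[OF q(1) that], of k0]
          k0[OF \<phi>U[OF q(1) that]] has_vector_derivative_at_within by fastforce
    qed (use q r in auto)
    then show "\<Psi> s $ k0 = y0 $ k0 + s $ ku"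
      using \<phi>0[OF q(1)] by (simp add: \<Psi>_def \<iota>_def Lk0)
  qed
qed

lemma bij_two_points:
  assumes "k0 \<noteq> k1" "ku \<noteq> kv"
  obtains \<sigma> :: "'d \<Rightarrow> 'd" where "bij \<sigma>" "\<sigma> k0 = ku" "\<sigma> k1 = kv"
proof -
  let ?t = "Transposition.transpose k0 ku"
  let ?s = "Transposition.transpose (?t k1) kv \<circ> ?t"
  have "?t k1 \<noteq> ku" using assms(1) by (auto simp: Transposition.transpose_def)
  then have "?s k0 = ku" "?s k1 = kv" using assms(2) by (auto simp: Transposition.transpose_def)
  moreover have "bij ?s" by (intro bij_comp bij_transpose)
  ultimately show thesis using that by blast
qed

section \<open>Adapted charts and independence of v\<close>

context lorentz
begin

lemma smooth_grad:
  assumes c: "c \<in> A"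
  shows "smooth_on (chart_image c) (\<lambda>y. matrix_inv (G c y) *v axis k 1)"
proof -
  have "smooth_on (chart_image c) (\<lambda>y. \<chi> i. matrix_inv (G c y) $ i $ k)"
    by (intro smooth_on_vec smooth_on_matrix_inv open_chart_image smooth_gram gram_invertible c)
  moreover have "(\<chi> i. matrix_inv (G c y) $ i $ k) = matrix_inv (G c y) *v axis k 1" for y
    by (simp add: vec_eq_iff matrix_vector_mul_component inner_axis)
  ultimately show ?thesis by (simp only:)
qed

text \<open>In the flow box of the gradient, \<open>\<partial>\<^sub>v\<close> has components
  \<open>V\<close> in \<open>c0\<close>; pairing \<open>V\<close> with a vector gives its component
  \<open>k0\<close> there, which is its component \<open>ku\<close> in the new chart. This single
  identity contains the whole row of the metric that belongs to \<open>v\<close>.\<close>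

lemma adapted_flow_box:
  assumes F: "codim1_foliation X A F" and l: "lightlike X A g F"
    and k: "ku \<noteq> kv" and p: "p \<in> topspace X"
  obtains c d where "c \<in> A" "p \<in> fst c" "d > 0" "chart_image c = box_at_0 d" "foliated_chart X F c ku"
    "\<And>s b. s \<in> box_at_0 d \<Longrightarrow> axis kv 1 \<bullet> (G c s *v b) = b $ ku"
proof -
  obtain c0 k0 where c0: "c0 \<in> A" "p \<in> fst c0" and fol: "foliated_chart X F c0 k0"
    using F p unfolding codim1_foliation_def by blast
  let ?y0 = "snd c0 p" and ?U = "chart_image c0"
  define V where "V y = matrix_inv (G c0 y) *v axis k0 1" for y
  have U: "open ?U" "?y0 \<in> ?U" using open_chart_image[OF c0(1)] in_chart_image[OF c0(2)] by simp_all
  have GV: "G c0 y *v V y = axis k0 1" if "y \<in> ?U" for y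
    using matrix_inv_mul(1)[OF gram_invertible[OF c0(1) that]] by (simp add: V_def matrix_vector_mul_assoc)
  have V0: "V y $ k0 = 0" if "y \<in> ?U" for y
    unfolding V_def by (rule grad_tangent[OF F l c0(1) that fol])
  have "V ?y0 \<noteq> 0"
  proof
    assume "V ?y0 = 0"
    then have "axis k0 (1::real) = 0" using GV[OF U(2)] by simp
    then show False by (simp add: axis_eq_0_iff)
  qed
  then obtain k1 where k1: "V ?y0 $ k1 \<noteq> 0" by (auto simp: vec_eq_iff)
  then have "k0 \<noteq> k1" using V0[OF U(2)] by auto
  then obtain \<sigma> where \<sigma>: "bij \<sigma>" "\<sigma> k0 = ku" "\<sigma> k1 = kv" using bij_two_points k by metis
  obtain d O' \<Psi> \<Theta> where d: "d > 0" and O': "open O'" "?y0 \<in> O'" "O' \<subseteq> ?U"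
    and hom: "homeomorphism O' (box_at_0 d) \<Theta> \<Psi>"
    and sm: "smooth_on O' \<Theta>" "smooth_on (box_at_0 d) \<Psi>"
    and \<Psi>u: "\<And>s. s \<in> box_at_0 d \<Longrightarrow> \<Psi> s $ k0 = ?y0 $ k0 + s $ ku"
    and \<Psi>v: "\<And>s. s \<in> box_at_0 d \<Longrightarrow> frechet_derivative \<Psi> (at s) (axis kv 1) = V (\<Psi> s)"
    by (rule flow_box[OF U smooth_grad[OF c0(1), of k0, folded V_def] V0 k1 \<sigma>]) (assumption | rule that)+
  define c where "c = ({q \<in> fst c0. snd c0 q \<in> O'}, \<Theta> \<circ> snd c0)"
  note cc = chart_change[OF c0(1) hom O'(1,3) open_box_at_0 sm, folded c_def]
  note cA = cc(1) and img = cc(2)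
  have dom: "fst c \<subseteq> fst c0" unfolding c_def by auto
  have pc: "p \<in> fst c" using c0 O' by (simp add: c_def)
  have q0: "snd c0 q = \<Psi> (snd c q)" and qB: "snd c q \<in> box_at_0 d" if "q \<in> fst c" for q
    using that homeomorphism_apply1[OF hom] img in_chart_image[OF that] by (auto simp: c_def)
  have qu: "snd c0 q $ k0 = ?y0 $ k0 + snd c q $ ku" if "q \<in> fst c" for q
    using \<Psi>u[OF qB[OF that]] q0[OF that] by simp
  have Dtr: "Dtr c c0 q = frechet_derivative \<Psi> (at (snd c q))" if "q \<in> fst c" for q
  proof (rule frechet_derivative_eqI)
    show "(transition c c0 has_derivative frechet_derivative \<Psi> (at (snd c q))) (at (snd c q))"
      by (rule has_derivative_transform_within_open[OF smooth_on_has_derivative[OF sm(2) qB[OF that]]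
            open_box_at_0 qB[OF that]]) (simp add: cc(3))
  qed
  have Du: "Dtr c c0 q b $ k0 = b $ ku" if "q \<in> fst c" for q b
  proof -
    let ?s = "snd c q"
    have "((\<lambda>s. \<Psi> s $ k0) has_derivative (\<lambda>b. Dtr c c0 q b $ k0)) (at ?s)"
      unfolding Dtr[OF that]
      by (rule bounded_linear.has_derivative[OF bounded_linear_vec_nth smooth_on_has_derivative[OF sm(2) qB[OF that]]])
    moreover have "((\<lambda>s. \<Psi> s $ k0) has_derivative (\<lambda>b. b $ ku)) (at ?s)"
    proof (rule has_derivative_transform_within_open[OF _ open_box_at_0 qB[OF that]])
      show "((\<lambda>s. ?y0 $ k0 + s $ ku) has_derivative (\<lambda>b. b $ ku)) (at ?s)"
        by (auto intro!: derivative_eq_intros bounded_linear_imp_has_derivative bounded_linear_vec_nth)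
    qed (simp add: \<Psi>u)
    ultimately show ?thesis using has_derivative_unique by metis
  qed
  have metric: "axis kv 1 \<bullet> (G c s *v b) = b $ ku" if "s \<in> box_at_0 d" for s b
  proof -
    let ?q = "cinv c s"
    have q: "?q \<in> fst c" "snd c ?q = s" using cinv_in[of s c] chart_cinv[of s c] that img by auto
    then have q': "?q \<in> fst c0" "snd c0 ?q \<in> ?U" using dom in_chart_image[of ?q c0] by auto
    have "axis kv 1 \<bullet> (G c s *v b) = V (snd c0 ?q) \<bullet> (G c0 (snd c0 ?q) *v Dtr c c0 ?q b)"
      using gram_change[OF cA c0(1) q(1) q'(1), of "axis kv 1" b] \<Psi>v[OF that] Dtr[OF q(1)] q0[OF q(1)] q(2)
      by simp
    also have "\<dots> = Dtr c c0 ?q b \<bullet> axis k0 1"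
      using gram_sym[OF c0(1) q'(2), of "V (snd c0 ?q)" "Dtr c c0 ?q b"] GV[OF q'(2)] by simp
    also have "\<dots> = b $ ku" using Du[OF q(1)] by (simp add: inner_axis)
    finally show ?thesis .
  qed
  \<comment> \<open>Shrinking the domain can in general cut a plaque of \<open>c0\<close> into
    pieces. Here each level of \<open>u\<close> corresponds to a convex slice of the cube, hence is
    connected and forms a single plaque.\<close>
  have "foliated_chart X F c ku"
    unfolding foliated_chart_def
  proof (intro ballI)
    fix L P assume L: "L \<in> F" and P: "P \<in> connected_components_of (subtopology X (fst c \<inter> L))"
    let ?T = "subtopology X (fst c \<inter> L)"
    have Psub: "P \<subseteq> fst c \<inter> L" using connected_components_of_subset[OF P] by auto
    obtain q where q: "q \<in> P" using nonempty_connected_components_of[OF P] by blast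
    have qX: "q \<in> topspace X" "q \<in> fst c" "q \<in> L" using Psub q chart_subset[OF cA] by auto
    let ?Sl = "{q' \<in> fst c. snd c q' $ ku = snd c q $ ku}"
    have SlL: "?Sl \<subseteq> L"
    proof
      fix q' assume q': "q' \<in> ?Sl"
      have "snd c0 q $ k0 = snd c0 q' $ k0" using qu[of q'] qu[OF qX(2)] q' by simp
      then show "q' \<in> L"
        using foliated_chart_leaf[OF fol L _ qX(3,1)] dom qX(2) q' by blast
    qed
    have "convex (box_at_0 d \<inter> {s. axis ku 1 \<bullet> s = snd c q $ ku})"
      by (intro convex_Int convex_box_at_0 convex_hyperplane)
    then have con: "connectedin X (cinv c ` (box_at_0 d \<inter> {s. axis ku 1 \<bullet> s = snd c q $ ku}))"
      using img by (intro connectedin_cinv[OF cA] convex_connected) auto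
    have Sl: "?Sl = cinv c ` (box_at_0 d \<inter> {s. axis ku 1 \<bullet> s = snd c q $ ku})"
    proof
      show "?Sl \<subseteq> cinv c ` (box_at_0 d \<inter> {s. axis ku 1 \<bullet> s = snd c q $ ku})"
      proof
        fix q' assume "q' \<in> ?Sl"
        then show "q' \<in> cinv c ` (box_at_0 d \<inter> {s. axis ku 1 \<bullet> s = snd c q $ ku})"
          using cinv_chart[OF cA] qB by (intro image_eqI[of _ _ "snd c q'"]) (auto simp: inner_axis')
      qed
      show "cinv c ` (box_at_0 d \<inter> {s. axis ku 1 \<bullet> s = snd c q $ ku}) \<subseteq> ?Sl"
        using cinv_in[of _ c] chart_cinv[of _ c] img by (auto simp: inner_axis')
    qed
    have conT: "connectedin ?T ?Sl"
      using con SlL by (auto simp: connectedin_subtopology Sl[symmetric])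
    have "P = connected_component_of_set ?T q"
    proof -
      obtain z where z: "z \<in> topspace ?T" "P = connected_component_of_set ?T z"
        using P unfolding connected_components_of_def by blast
      then show ?thesis using q connected_component_of_equiv[of ?T z q] by auto
    qed
    then have "?Sl \<subseteq> P"
      using connected_component_of_maximal[OF conT, of q] qX(2) by simp
    moreover have "P \<subseteq> ?Sl"
    proof
      fix q' assume q': "q' \<in> P"
      have "connectedin X P"
        using connectedin_connected_components_of[OF P] by (simp add: connectedin_subtopology)
      then have "snd c0 q' $ k0 = snd c0 q $ k0"
        using foliated_chart_constant[OF fol L, of P q' q] Psub dom q q' by blast
      moreover have "q' \<in> fst c" using q' Psub by blast
      ultimately show "q' \<in> ?Sl" using qu[of q'] qu[OF qX(2)] by simp
    qed
    ultimately show "\<exists>r. P = {q' \<in> fst c. snd c q' $ ku = r}" by blast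
  qed
  then show thesis using that[OF cA pc d img _ metric] by blast
qed

text \<open>A leaf may meet the chart in many plaques, so lying in the leaf does not yet fix the
  coordinate \<open>k\<close>; the image of a short time interval is connected and therefore stays
  in one plaque. Differentiating the constant coordinate twice isolates one component of the
  geodesic equation. This yields the quadratic form at \<open>b\<close>, which polarization will
  complete.\<close>

lemma christoffel_tangent_zero:
  assumes F: "codim1_foliation X A F" and tg: "totally_geodesic X A g F"
    and c: "c \<in> A" "p \<in> fst c" "foliated_chart X F c k" and b: "b $ k = 0"
  shows "(\<Sum>i\<in>UNIV. \<Sum>j\<in>UNIV. christoffel A g c k i j (snd c p) * b $ i * b $ j) = 0"
proof -
  obtain r \<gamma> v a where r: "r > 0" and geo: "geodesic X A g {-r<..<r} \<gamma>" and \<gamma>0: "\<gamma> 0 = p"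
    and vel: "velocity A \<gamma> 0 = tvec A c p b" and \<gamma>c: "\<And>t. t \<in> {-r<..<r} \<Longrightarrow> \<gamma> t \<in> fst c"
    and v: "\<And>t. t \<in> {-r<..<r} \<Longrightarrow> ((\<lambda>t. snd c (\<gamma> t)) has_vector_derivative v t) (at t)"
    and "v 0 = b" and a: "(v has_vector_derivative a) (at 0)"
    and ak: "\<And>k. a $ k = - (\<Sum>i\<in>UNIV. \<Sum>j\<in>UNIV. christoffel A g c k i j (snd c p) * b $ i * b $ j)"
    by (rule geodesic_existence[OF c(1,2), of b]) blast
  have "p \<in> topspace X" using chart_subset c by blast
  then obtain L where L: "L \<in> F" "p \<in> L"
    using F unfolding codim1_foliation_def partition_on_def by blast
  have "velocity A \<gamma> 0 \<in> foliation_tangent X A F p"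
    unfolding foliation_tangent_eq[OF F c] vel using tvec_in[OF c(1,2)] tvec_self[OF c(1,2)] b by simp
  then obtain \<delta> where \<delta>: "\<delta> > 0" "\<And>t. t \<in> {-r<..<r} \<Longrightarrow> \<bar>t - 0\<bar> < \<delta> \<Longrightarrow> \<gamma> t \<in> L"
    using tg geo L r \<gamma>0 unfolding totally_geodesic_def
    by (metis greaterThanLessThan_iff neg_less_0_iff_less)
  define e where "e = min r \<delta>"
  have e: "e > 0" using r \<delta> by (simp add: e_def)
  let ?J = "{-e<..<e}"
  have Jr: "t \<in> {-r<..<r}" "\<gamma> t \<in> L" if "t \<in> ?J" for t using that \<delta>(2)[of t] by (auto simp: e_def)
  have "continuous_map (top_of_set {-r<..<r}) X \<gamma>"
    using geo unfolding geodesic_def smooth_curve_def by blast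
  then have con: "connectedin X (\<gamma> ` ?J)"
    by (rule connectedin_continuous_map_image) (use Jr in \<open>auto simp: connectedin_subtopology\<close>)
  have const: "snd c (\<gamma> t) $ k = snd c (\<gamma> 0) $ k" if "t \<in> ?J" for t
  proof (rule foliated_chart_constant[OF c(3) L(1) con])
    show "\<gamma> ` ?J \<subseteq> fst c \<inter> L" using Jr \<gamma>c by blast
    show "\<gamma> t \<in> \<gamma> ` ?J" "\<gamma> 0 \<in> \<gamma> ` ?J" using that e by auto
  qed
  have oJ: "open ?J" by simp
  have vk: "v t $ k = 0" if "t \<in> ?J" for t
  proof -
    have "((\<lambda>t. snd c (\<gamma> t) $ k) has_vector_derivative v t $ k) (at t)"
      by (rule bounded_linear.has_vector_derivative[OF bounded_linear_vec_nth v[OF Jr(1)[OF that]]])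
    moreover have "((\<lambda>t. snd c (\<gamma> t) $ k) has_vector_derivative 0) (at t)"
      by (rule has_vector_derivative_transform_within_open[OF
            has_vector_derivative_const[of "snd c (\<gamma> 0) $ k"] oJ that]) (rule const[symmetric])
    ultimately show ?thesis by (rule vector_derivative_unique_at)
  qed
  have "((\<lambda>t. v t $ k) has_vector_derivative a $ k) (at 0)"
    by (rule bounded_linear.has_vector_derivative[OF bounded_linear_vec_nth a])
  moreover have "((\<lambda>t. v t $ k) has_vector_derivative 0) (at 0)"
    by (rule has_vector_derivative_transform_within_open[OF has_vector_derivative_const[of "0 :: real"] oJ])
      (use e vk in auto)
  ultimately have "a $ k = 0" by (rule vector_derivative_unique_at)
  then show ?thesis using ak[of k] by simp
qed

text \<open>In the chart of the flow box, \<open>\<Gamma>\<^sup>u\<^sub>i\<^sub>j\<close> reduces to \<open>-1/2 \<partial>\<^sub>v g\<^sub>i\<^sub>j\<close>.\<close>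

lemma gram_independent_of_v:
  assumes F: "codim1_foliation X A F" and tg: "totally_geodesic X A g F"
    and c: "c \<in> A" "foliated_chart X F c ku" "chart_image c = box_at_0 d"
    and metric: "\<And>s b. s \<in> box_at_0 d \<Longrightarrow> axis kv 1 \<bullet> (G c s *v b) = b $ ku"
    and ij: "i \<noteq> ku" "j \<noteq> ku"
  shows "independent_of_coord kv (chart_image c) (\<lambda>s. G c s $ i $ j)"
proof -
  \<comment> \<open>The row of \<open>v\<close> is constant over the chart. This is used both to
    read off the upper index \<open>u\<close> and to kill the derivatives of the metric paired with
    \<open>\<partial>\<^sub>v\<close>.\<close>
  have Gv: "G c s *v axis kv 1 = axis ku 1" if "s \<in> chart_image c" for s
  proof -
    have "axis l 1 \<bullet> (G c s *v axis kv 1) = axis ku 1 $ l" for l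
      using gram_sym[OF c(1) that, of "axis l 1" "axis kv 1"] metric[of s "axis l 1"] that c(3)
      by (simp add: axis_def)
    then show ?thesis by (simp add: vec_eq_iff inner_axis')
  qed
  have dGv: "dG c s u *v axis kv 1 = 0" if "s \<in> chart_image c" for s u
  proof -
    have "((\<lambda>s. G c s *v axis kv 1) has_derivative (\<lambda>u. dG c s u *v axis kv 1)) (at s)"
      by (rule bounded_linear.has_derivative[OF
          bounded_bilinear.bounded_linear_left[OF bounded_bilinear_matrix_vector]
          smooth_on_has_derivative[OF smooth_gram[OF c(1)] that]])
    moreover have "((\<lambda>s. G c s *v axis kv 1) has_derivative (\<lambda>u. 0)) (at s)"
      by (rule has_derivative_transform_within_open[OF has_derivative_const open_chart_image[OF c(1)] that])
        (simp add: Gv)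
    ultimately show ?thesis using has_derivative_unique by metis
  qed
  \<comment> \<open>Since the Gram matrix maps \<open>axis kv 1\<close> to \<open>axis ku 1\<close>,
    the component \<open>u\<close> of the raised form is the component \<open>v\<close> of the
    lowered one; by \<open>dGv\<close> only the derivative in the direction
    \<open>\<partial>\<^sub>v\<close> survives in it.\<close>
  have quad: "b \<bullet> (dG c s (axis kv 1) *v b) = 0" if s: "s \<in> chart_image c" and b: "b $ ku = 0" for s b
  proof -
    let ?S = "christoffel_form c s b" and ?I = "matrix_inv (G c s)"
    have q: "cinv c s \<in> fst c" "snd c (cinv c s) = s" using cinv_in chart_cinv s by blast+
    have "0 = axis ku 1 \<bullet> (?I *v ?S)"
      using christoffel_tangent_zero[OF F tg c(1) q(1) c(2) b] christoffel_contracted[OF c(1) s, of ku b] q(2)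
      by (simp add: inner_axis')
    also have "\<dots> = axis kv 1 \<bullet> (G c s *v (?I *v ?S))"
      using gram_sym[OF c(1) s, of "axis kv 1" "?I *v ?S"] Gv[OF s] by (simp add: inner_commute)
    also have "\<dots> = axis kv 1 \<bullet> ?S"
      using matrix_inv_mul(1)[OF gram_invertible[OF c(1) s]] by (simp add: matrix_vector_mul_assoc)
    also have "\<dots> = - 1/2 * (b \<bullet> (dG c s (axis kv 1) *v b))"
      unfolding inner_christoffel_form[OF c(1) s] dGv[OF s] by simp
    finally show ?thesis by simp
  qed
  have dsym: "dG c s u $ i $ j = dG c s u $ j $ i" if s: "s \<in> chart_image c" for s u i j
  proof -
    note d = smooth_on_has_derivative[OF smooth_gram[OF c(1)] s]
    have e: "((\<lambda>s. G c s $ i $ j) has_derivative (\<lambda>u. dG c s u $ i $ j)) (at s)" for i j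
      using bounded_linear.has_derivative[OF bounded_linear_vec_nth
          bounded_linear.has_derivative[OF bounded_linear_vec_nth d]] .
    have "((\<lambda>s. G c s $ i $ j) has_derivative (\<lambda>u. dG c s u $ j $ i)) (at s)"
      by (rule has_derivative_transform_within_open[OF e open_chart_image[OF c(1)] s])
        (rule gram_sym_nth[OF c(1)])
    from fun_cong[OF has_derivative_unique[OF e this]] show ?thesis .
  qed
  \<comment> \<open>Polarization with \<open>axis i 1\<close>, \<open>axis j 1\<close> and their
    sum, all tangent to the leaves as \<open>i\<close> and \<open>j\<close> differ from
    \<open>ku\<close>.\<close>
  have zero: "dG c s (axis kv 1) $ i $ j = 0" if s: "s \<in> chart_image c" for s
  proof -
    let ?M = "dG c s (axis kv 1)"
    have q: "?M $ i $ i = 0" "?M $ j $ j = 0"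
      using quad[OF s, of "axis i 1"] quad[OF s, of "axis j 1"] ij gram_nth[of _ ?M]
      by (simp_all add: axis_def)
    have "(axis i 1 + axis j 1) \<bullet> (?M *v (axis i 1 + axis j 1)) = 0"
      using ij by (intro quad[OF s]) (simp add: axis_def)
    then have "?M $ i $ i + ?M $ i $ j + (?M $ j $ i + ?M $ j $ j) = 0"
      by (simp only: inner_add_left inner_add_right matrix_vector_right_distrib gram_nth)
    then show ?thesis using q dsym[OF s, of "axis kv 1" i j] by simp
  qed
  show ?thesis
    unfolding independent_of_coord_def
  proof (intro ballI impI)
    fix y z assume y: "y \<in> chart_image c" and z: "z \<in> chart_image c" and yz: "\<forall>l. l \<noteq> kv \<longrightarrow> y $ l = z $ l"
    define h where "h = z $ kv - y $ kv"
    have zy: "z = y + h *\<^sub>R axis kv 1" using yz by (auto simp: vec_eq_iff axis_def h_def)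
    \<comment> \<open>The segment between two points that differ only in \<open>v\<close> stays in
      the convex cube, so the vanishing derivative can be integrated along it.\<close>
    have in_img: "y + (t * h) *\<^sub>R axis kv 1 \<in> chart_image c" if "t \<in> {0..1}" for t
    proof -
      have "(1 - t) *\<^sub>R y + t *\<^sub>R z \<in> chart_image c"
        using convexD_alt[OF convex_box_at_0] y z c(3) that by auto
      moreover have "(1 - t) *\<^sub>R y + t *\<^sub>R z = y + (t * h) *\<^sub>R axis kv 1" by (simp add: zy algebra_simps)
      ultimately show ?thesis by simp
    qed
    have "norm (G c (y + (1 * h) *\<^sub>R axis kv 1) $ i $ j - G c (y + (0 * h) *\<^sub>R axis kv 1) $ i $ j) \<le> 0 * \<bar>1 - 0\<bar>"
    proof (rule norm_diff_le_vector_derivative[of "{0..1}" "\<lambda>t. G c (y + (t * h) *\<^sub>R axis kv 1) $ i $ j"])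
      fix t :: real assume t: "t \<in> {0..1}"
      let ?s = "y + (t * h) *\<^sub>R axis kv 1"
      have 1: "((\<lambda>t. y + (t * h) *\<^sub>R axis kv 1) has_derivative (\<lambda>d. (d * h) *\<^sub>R axis kv 1)) (at t)"
        by (auto intro!: derivative_eq_intros)
      note d = smooth_on_has_derivative[OF smooth_gram[OF c(1)] in_img[OF t]]
      from bounded_linear.has_derivative[OF bounded_linear_vec_nth
          bounded_linear.has_derivative[OF bounded_linear_vec_nth has_derivative_compose[OF 1 d]]]
      have "((\<lambda>t. G c (y + (t * h) *\<^sub>R axis kv 1) $ i $ j) has_derivative
        (\<lambda>d. dG c ?s ((d * h) *\<^sub>R axis kv 1) $ i $ j)) (at t)" .
      moreover have "dG c ?s ((d * h) *\<^sub>R axis kv 1) $ i $ j = 0" for d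
        using linear_scale[OF has_derivative_linear[OF d]] zero[OF in_img[OF t]] by simp
      ultimately show "((\<lambda>t. G c (y + (t * h) *\<^sub>R axis kv 1) $ i $ j) has_vector_derivative 0) (at t within {0..1})"
        by (simp add: has_vector_derivative_def has_derivative_at_withinI)
    qed auto
    then show "G c y $ i $ j = G c z $ i $ j" by (simp add: zy)
  qed
qed

end

section \<open>The normal form of the metric\<close>

text \<open>Separates \<open>u\<close> and \<open>v\<close> from the rest. The index
  \<open>i + 1\<close> reflects that the coordinates \<open>x\<close> are counted from
  \<open>1\<close> while their numbers begin at \<open>2\<close>.\<close>

lemma sum_numbered_coords:
  fixes f :: "'d::finite \<Rightarrow> real" and idx :: "nat \<Rightarrow> 'd"
  assumes "bij_betw idx {..<n + 2} (UNIV :: 'd set)"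
  shows "(\<Sum>a\<in>UNIV. f a) = f (idx 0) + f (idx 1) + (\<Sum>i=1..n. f (idx (i + 1)))"
proof -
  have "(\<Sum>a\<in>UNIV. f a) = (\<Sum>i<n + 2. f (idx i))"
    using sum.reindex_bij_betw[OF assms, of f] by simp
  also have "\<dots> = f (idx 0) + (f (idx 1) + (\<Sum>i<n. f (idx (Suc (Suc i)))))"
    by (simp add: sum.lessThan_Suc_shift del: sum.lessThan_Suc)
  also have "(\<Sum>i<n. f (idx (Suc (Suc i)))) = (\<Sum>i=1..n. f (idx (i + 1)))"
    by (simp add: sum.atLeast1_atMost_eq)
  finally show ?thesis by simp
qed

theorem proposition4p1:
  fixes X :: "'m topology"
    and A :: "('m, 'd::finite) chart set"
    and g :: "('m, 'd) metric"
    and F :: "'m set set"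
    and n :: nat
    and idx :: "nat \<Rightarrow> 'd"
      \<comment> \<open>\<open>idx 0\<close>, \<open>idx 1\<close>, \<open>idx (i + 1)\<close> number the coordinates \<open>u\<close>, \<open>v\<close>, \<open>x\<^sup>i\<close> for \<open>1 \<le> i \<le> n\<close>\<close>
  assumes "CARD('d) = n + 2"
    and "bij_betw idx {..<n + 2} UNIV"
    and "smooth_manifold X A"
    and "lorentzian_metric X A g"
    and "codim1_foliation X A F"
    and "lightlike X A g F"
    and "totally_geodesic X A g F"
    and "orientable_distribution X A (n + 2) (tangent_space A)"
    and "orientable_distribution X A (n + 1) (foliation_tangent X A F)"
    and "orientable_distribution X A 1 (foliation_normal X A g F)"
  shows "\<forall>p\<in>topspace X. \<exists>c\<in>A. p \<in> fst c \<and>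
    adapted_chart X A g F c (idx 0) (idx 1) \<and>
    (\<exists>(H :: real ^ 'd \<Rightarrow> real) (W :: nat \<Rightarrow> real ^ 'd \<Rightarrow> real) (h :: nat \<Rightarrow> nat \<Rightarrow> real ^ 'd \<Rightarrow> real).
       smooth_on (chart_image c) H \<and>
       (\<forall>i\<in>{1..n}. smooth_on (chart_image c) (W i)) \<and>
       (\<forall>i\<in>{1..n}. \<forall>j\<in>{1..n}. smooth_on (chart_image c) (h i j) \<and>
          independent_of_coord (idx 1) (chart_image c) (h i j)) \<and>
       (\<forall>q\<in>fst c. \<forall>\<xi>\<in>tangent_space A q. \<forall>\<eta>\<in>tangent_space A q.
          let y = snd c q;
              du = coord_differential c (idx 0);
              dv = coord_differential c (idx 1);
              dx = (\<lambda>i. coord_differential c (idx (i + 1)))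
          in g q \<xi> \<eta> = 2 * sym_prod du dv \<xi> \<eta> + H y * sym_prod du du \<xi> \<eta>
               + (\<Sum>i=1..n. W i y * sym_prod du (dx i) \<xi> \<eta>)
               + (\<Sum>i=1..n. \<Sum>j=1..n. h i j y * sym_prod (dx i) (dx j) \<xi> \<eta>)))"
proof
  fix p assume p: "p \<in> topspace X"
  interpret lorentz X A g
    using assms(3,4) by unfold_locales (simp add: smooth_manifold_def)
  let ?u = "idx 0" and ?v = "idx 1" and ?x = "\<lambda>i. idx (i + 1)"
  note inj = bij_betw_imp_inj_on[OF assms(2)]
  have uv: "?u \<noteq> ?v" using inj_onD[OF inj, of 0 1] by auto
  have xu: "?x i \<noteq> ?u" and xv: "?x i \<noteq> ?v" if "i \<in> {1..n}" for i
    using inj_onD[OF inj, of "i + 1" 0] inj_onD[OF inj, of "i + 1" 1] that by auto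
  obtain c d where c: "c \<in> A" "p \<in> fst c" and img: "chart_image c = box_at_0 d"
    and fol: "foliated_chart X F c ?u"
    and metric: "\<And>s b. s \<in> box_at_0 d \<Longrightarrow> axis ?v 1 \<bullet> (G c s *v b) = b $ ?u"
    by (rule adapted_flow_box[OF assms(5,6) uv p]) blast
  define H where "H y = G c y $ ?u $ ?u" for y
  \<comment> \<open>The symmetric product \<open>du dx^i\<close> carries a factor
    \<open>1/2\<close>, while the metric contains both the entry at \<open>u\<close>,
    \<open>x^i\<close> and its transpose.\<close>
  define W where "W i y = 2 * G c y $ ?u $ ?x i" for i y
  define h where "h i j y = G c y $ ?x i $ ?x j" for i j y
  note o = open_chart_image[OF c(1)]
  have sm: "smooth_on (chart_image c) (\<lambda>y. G c y $ a $ b)" for a b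
    by (intro smooth_on_nth o smooth_gram c)
  have adapted: "adapted_chart X A g F c ?u ?v"
    unfolding adapted_chart_def
  proof (intro conjI ballI fol)
    fix q assume q: "q \<in> fst c"
    have "g q (tvec A c q (axis ?v 1)) \<eta> = 0" if "\<eta> \<in> foliation_tangent X A F q" for \<eta>
    proof -
      have \<eta>: "\<eta> \<in> tangent_space A q" "\<eta> c $ ?u = 0"
        using that foliation_tangent_eq[OF assms(5) c(1) q fol] by auto
      show ?thesis
        using metric_expansion[OF c(1) q tvec_in[OF c(1) q] \<eta>(1)] metric[of "snd c q" "\<eta> c"]
          \<eta>(2) in_chart_image[OF q] img by (simp add: tvec_self[OF c(1) q])
    qed
    then show "coord_vector A c ?v q \<in> foliation_normal X A g F q"
      unfolding foliation_normal_def coord_vector_eq_tvec using tvec_in[OF c(1) q] by blast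
  qed
  have formula: "g q \<xi> \<eta> = 2 * sym_prod du dv \<xi> \<eta> + H y * sym_prod du du \<xi> \<eta>
       + (\<Sum>i=1..n. W i y * sym_prod du (dx i) \<xi> \<eta>)
       + (\<Sum>i=1..n. \<Sum>j=1..n. h i j y * sym_prod (dx i) (dx j) \<xi> \<eta>)"
    if q: "q \<in> fst c" and \<xi>: "\<xi> \<in> tangent_space A q" and \<eta>: "\<eta> \<in> tangent_space A q"
      and defs: "y = snd c q" "du = coord_differential c ?u" "dv = coord_differential c ?v"
        "dx = (\<lambda>i. coord_differential c (?x i))" for q \<xi> \<eta> y du dv dx
  proof -
    let ?G = "G c y" and ?a = "\<xi> c" and ?b = "\<eta> c"
    have y: "y \<in> chart_image c" using in_chart_image[OF q] defs by simp
    note sym = gram_sym_nth[OF c(1) y]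
    \<comment> \<open>The only nonzero entry in the row of \<open>v\<close> is \<open>1\<close>, at
      \<open>u\<close>: the source of \<open>2 du dv\<close> and of the absence of other terms in
      \<open>dv\<close>.\<close>
    have Gv: "?G $ ?v $ j = (if j = ?u then 1 else 0)" for j
      using metric[of y "axis j 1"] y img unfolding gram_nth by (simp add: axis_def eq_commute)
    then have Gv': "?G $ j $ ?v = (if j = ?u then 1 else 0)" for j using sym[of j ?v] by simp
    have Gxu: "?G $ ?x i $ ?u = ?G $ ?u $ ?x i" for i by (rule sym)
    have "g q \<xi> \<eta> = (\<Sum>k\<in>UNIV. ?a $ k * (\<Sum>l\<in>UNIV. ?G $ k $ l * ?b $ l))"
      unfolding metric_expansion[OF c(1) q \<xi> \<eta>] defs(1)[symmetric]
      by (simp add: inner_vec_def matrix_vector_mult_def)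
    also have "\<dots> = ?a $ ?u * (H y * ?b $ ?u + ?b $ ?v + (\<Sum>j=1..n. ?G $ ?u $ ?x j * ?b $ ?x j))
      + ?a $ ?v * ?b $ ?u
      + (\<Sum>i=1..n. ?a $ ?x i * (?G $ ?u $ ?x i * ?b $ ?u + (\<Sum>j=1..n. h i j y * ?b $ ?x j)))"
    proof -
      have r: "(\<Sum>l\<in>UNIV. ?G $ k $ l * ?b $ l)
        = ?G $ k $ ?u * ?b $ ?u + ?G $ k $ ?v * ?b $ ?v + (\<Sum>j=1..n. ?G $ k $ ?x j * ?b $ ?x j)" for k
        by (rule sum_numbered_coords[OF assms(2)])
      have z: "(\<Sum>j=1..n. ?G $ ?v $ ?x j * ?b $ ?x j) = 0" using xu by (intro sum.neutral) (simp add: Gv del: One_nat_def)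
      show ?thesis
        unfolding sum_numbered_coords[OF assms(2), of "\<lambda>k. ?a $ k * (\<Sum>l\<in>UNIV. ?G $ k $ l * ?b $ l)"]
        unfolding r z using uv xu xv by (simp add: Gv Gv' Gxu H_def h_def del: One_nat_def)
    qed
    also have "\<dots> = (?a $ ?u * ?b $ ?v + ?a $ ?v * ?b $ ?u) + H y * (?a $ ?u * ?b $ ?u)
      + (\<Sum>i=1..n. ?G $ ?u $ ?x i * (?a $ ?u * ?b $ ?x i + ?a $ ?x i * ?b $ ?u))
      + (\<Sum>i=1..n. \<Sum>j=1..n. h i j y * (?a $ ?x i * ?b $ ?x j))"
      by (simp add: sum.distrib sum_distrib_left algebra_simps)
    also have "(\<Sum>i=1..n. \<Sum>j=1..n. h i j y * (?a $ ?x i * ?b $ ?x j))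
      = (\<Sum>i=1..n. \<Sum>j=1..n. h i j y * sym_prod (dx i) (dx j) \<xi> \<eta>)"
    proof -
      \<comment> \<open>\<open>h\<close> is symmetric, so replacing the products of components by
        their symmetrizations does not change the double sum.\<close>
      have sw: "(\<Sum>i=1..n. \<Sum>j=1..n. h i j y * (?a $ ?x j * ?b $ ?x i))
        = (\<Sum>i=1..n. \<Sum>j=1..n. h i j y * (?a $ ?x i * ?b $ ?x j))"
        by (subst sum.swap) (simp add: h_def sym)
      have "(\<Sum>i=1..n. \<Sum>j=1..n. h i j y * sym_prod (dx i) (dx j) \<xi> \<eta>)
        = (\<Sum>i=1..n. \<Sum>j=1..n. 1/2 * (h i j y * (?a $ ?x i * ?b $ ?x j))
            + 1/2 * (h i j y * (?a $ ?x j * ?b $ ?x i)))"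
        by (intro sum.cong refl) (simp add: sym_prod_def defs coord_differential_def field_simps)
      also have "\<dots> = 1/2 * (\<Sum>i=1..n. \<Sum>j=1..n. h i j y * (?a $ ?x i * ?b $ ?x j))
        + 1/2 * (\<Sum>i=1..n. \<Sum>j=1..n. h i j y * (?a $ ?x j * ?b $ ?x i))"
        by (simp only: sum.distrib sum_distrib_left)
      finally show ?thesis unfolding sw by simp
    qed
    finally show ?thesis
      by (simp add: sym_prod_def defs coord_differential_def W_def mult.commute mult.left_commute)
  qed
  show "\<exists>c\<in>A. p \<in> fst c \<and>
    adapted_chart X A g F c (idx 0) (idx 1) \<and>
    (\<exists>(H :: real ^ 'd \<Rightarrow> real) (W :: nat \<Rightarrow> real ^ 'd \<Rightarrow> real) (h :: nat \<Rightarrow> nat \<Rightarrow> real ^ 'd \<Rightarrow> real).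
       smooth_on (chart_image c) H \<and>
       (\<forall>i\<in>{1..n}. smooth_on (chart_image c) (W i)) \<and>
       (\<forall>i\<in>{1..n}. \<forall>j\<in>{1..n}. smooth_on (chart_image c) (h i j) \<and>
          independent_of_coord (idx 1) (chart_image c) (h i j)) \<and>
       (\<forall>q\<in>fst c. \<forall>\<xi>\<in>tangent_space A q. \<forall>\<eta>\<in>tangent_space A q.
          let y = snd c q;
              du = coord_differential c (idx 0);
              dv = coord_differential c (idx 1);
              dx = (\<lambda>i. coord_differential c (idx (i + 1)))
          in g q \<xi> \<eta> = 2 * sym_prod du dv \<xi> \<eta> + H y * sym_prod du du \<xi> \<eta>
               + (\<Sum>i=1..n. W i y * sym_prod du (dx i) \<xi> \<eta>)
               + (\<Sum>i=1..n. \<Sum>j=1..n. h i j y * sym_prod (dx i) (dx j) \<xi> \<eta>)))"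
  proof (intro bexI[of _ c] conjI exI[of _ H] exI[of _ W] exI[of _ h] ballI c adapted)
    show "smooth_on (chart_image c) H" unfolding H_def[abs_def] by (rule sm)
    show "smooth_on (chart_image c) (W i)" for i
      unfolding W_def[abs_def] by (rule smooth_on_mult[OF o smooth_on_const sm])
    show "smooth_on (chart_image c) (h i j)" for i j unfolding h_def[abs_def] by (rule sm)
    show "independent_of_coord ?v (chart_image c) (h i j)" if "i \<in> {1..n}" "j \<in> {1..n}" for i j
      unfolding h_def[abs_def]
      using gram_independent_of_v[OF assms(5,7) c(1) fol img metric xu[OF that(1)] xu[OF that(2)]] .
  qed (unfold Let_def, rule formula[OF _ _ _ refl refl refl refl])
qed

end
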